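(* Let $E\subset\mathbb{R}$ be a nonempty set and let $\alpha>0$. Then $d_E^{\,-\alpha}\in A_p^+$ for some $1<p<\infty$ if and only if $\alpha<\mathrm{Mu}_\infty^+(E)$.
   Context: Lebesgue measure on $\mathbb{R}$ is denoted $|\cdot|$. Throughout, $I=(a,b)$ with $a<b$ real denotes a bounded open interval; $I^-=(a,\frac{a+b}{2})$ and $I^+=(\frac{a+b}{2},b)$. $d_E(x)=\inf\{|x-y|:y\in E\}$; $d_E^{\,-\alpha}(x)=d_E(x)^{-\alpha}$, equal to $+\infty$ where $d_E(x)=0$. For $r>0$, $E_r=\{x\in\mathbb{R}:d_E(x)<r\}$. A weight on $\mathbb{R}$ is a locally integrable function $w:\mathbb{R}\to[0,\infty]$ with $w>0$ a.e. For $1<p<\infty$, a weight $w$ belongs to $A_p^+$ if $$\sup_{I\subset\mathbb{R}}\Big(\frac{1}{|I^-|}\int_{I^-}w\Big)\Big(\frac{1}{|I^+|}\int_{I^+}w^{-1/(p-1)}\Big)^{p-1}<\infty.$$ The statement $d_E^{\,-\alpha}\in A_p^+$ includes the assertion that $d_E^{\,-\alpha}$ is a weight. For $0<s\le1$, $L_s(E,I)$ is the supremum of all $\ell>0$ for which there exist an integer $k\ge1$ and disjoint open intervals $I_1,\dots,I_k\subset I\setminus E$ with $|I_i|\ge\ell$ for all $i$ and $\sum_{i=1}^k|I_i|\ge(1-s)|I|$; if no such $\ell$ exists, $L_s(E,I)=0$. One-sided $\infty$-Muckenhoupt exponent: if $L_s(E,I)=0$ for some $0<s<1$ and some bounded open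 interval $I$, set $\mathrm{Mu}_\infty^+(E)=0$. Otherwise $\mathrm{Mu}_\infty^+(E)$ is the supremum of all $\alpha\ge0$ for which there exist $0<s<1$ and $C>0$ such that, for every bounded open interval $I$ centred at a point of $E$ and every $0<r\le L_s(E,I^+)$, $$\frac{|I^-\cap E_r|}{|I^-|}\le C\Big(\frac{r}{L_s(E,I^+)}\Big)^\alpha.$$ *)

theory Defs
  imports "HOL-Analysis.Analysis"
begin

text \<open>
  A bounded open interval \<open>I = (a,b)\<close> is given by its endpoints \<open>a < b\<close>; thus \<open>I\<^sup>-\<close> is
  \<open>{a<..<(a+b)/2}\<close> and \<open>I\<^sup>+\<close> is \<open>{(a+b)/2<..<b}\<close>, both of length \<open>(b-a)/2\<close>.
  The distance \<open>d\<^sub>E(x)\<close> is \<open>infdist x E\<close>, which is the intended infimum only for nonempty \<open>E\<close>.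
\<close>

text \<open>
  Real powers on \<open>[0,\<infinity>]\<close>, with \<open>0\<close> and \<open>\<infinity>\<close> exchanged by negative exponents. (Plain \<open>powr\<close>
  on the reals would give \<open>0 powr a = 0\<close> for every \<open>a\<close>.)
\<close>
definition ennpowr :: "ennreal \<Rightarrow> real \<Rightarrow> ennreal" where
  "ennpowr x a =
     (if a = 0 then 1
      else if x = 0 then (if a > 0 then 0 else \<infinity>)
      else if x = \<infinity> then (if a > 0 then \<infinity> else 0)
      else ennreal (enn2real x powr a))"

definition dist_weight :: "real set \<Rightarrow> real \<Rightarrow> real \<Rightarrow> ennreal" where
  "dist_weight E \<alpha> x =
     (if infdist x E = 0 then \<infinity> else ennreal (infdist x E powr (- \<alpha>)))"

definition nbhd :: "real set \<Rightarrow> real \<Rightarrow> real set" where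
  "nbhd E r = {x. infdist x E < r}"

definition weight :: "(real \<Rightarrow> ennreal) \<Rightarrow> bool" where
  "weight w \<longleftrightarrow>
     w \<in> borel_measurable lebesgue \<and>
     (\<forall>K. compact K \<longrightarrow> (\<integral>\<^sup>+x\<in>K. w x \<partial>lebesgue) < \<infinity>) \<and>
     (AE x in lebesgue. w x > 0)"

definition Ap_plus :: "real \<Rightarrow> (real \<Rightarrow> ennreal) set" where
  "Ap_plus p = {w. weight w \<and>
     (SUP (a, b) \<in> {(a, b). a < b}.
        ((\<integral>\<^sup>+x\<in>{a<..<(a+b)/2}. w x \<partial>lebesgue) / emeasure lebesgue {a<..<(a+b)/2}) *
        ennpowr
          ((\<integral>\<^sup>+x\<in>{(a+b)/2<..<b}. ennpowr (w x) (- 1 / (p - 1)) \<partial>lebesgue)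
             / emeasure lebesgue {(a+b)/2<..<b})
          (p - 1)) < \<infinity>}"

definition admissible_length :: "real \<Rightarrow> real set \<Rightarrow> real \<Rightarrow> real \<Rightarrow> real \<Rightarrow> bool" where
  "admissible_length s E a b l \<longleftrightarrow>
     (\<exists>k\<ge>1. \<exists>u v :: nat \<Rightarrow> real.
        disjoint_family_on (\<lambda>i. {u i<..<v i}) {1..k} \<and>
        (\<forall>i\<in>{1..k}. {u i<..<v i} \<subseteq> {a<..<b} - E \<and> l \<le> v i - u i) \<and>
        (1 - s) * (b - a) \<le> (\<Sum>i=1..k. v i - u i))"

text \<open>
  \<open>L_s s E a b\<close> is \<open>L\<^sub>s(E,(a,b))\<close>. Admissible positive lengths are at most \<open>b - a\<close>, so the real
  supremum is the true one.
\<close>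
definition L_s :: "real \<Rightarrow> real set \<Rightarrow> real \<Rightarrow> real \<Rightarrow> real" where
  "L_s s E a b =
     (if \<exists>l>0. admissible_length s E a b l
      then Sup {l. l > 0 \<and> admissible_length s E a b l} else 0)"

definition Mu_inf_plus :: "real set \<Rightarrow> ereal" where
  "Mu_inf_plus E =
     (if \<exists>s a b. 0 < s \<and> s < 1 \<and> a < b \<and> L_s s E a b = 0 then 0
      else Sup {ereal \<alpha> | \<alpha>. \<alpha> \<ge> 0 \<and>
        (\<exists>s C. 0 < s \<and> s < 1 \<and> C > 0 \<and>
          (\<forall>a b r. a < b \<and> (a + b) / 2 \<in> E \<and> 0 < r \<and> r \<le> L_s s E ((a+b)/2) b \<longrightarrow>
             measure lebesgue ({a<..<(a+b)/2} \<inter> nbhd E r) / measure lebesgue {a<..<(a+b)/2}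
               \<le> C * (r / L_s s E ((a+b)/2) b) powr \<alpha>))})"

end

theory Submission
  imports Defs
begin

text \<open>
  Put \<open>d x = infdist x E\<close> and \<open>w x = d x powr (- \<alpha>)\<close>. Both sides of the equivalence force the closure
  of \<open>E\<close> to be a null set and \<open>w\<close> to be locally integrable, and both lead to a one-sided \<open>A\<^sub>\<infinity>\<close>
  condition on \<open>w\<close> (the predicate \<open>A_inf\<close>), which gives back more than was put in. It asks for
  \<open>\<beta>, s > 0\<close> such that, whenever the average of \<open>w\<close> over \<open>(m-h, m)\<close> is at least \<open>l\<close>, the set
  \<open>{w \<ge> \<beta> l}\<close> fills at least the proportion \<open>s\<close> of \<open>(m, m+h)\<close>.

  The link with gap lengths is that \<open>L\<^sub>s(E,I)\<close> measures, up to constants, the distance \<open>\<rho>\<close> such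
  that a fixed proportion of \<open>I\<close> lies within \<open>\<rho>\<close> of \<open>E\<close>, hence in \<open>{w \<ge> \<rho> powr (- \<alpha>)}\<close>
  (\<open>admissible_length_far\<close>, \<open>admissible_length_of_far_set\<close>). If the decay in the definition of the
  exponent holds with some \<open>q > \<alpha>\<close>, summing over the layers \<open>{d < r}\<close> bounds the average of \<open>w\<close> on
  \<open>I\<^sup>-\<close> by a multiple of \<open>L\<^sub>s(E,I\<^sup>+) powr (- \<alpha>)\<close> for intervals centred on the closure of \<open>E\<close>. For
  other centres one moves to a nearby point of the closure, or crosses a gap, in which \<open>w\<close> is
  explicit (\<open>integral_left_bound\<close>). This is the \<open>A\<^sub>\<infinity>\<close> condition. Conversely, \<open>A\<^sub>p\<^sup>+\<close> yields it by
  testing the dual average on sublevel sets of \<open>w\<close> (\<open>Ap_plus_level_bound\<close>).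

  The core consists of two self-improvement properties of the \<open>A\<^sub>\<infinity>\<close> condition, valid for any
  nonnegative, locally integrable, almost everywhere continuous function.
  \<^item> On \<open>I\<^sup>+\<close> the sublevel sets \<open>{w < t \<lambda>}\<close>, with \<open>\<lambda>\<close> the average of \<open>w\<close> on \<open>I\<^sup>-\<close>, have measure
    \<open>O(t\<^sup>q)\<close> for some \<open>q > 0\<close> (\<open>lower_level_decay\<close>). So a small negative power of \<open>w\<close> has the
    right average on \<open>I\<^sup>+\<close>, which is \<open>A\<^sub>p\<^sup>+\<close> for large \<open>p\<close>.
  \<^item> On an interval ending at a point \<open>b\<close> where all left averages of \<open>w\<close> are at most \<open>\<lambda>\<close>, the
    superlevel sets \<open>{w > t \<lambda>}\<close> have measure \<open>O(t powr (- q))\<close> for some \<open>q > 1\<close>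
    (\<open>upper_level_decay\<close>), a one-sided reverse Hoelder inequality. As \<open>{w > r powr (- \<alpha>)}\<close> is
    \<open>{0 < d < r}\<close>, this gives the decay in the definition of the exponent with \<open>\<alpha> q > \<alpha>\<close> in place of
    \<open>\<alpha>\<close>, whence the strict inequality.

  Both follow from the rising sun lemma. The set of points with some left average below (or
  above) the level \<open>l\<close> has components on which the average is controlled by \<open>l\<close>, while the \<open>A\<^sub>\<infinity>\<close>
  condition makes \<open>{w \<ge> \<beta> l}\<close> a fixed proportion of each. Hence the set shrinks by a fixed
  factor when \<open>l\<close> is lowered, respectively raised, by a suitable factor; in the second case it
  shrinks by more than the factor itself, which is what makes \<open>q > 1\<close>. Geometric decay along a
  geometric sequence of levels is decay by a power.
\<close>

section \<open>Components of open sets and the rising sun lemma\<close>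

lemma component_of_bounded_open_real:
  fixes U :: "real set"
  assumes U: "open U" "bounded U" and C: "C \<in> components U"
  obtains c d where "c < d" "C = {c<..<d}" "c \<notin> U" "d \<notin> U"
proof -
  have opC: "open C" using open_components U C by blast
  have conC: "connected C" using C in_components_connected by blast
  have neC: "C \<noteq> {}" using C in_components_nonempty by blast
  have CU: "C \<subseteq> U" using C in_components_subset by blast
  have bC: "bounded C" using CU U bounded_subset by blast
  define c where "c = Inf C"
  define d where "d = Sup C"
  have bdd: "bdd_below C" "bdd_above C"
    using bC bounded_imp_bdd_below bounded_imp_bdd_above by auto
  have ivl: "is_interval C" using conC is_interval_connected_1 by blast
  have nin: "x \<in> C \<Longrightarrow> \<exists>y\<in>C. y < x" "x \<in> C \<Longrightarrow> \<exists>y\<in>C. x < y" for x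
  proof -
    assume x: "x \<in> C"
    then obtain e where e: "e > 0" "cball x e \<subseteq> C" using opC open_contains_cball by blast
    have "x - e \<in> C" "x + e \<in> C" using e by (auto simp: subset_iff dist_real_def)
    then show "\<exists>y\<in>C. y < x" "\<exists>y\<in>C. x < y" using e(1) by (auto intro: bexI[of _ "x-e"] bexI[of _ "x+e"])
  qed
  have Ceq: "C = {c<..<d}"
  proof (intro set_eqI iffI)
    fix x assume x: "x \<in> C"
    obtain y z where "y \<in> C" "y < x" "z \<in> C" "x < z" using nin x by blast
    then show "x \<in> {c<..<d}" unfolding c_def d_def
      using cInf_lower[OF _ bdd(1)] cSup_upper[OF _ bdd(2)] by fastforce
  next
    fix x assume "x \<in> {c<..<d}"
    then have "Inf C < x" "x < Sup C" unfolding c_def d_def by auto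
    then obtain y z where "y \<in> C" "y < x" "z \<in> C" "x < z"
      using cInf_lessD[OF neC, of x] less_cSupD[OF neC, of x] by blast
    then show "x \<in> C" using ivl unfolding is_interval_1 by (meson less_imp_le)
  qed
  have cd: "c < d" using Ceq neC by auto
  have cU: "e \<notin> U" if e: "e \<in> closure C" "e \<notin> C" for e
  proof
    assume "e \<in> U"
    have "connected (insert e C)"
      by (rule connected_intermediate_closure[OF conC]) (use e closure_subset in auto)
    then have "insert e C \<subseteq> C"
      using components_maximal[OF C, of "insert e C"] neC CU \<open>e \<in> U\<close> by auto
    then show False using e by auto
  qed
  have "c \<notin> U" "d \<notin> U" by (rule cU; use Ceq cd in auto)+
  then show ?thesis using that cd Ceq by blast
qed

text \<open>
  An open set is the disjoint union of its countably many components, so an integral inequality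
  may be checked on each component. Taking \<open>u\<close> of the form \<open>f - k\<close>, \<open>k - f\<close> or \<open>k\<close> minus an indicator
  gives the comparisons of integrals and measures used below.
\<close>

lemma set_integral_components_nonpos:
  fixes u :: "real \<Rightarrow> real"
  assumes U: "open U" and int: "set_integrable lebesgue U u"
    and le: "\<And>C. C \<in> components U \<Longrightarrow> (LINT x:C|lebesgue. u x) \<le> 0"
  shows "(LINT x:U|lebesgue. u x) \<le> 0"
proof (cases "U = {}")
  case True then show ?thesis by (simp add: set_lebesgue_integral_def)
next
  case False
  define K where "K = components U"
  have "countable K"
    unfolding K_def
  proof (rule countable_disjoint_open_subsets)
    show "pairwise disjnt (components U)"
      using pairwise_disjoint_components unfolding pairwise_def disjnt_def by blast
  qed (use U open_components in blast)
  have "K \<noteq> {}" using False by (simp add: K_def)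
  define s where "s = from_nat_into K"
  have s: "range s = K" using \<open>countable K\<close> \<open>K \<noteq> {}\<close> unfolding s_def by (rule range_from_nat_into[rotated])
  have sub: "C \<subseteq> U" and meas: "C \<in> sets lebesgue" if "C \<in> K" for C
    using in_components_subset open_components[OF U] that unfolding K_def by auto
  define A where "A n = (\<Union>C\<in>s ` {..n}. C)" for n :: nat
  have UA: "(\<Union>n. A n) = U"
  proof -
    have "(\<Union>n. A n) = \<Union>(range s)" unfolding A_def by auto
    then show ?thesis using s Union_components K_def by metis
  qed
  \<comment> \<open>The enumeration may repeat components, so the integral is computed on the finite
  sets of components met so far instead of termwise.\<close>
  have lim: "(\<lambda>n. LINT x:A n|lebesgue. u x) \<longlonglongrightarrow> (LINT x:(\<Union>n. A n)|lebesgue. u x)"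
  proof (rule set_integral_cont_up)
    show "A i \<in> sets lebesgue" for i
      unfolding A_def using meas s by (intro sets.finite_UN) auto
    show "incseq A" unfolding A_def by (auto simp: incseq_def intro: order_trans)
    show "set_integrable lebesgue (\<Union>i. A i) u" using int UA by simp
  qed
  have "(LINT x:A n|lebesgue. u x) \<le> 0" for n
  proof -
    have sK: "s ` {..n} \<subseteq> K" using s by auto
    have "(LINT x:A n|lebesgue. u x) = (\<Sum>C\<in>s ` {..n}. LINT x:C|lebesgue. u x)"
      unfolding A_def
    proof (rule set_integral_finite_Union)
      show "disjoint_family_on (\<lambda>C. C) (s ` {..n})"
        unfolding disjoint_family_on_def using sK components_nonoverlap K_def by blast
      show "set_integrable lebesgue C u" if "C \<in> s ` {..n}" for C
        using int meas sub that sK by (meson set_integrable_subset subsetD)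
    qed (use sK meas in auto)
    also have "\<dots> \<le> 0" by (rule sum_nonpos) (use sK le K_def in auto)
    finally show ?thesis .
  qed
  then show ?thesis using lim UA LIMSEQ_le_const2 by (metis (no_types, lifting))
qed

text \<open>
  The mirrored rising sun lemma. The left endpoint \<open>c\<close> of a component lies outside the set, so \<open>G c\<close>
  is the minimum of \<open>G\<close> on \<open>[a,c]\<close>; a minimum of \<open>G\<close> on \<open>[c,x]\<close> at an interior point of the
  component would contradict membership of that point, so \<open>c\<close> is also the minimum point on the
  component. At \<open>d < b\<close> the same argument for the right endpoint gives equality.
\<close>

lemma rising_sun:
  fixes G :: "real \<Rightarrow> real"
  assumes cont: "continuous_on {a..b} G"
  defines "U \<equiv> {x\<in>{a<..<b}. \<exists>y\<in>{a..<x}. G y < G x}"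
  shows rising_sun_open: "open U"
    and rising_sun_component: "C \<in> components U \<Longrightarrow> \<exists>c d. a \<le> c \<and> c < d \<and> d \<le> b \<and> C = {c<..<d} \<and>
      (\<forall>x\<in>{c..d}. G c \<le> G x) \<and> (\<forall>y\<in>{a..c}. G c \<le> G y) \<and> (d < b \<longrightarrow> G d = G c)"
proof -
  show op: "open U"
  proof -
    have "U = (\<Union>y\<in>{a..b}. {y<..<b} \<inter> G -` {G y<..})" 
    proof (intro set_eqI iffI)
      fix x assume "x \<in> U"
      then obtain y where "y \<in> {a..<x}" "G y < G x" "x < b" unfolding U_def by auto
      then show "x \<in> (\<Union>y\<in>{a..b}. {y<..<b} \<inter> G -` {G y<..})" by (intro UN_I[of y]) auto
    qed (auto simp: U_def)
    moreover have "open ({y<..<b} \<inter> G -` {G y<..})" if "y \<in> {a..b}" for y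
    proof (rule continuous_open_preimage)
      show "continuous_on {y<..<b} G" by (rule continuous_on_subset[OF cont]) (use that in auto)
    qed auto
    ultimately show ?thesis by auto
  qed
  assume C: "C \<in> components U"
  have Uab: "U \<subseteq> {a<..<b}" unfolding U_def by auto
  have "bounded U" using bounded_subset[OF _ Uab] by simp
  then obtain c d where cd: "c < d" "C = {c<..<d}" "c \<notin> U" "d \<notin> U"
    using component_of_bounded_open_real op C by blast
  have CU: "C \<subseteq> U" using C in_components_subset by blast
  have ac: "a \<le> c" "d \<le> b"
  proof -
    have "{c<..<d} \<subseteq> {a<..<b}" using cd CU Uab by auto
    then show "a \<le> c" "d \<le> b" using cd by (auto simp: greaterThanLessThan_subseteq_greaterThanLessThan)
  qed
  have left: "G c \<le> G y" if "y \<in> {a..c}" for y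
  proof (rule ccontr)
    assume "\<not> ?thesis"
    then have "G y < G c" "y < c" using that by (auto simp: le_less)
    then have "c \<in> U" unfolding U_def using that ac cd by auto
    then show False using cd by simp
  qed
  have mid: "G c \<le> G x" if x: "x \<in> {c<..<d}" for x
  proof -
    have "continuous_on {c..x} G" by (rule continuous_on_subset[OF cont]) (use x ac in auto)
    then obtain z where z: "z \<in> {c..x}" "\<forall>y\<in>{c..x}. G z \<le> G y"
      using continuous_attains_inf[of "{c..x}" G] x by auto
    have "z = c"
    proof (rule ccontr)
      assume "z \<noteq> c"
      then have "z \<in> U" using z x cd CU by auto
      then obtain y where y: "y \<in> {a..<z}" "G y < G z" unfolding U_def by auto
      show False
      proof (cases "y < c")
        case True
        then have "G c \<le> G y" using left y by auto
        moreover have "G z \<le> G c" using z x by auto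
        ultimately show False using y by simp
      next
        case False
        then show False using z(1) z(2)[rule_format, of y] y by auto
      qed
    qed
    then show ?thesis using z x by auto
  qed
  have right: "G c \<le> G d"
  proof (rule continuous_ge_on_closure[where S = "{c<..<d}" and f = G])
    show "continuous_on (closure {c<..<d}) G" using cd ac by (auto intro!: continuous_on_subset[OF cont])
  qed (use cd mid in auto)
  have "\<forall>x\<in>{c..d}. G c \<le> G x"
  proof
    fix x assume "x \<in> {c..d}"
    then consider "x = c" | "x = d" | "x \<in> {c<..<d}" by fastforce
    then show "G c \<le> G x" using mid right by cases auto
  qed
  moreover have "G d = G c" if "d < b"
  proof (rule antisym[OF _ right], rule ccontr)
    assume "\<not> G d \<le> G c"
    then have "d \<in> U" unfolding U_def using that ac cd(1) by (auto intro!: bexI[of _ c])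
    then show False using cd by simp
  qed
  ultimately show "\<exists>c d. a \<le> c \<and> c < d \<and> d \<le> b \<and> C = {c<..<d} \<and>
      (\<forall>x\<in>{c..d}. G c \<le> G x) \<and> (\<forall>y\<in>{a..c}. G c \<le> G y) \<and> (d < b \<longrightarrow> G d = G c)"
    using ac cd left by blast
qed

section \<open>Weights and their level sets\<close>

lemma set_integral_const_lebesgue:
  fixes k :: real
  assumes "U \<in> sets lebesgue" "bounded U"
  shows "set_integrable lebesgue U (\<lambda>_. k)" "(LINT x:U|lebesgue. k) = k * measure lebesgue U"
proof -
  have U: "U \<in> lmeasurable" using assms bounded_set_imp_lmeasurable by blast
  then show "set_integrable lebesgue U (\<lambda>_. k)"
    unfolding set_integrable_def by (auto simp: fmeasurable_def)
  show "(LINT x:U|lebesgue. k) = k * measure lebesgue U"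
    using U by (subst set_integral_const) (auto simp: fmeasurable_def)
qed

lemma set_integral_indicator_lebesgue:
  assumes "U \<in> sets lebesgue" "bounded U" "A \<in> sets lebesgue"
  shows "set_integrable lebesgue U (indicator A :: real \<Rightarrow> real)"
    "(LINT x:U|lebesgue. indicat_real A x) = measure lebesgue (A \<inter> U)"
proof -
  have "A \<inter> U \<in> lmeasurable"
    using assms by (intro bounded_set_imp_lmeasurable) (auto intro: bounded_subset)
  then have "integrable lebesgue (indicat_real (A \<inter> U))" by (auto simp: fmeasurable_def)
  moreover have eq: "(\<lambda>x. indicat_real U x *\<^sub>R indicat_real A x) = indicat_real (A \<inter> U)"
    by (auto simp: indicator_def)
  ultimately show "set_integrable lebesgue U (indicator A :: real \<Rightarrow> real)"
    unfolding set_integrable_def by simp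
  show "(LINT x:U|lebesgue. indicat_real A x) = measure lebesgue (A \<inter> U)"
    unfolding set_lebesgue_integral_def eq by simp
qed

lemma measure_components_ge:
  fixes U :: "real set"
  assumes U: "open U" "bounded U" and A: "A \<in> sets lebesgue"
    and le: "\<And>C. C \<in> components U \<Longrightarrow> k * measure lebesgue C \<le> measure lebesgue (A \<inter> C)"
  shows "k * measure lebesgue U \<le> measure lebesgue (A \<inter> U)"
proof -
  have *: "set_integrable lebesgue S (\<lambda>x. k - indicat_real A x)"
    "(LINT x:S|lebesgue. k - indicat_real A x) = k * measure lebesgue S - measure lebesgue (A \<inter> S)"
    if "S \<in> sets lebesgue" "bounded S" for S
    using set_integral_const_lebesgue[OF that, of k] set_integral_indicator_lebesgue[OF that A]
    by (auto simp: set_integral_diff)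
  have "(LINT x:U|lebesgue. k - indicat_real A x) \<le> 0"
  proof (rule set_integral_components_nonpos)
    fix C assume C: "C \<in> components U"
    then have "open C" "C \<subseteq> U" using open_components[OF U(1)] in_components_subset by auto
    then show "(LINT x:C|lebesgue. k - indicat_real A x) \<le> 0"
      using *(2)[of C] le[OF C] bounded_subset[OF U(2)] by auto
  qed (use U * in auto)
  then show ?thesis using *(2)[of U] U by auto
qed

text \<open>
  With \<open>\<gamma> ^ n < t \<le> \<gamma> ^ (n-1)\<close>, monotonicity costs one factor \<open>1 / \<theta>\<close>, and
  \<open>\<theta> ^ n = (\<gamma> ^ n) powr log \<gamma> \<theta>\<close>.
\<close>

lemma geometric_decay_imp_power_decay:
  fixes \<phi> :: "real \<Rightarrow> real"
  assumes g: "0 < \<gamma>" "\<gamma> < 1" and th: "0 < \<theta>" "\<theta> < 1" and M: "0 \<le> M"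
    and mono: "\<And>t u. 0 < t \<Longrightarrow> t \<le> u \<Longrightarrow> u \<le> 1 \<Longrightarrow> \<phi> t \<le> \<phi> u"
    and geo: "\<And>k. \<phi> (\<gamma> ^ k) \<le> M * \<theta> ^ k"
    and t: "0 < t" "t \<le> 1"
  shows "\<phi> t \<le> M / \<theta> * t powr log \<gamma> \<theta>"
proof -
  obtain n0 where "\<gamma> ^ n0 < t" using real_arch_pow_inv[OF t(1) g(2)] by blast
  define n where "n = (LEAST n. \<gamma> ^ n < t)"
  have n: "\<gamma> ^ n < t" unfolding n_def using \<open>\<gamma> ^ n0 < t\<close> by (rule LeastI)
  have "n \<noteq> 0" using n t by (cases n) auto
  then obtain k where k: "n = Suc k" using not0_implies_Suc by blast
  have "\<not> \<gamma> ^ k < t" using not_less_Least[of k "\<lambda>n. \<gamma> ^ n < t"] k n_def by auto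
  have "\<phi> t \<le> \<phi> (\<gamma> ^ k)"
    using t \<open>\<not> \<gamma> ^ k < t\<close> g by (intro mono) (auto intro: power_le_one)
  also have "\<dots> \<le> M * \<theta> ^ k" by (rule geo)
  also have "\<theta> ^ k = \<theta> ^ n / \<theta>" using th k by simp
  also have "\<theta> ^ n = (\<gamma> ^ n) powr log \<gamma> \<theta>"
  proof -
    have "(\<gamma> ^ n) powr log \<gamma> \<theta> = (\<gamma> powr log \<gamma> \<theta>) ^ n"
      using g by (simp add: powr_power powr_powr mult.commute flip: powr_realpow)
    then show ?thesis using g th by simp
  qed
  also have "M * ((\<gamma> ^ n) powr log \<gamma> \<theta> / \<theta>) \<le> M * (t powr log \<gamma> \<theta> / \<theta>)"
  proof -
    have "0 \<le> log \<gamma> \<theta>"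
      using g th by (simp add: log_def divide_nonpos_nonpos)
    then show ?thesis
      using n g th M by (intro mult_left_mono divide_right_mono powr_mono2) auto
  qed
  finally show ?thesis by simp
qed

text \<open>
  Continuity off the null set \<open>N\<close> is a convenient substitute for Lebesgue's differentiation
  theorem: it makes almost every point of a level set a point whose short left averages are on
  the same side of the level.
\<close>

locale regular_weight =
  fixes f :: "real \<Rightarrow> real" and N :: "real set"
  assumes borel [measurable]: "f \<in> borel_measurable borel"
    and nonneg: "\<And>x. 0 \<le> f x"
    and integrable: "\<And>a b. set_integrable lebesgue {a..b} f"
    and null: "N \<in> null_sets lebesgue"
    and cont: "\<And>x. x \<notin> N \<Longrightarrow> isCont f x"
begin

definition mass :: "real \<Rightarrow> real \<Rightarrow> real" where
  "mass a b = (LINT x:{a..b}|lebesgue. f x)"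

lemma borel_lebesgue [measurable]: "f \<in> borel_measurable lebesgue"
  using borel by (simp add: measurable_completion)

lemma level_sets [measurable]:
  "{x. k \<le> f x} \<in> sets lebesgue" "{x. f x < k} \<in> sets lebesgue" "{x. k < f x} \<in> sets lebesgue"
proof -
  have "{x\<in>space borel. k \<le> f x} \<in> sets borel" "{x\<in>space borel. f x < k} \<in> sets borel"
    "{x\<in>space borel. k < f x} \<in> sets borel" by measurable
  then show "{x. k \<le> f x} \<in> sets lebesgue" "{x. f x < k} \<in> sets lebesgue" "{x. k < f x} \<in> sets lebesgue"
    by auto
qed

lemma integrable_on:
  assumes "U \<in> sets lebesgue" "bounded U" shows "set_integrable lebesgue U f"
proof -
  obtain b where "\<forall>x\<in>U. \<bar>x\<bar> \<le> b"
    using assms(2) unfolding bounded_iff by auto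
  then have "U \<subseteq> {-b..b}" by (force simp: abs_le_iff)
  then show ?thesis using set_integrable_subset[OF integrable] assms(1) by blast
qed

lemma integral_nonneg: "0 \<le> (LINT x:U|lebesgue. f x)"
  unfolding set_lebesgue_integral_def
  by (intro Bochner_Integration.integral_nonneg) (simp add: nonneg)

lemma integral_subset_le:
  assumes "U \<in> sets lebesgue" "V \<in> sets lebesgue" "bounded V" "U \<subseteq> V"
  shows "(LINT x:U|lebesgue. f x) \<le> (LINT x:V|lebesgue. f x)"
proof -
  have "V = U \<union> (V - U)" using assms by auto
  then have "(LINT x:V|lebesgue. f x) = (LINT x:U|lebesgue. f x) + (LINT x:V - U|lebesgue. f x)"
    using set_integral_Un[of U "V - U" lebesgue f] integrable_on assms bounded_subset
    by (metis Diff_disjoint Diff_subset sets.Diff)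
  then show ?thesis using integral_nonneg[of "V - U"] by simp
qed

lemma mass_nonneg: "0 \<le> mass a b" unfolding mass_def by (rule integral_nonneg)

lemma integral_Ioo: "(LINT x:{a<..<b}|lebesgue. f x) = mass a b"
  unfolding mass_def
proof (rule set_integral_cong_set)
  have "AE x in lebesgue. x \<notin> {a, b}"
    by (intro AE_not_in) (simp add: negligible_iff_null_sets[symmetric])
  then show "AE x in lebesgue. (x \<in> {a..b}) = (x \<in> {a<..<b})" by eventually_elim auto
qed (auto simp: set_borel_measurable_def intro!: borel_measurable_times borel_measurable_indicator)

lemma mass_eq_integral: "mass a b = integral {a..b} f"
  unfolding mass_def by (rule set_lebesgue_integral_eq_integral(2)[OF integrable])

lemma mass_split: "a \<le> b \<Longrightarrow> b \<le> c \<Longrightarrow> mass a c = mass a b + mass b c"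
  unfolding mass_eq_integral
  by (rule Henstock_Kurzweil_Integration.integral_combine[symmetric])
     (auto intro: set_lebesgue_integral_eq_integral(1) integrable)

lemma mass_mono: "a' \<le> a \<Longrightarrow> b \<le> b' \<Longrightarrow> mass a b \<le> mass a' b'"
  unfolding mass_def by (rule integral_subset_le) auto

lemma mass_cont: "continuous_on {a..b} (mass a)"
  unfolding mass_eq_integral
  by (rule indefinite_integral_continuous_1) (rule set_lebesgue_integral_eq_integral(1)[OF integrable])

lemma mass_le: "a \<le> b \<Longrightarrow> (\<And>x. a \<le> x \<Longrightarrow> x \<le> b \<Longrightarrow> f x \<le> k) \<Longrightarrow> mass a b \<le> k * (b - a)"
proof -
  assume "a \<le> b" and le: "\<And>x. a \<le> x \<Longrightarrow> x \<le> b \<Longrightarrow> f x \<le> k"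
  have "mass a b \<le> (LINT x:{a..b}|lebesgue. k)"
    unfolding mass_def by (intro set_integral_mono integrable set_integral_const_lebesgue) (auto intro: le)
  then show ?thesis using set_integral_const_lebesgue(2)[of "{a..b}" k] \<open>a \<le> b\<close> by simp
qed

lemma mass_ge: "a \<le> b \<Longrightarrow> (\<And>x. a \<le> x \<Longrightarrow> x \<le> b \<Longrightarrow> k \<le> f x) \<Longrightarrow> k * (b - a) \<le> mass a b"
proof -
  assume "a \<le> b" and le: "\<And>x. a \<le> x \<Longrightarrow> x \<le> b \<Longrightarrow> k \<le> f x"
  have "(LINT x:{a..b}|lebesgue. k) \<le> mass a b"
    unfolding mass_def by (intro set_integral_mono integrable set_integral_const_lebesgue) (auto intro: le)
  then show ?thesis using set_integral_const_lebesgue(2)[of "{a..b}" k] \<open>a \<le> b\<close> by simp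
qed

lemma Chebyshev:
  assumes "U \<in> sets lebesgue" "bounded U" 
  shows "k * measure lebesgue {x\<in>U. k \<le> f x} \<le> (LINT x:U|lebesgue. f x)"
proof -
  have m: "{x\<in>U. k \<le> f x} \<in> sets lebesgue" and b: "bounded {x\<in>U. k \<le> f x}"
    using sets.Int[OF assms(1) level_sets(1)[of k]] assms(2) 
    by (auto simp: Int_def conj_commute intro: bounded_subset)
  have "k * measure lebesgue {x\<in>U. k \<le> f x} = (LINT x:{x\<in>U. k \<le> f x}|lebesgue. k)"
    using set_integral_const_lebesgue[OF m b] by simp
  also have "\<dots> \<le> (LINT x:{x\<in>U. k \<le> f x}|lebesgue. f x)"
    by (intro set_integral_mono integrable_on m b set_integral_const_lebesgue) auto
  also have "\<dots> \<le> (LINT x:U|lebesgue. f x)" by (intro integral_subset_le assms m) auto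
  finally show ?thesis .
qed

lemma component_integral_le:
  assumes U: "open U" "bounded U"
    and le: "\<And>C. C \<in> components U \<Longrightarrow> (LINT x:C|lebesgue. f x) \<le> k * measure lebesgue C"
  shows "(LINT x:U|lebesgue. f x) \<le> k * measure lebesgue U"
proof -
  have *: "set_integrable lebesgue S (\<lambda>x. f x - k)"
    "(LINT x:S|lebesgue. f x - k) = (LINT x:S|lebesgue. f x) - k * measure lebesgue S"
    if "S \<in> sets lebesgue" "bounded S" for S
    using set_integral_const_lebesgue[OF that, of k] integrable_on[OF that]
    by (auto simp: set_integral_diff)
  have "(LINT x:U|lebesgue. f x - k) \<le> 0"
  proof (rule set_integral_components_nonpos)
    fix C assume C: "C \<in> components U"
    then have "open C" "C \<subseteq> U" using open_components[OF U(1)] in_components_subset by auto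
    then show "(LINT x:C|lebesgue. f x - k) \<le> 0"
      using *(2)[of C] le[OF C] bounded_subset[OF U(2)] by auto
  qed (use U * in auto)
  then show ?thesis using *(2)[of U] U by auto
qed

lemma component_integral_ge:
  assumes U: "open U" "bounded U"
    and le: "\<And>C. C \<in> components U \<Longrightarrow> k * measure lebesgue C \<le> (LINT x:C|lebesgue. f x)"
  shows "k * measure lebesgue U \<le> (LINT x:U|lebesgue. f x)"
proof -
  have *: "set_integrable lebesgue S (\<lambda>x. k - f x)"
    "(LINT x:S|lebesgue. k - f x) = k * measure lebesgue S - (LINT x:S|lebesgue. f x)"
    if "S \<in> sets lebesgue" "bounded S" for S
    using set_integral_const_lebesgue[OF that, of k] integrable_on[OF that]
    by (auto simp: set_integral_diff)
  have "(LINT x:U|lebesgue. k - f x) \<le> 0"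
  proof (rule set_integral_components_nonpos)
    fix C assume C: "C \<in> components U"
    then have "open C" "C \<subseteq> U" using open_components[OF U(1)] in_components_subset by auto
    then show "(LINT x:C|lebesgue. k - f x) \<le> 0"
      using *(2)[of C] le[OF C] bounded_subset[OF U(2)] by auto
  qed (use U * in auto)
  then show ?thesis using *(2)[of U] U by auto
qed

lemma local_average_less:
  assumes "x \<notin> N" "f x < k" "c < x"
  shows "\<exists>y\<in>{c..<x}. mass y x < k * (x - y)"
proof -
  define k' where "k' = (f x + k) / 2"
  have k': "f x < k'" "k' < k" using assms by (auto simp: k'_def)
  have "isCont f x" using cont assms by blast
  then have "\<forall>\<^sub>F y in at x. f y < k'"
    using k' order_tendstoD(2) isCont_def by blast
  then obtain e where e: "e > 0" "\<And>y. y \<noteq> x \<Longrightarrow> dist y x < e \<Longrightarrow> f y < k'"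
    unfolding eventually_at by auto
  define y where "y = max c (x - e/2)"
  have y: "c \<le> y" "y < x" "x - y < e" using assms e by (auto simp: y_def)
  have "mass y x \<le> k' * (x - y)"
  proof (rule mass_le)
    fix z assume "y \<le> z" "z \<le> x"
    then show "f z \<le> k'" using e(2)[of z] y k' by (cases "z = x") (auto simp: dist_real_def)
  qed (use y in auto)
  also have "\<dots> < k * (x - y)" using k' y by (simp add: mult_strict_right_mono)
  finally show ?thesis using y by auto
qed

lemma local_average_greater:
  assumes "x \<notin> N" "k < f x" "c < x"
  shows "\<exists>y\<in>{c..<x}. k * (x - y) < mass y x"
proof -
  define k' where "k' = (f x + k) / 2"
  have k': "k' < f x" "k < k'" using assms by (auto simp: k'_def)
  have "isCont f x" using cont assms by blast
  then have "\<forall>\<^sub>F y in at x. k' < f y"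
    using k' order_tendstoD(1) isCont_def by blast
  then obtain e where e: "e > 0" "\<And>y. y \<noteq> x \<Longrightarrow> dist y x < e \<Longrightarrow> k' < f y"
    unfolding eventually_at by auto
  define y where "y = max c (x - e/2)"
  have y: "c \<le> y" "y < x" "x - y < e" using assms e by (auto simp: y_def)
  have "k * (x - y) < k' * (x - y)" using k' y by (simp add: mult_strict_right_mono)
  also have "k' * (x - y) \<le> mass y x"
  proof (rule mass_ge)
    fix z assume "y \<le> z" "z \<le> x"
    then show "k' \<le> f z" using e(2)[of z] y k' by (cases "z = x") (auto simp: dist_real_def)
  qed (use y in auto)
  finally show ?thesis using y by auto
qed

text \<open>
  The one-sided \<open>A\<^sub>\<infinity>\<close> condition: the average on the left half is dominated by typical values on
  the right half. For an \<open>A\<^sub>p\<^sup>+\<close> weight the roles of left and right cannot be exchanged.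
\<close>

definition A_inf :: "real \<Rightarrow> real \<Rightarrow> bool" where
  "A_inf \<beta> s \<longleftrightarrow> (\<forall>m h l. 0 < h \<longrightarrow> 0 < l \<longrightarrow> l * h \<le> mass (m - h) m \<longrightarrow>
     s * h \<le> measure lebesgue {x\<in>{m<..<m+h}. \<beta> * l \<le> f x})"

end

section \<open>Self-improvement of the one-sided condition\<close>

lemma bounded_restrict:
  assumes "bounded U" shows "bounded {x\<in>U. P x}" "bounded (U - V)"
  using assms by (auto intro: bounded_subset)

lemma measure_mono_bounded:
  fixes A B :: "real set"
  assumes "A \<subseteq> B" "A \<in> sets lebesgue" "B \<in> sets lebesgue" "bounded B"
  shows "measure lebesgue A \<le> measure lebesgue B"
  using assms by (intro measure_mono_fmeasurable) (auto intro: bounded_set_imp_lmeasurable)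

context regular_weight
begin

lemma A_infD:
  assumes "A_inf \<beta> s" "0 < h" "0 < l" "l * h \<le> mass (m - h) m"
  shows "s * h \<le> measure lebesgue {x\<in>{m<..<m+h}. \<beta> * l \<le> f x}"
  using assms unfolding A_inf_def by blast

text \<open>
  The superlevel set of the left maximal function of \<open>f\<close> restricted to \<open>(a, b)\<close>, and below its
  counterpart for the left minimal function. They are rising sun sets of the functions
  \<open>mass a x - l x\<close> and \<open>l x - mass a x\<close>.
\<close>

definition high_set :: "real \<Rightarrow> real \<Rightarrow> real \<Rightarrow> real set" where
  "high_set a b l = {x\<in>{a<..<b}. \<exists>y\<in>{a..<x}. l * (x - y) < mass y x}"

definition low_set :: "real \<Rightarrow> real \<Rightarrow> real \<Rightarrow> real set" where
  "low_set a b l = {x\<in>{a<..<b}. \<exists>y\<in>{a..<x}. mass y x < l * (x - y)}"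

lemma high_set_rising_sun:
  "high_set a b l = {x\<in>{a<..<b}. \<exists>y\<in>{a..<x}. mass a y - l * y < mass a x - l * x}"
proof -
  have "l * (x - y) < mass y x \<longleftrightarrow> mass a y - l * y < mass a x - l * x"
    if "x \<in> {a<..<b}" "y \<in> {a..<x}" for x y
    using mass_split[of a y x] that by (auto simp: algebra_simps)
  then show ?thesis unfolding high_set_def by blast
qed

lemma low_set_rising_sun:
  "low_set a b l = {x\<in>{a<..<b}. \<exists>y\<in>{a..<x}. l * y - mass a y < l * x - mass a x}"
proof -
  have "mass y x < l * (x - y) \<longleftrightarrow> l * y - mass a y < l * x - mass a x"
    if "x \<in> {a<..<b}" "y \<in> {a..<x}" for x y
    using mass_split[of a y x] that by (auto simp: algebra_simps)
  then show ?thesis unfolding low_set_def by blast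
qed

lemma high_set_mono: "l \<le> l' \<Longrightarrow> high_set a b l' \<subseteq> high_set a b l"
proof
  fix x assume l: "l \<le> l'" and "x \<in> high_set a b l'"
  then obtain y where y: "x \<in> {a<..<b}" "y \<in> {a..<x}" "l' * (x - y) < mass y x"
    unfolding high_set_def by auto
  have "l * (x - y) \<le> l' * (x - y)" using l y by (intro mult_right_mono) auto
  then have "l * (x - y) < mass y x" using y by linarith
  then show "x \<in> high_set a b l" using y unfolding high_set_def by blast
qed

lemma low_set_mono: "l \<le> l' \<Longrightarrow> low_set a b l \<subseteq> low_set a b l'"
proof
  fix x assume l: "l \<le> l'" and "x \<in> low_set a b l"
  then obtain y where y: "x \<in> {a<..<b}" "y \<in> {a..<x}" "mass y x < l * (x - y)"
    unfolding low_set_def by auto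
  have "l * (x - y) \<le> l' * (x - y)" using l y by (intro mult_right_mono) auto
  then have "mass y x < l' * (x - y)" using y by linarith
  then show "x \<in> low_set a b l'" using y unfolding low_set_def by blast
qed

lemma open_high_set: "open (high_set a b l)"
  unfolding high_set_rising_sun by (intro rising_sun_open continuous_intros mass_cont)

lemma open_low_set: "open (low_set a b l)"
  unfolding low_set_rising_sun by (intro rising_sun_open continuous_intros mass_cont)

lemma bounded_high_set: "bounded (high_set a b l)"
  by (rule bounded_subset[of "{a<..<b}"]) (auto simp: high_set_def)

lemma bounded_low_set: "bounded (low_set a b l)"
  by (rule bounded_subset[of "{a<..<b}"]) (auto simp: low_set_def)

lemma high_set_component:
  assumes C: "C \<in> components (high_set a b l)"
  obtains c d where "a \<le> c" "c < d" "d \<le> b" "C = {c<..<d}"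
    "l * (d - c) \<le> mass c d" "d < b \<Longrightarrow> mass c d = l * (d - c)"
    "\<And>x. c \<le> x \<Longrightarrow> x \<le> d \<Longrightarrow> l * (x - c) \<le> mass c x"
proof -
  let ?G = "\<lambda>x. mass a x - l * x"
  have "continuous_on {a..b} ?G" by (intro continuous_intros mass_cont)
  from rising_sun_component[OF this, of C] C
  obtain c d where cd: "a \<le> c" "c < d" "d \<le> b" "C = {c<..<d}"
    and G: "\<forall>x\<in>{c..d}. ?G c \<le> ?G x" "d < b \<Longrightarrow> ?G d = ?G c"
    unfolding high_set_rising_sun by auto
  have *: "mass a x = mass a c + mass c x" if "c \<le> x" for x using that cd by (intro mass_split) auto
  show ?thesis
  proof (rule that[OF cd])
    show ge: "l * (x - c) \<le> mass c x" if "c \<le> x" "x \<le> d" for x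
      using G(1)[rule_format, of x] *[of x] that by (auto simp: algebra_simps)
    show "l * (d - c) \<le> mass c d" using ge[of d] cd by simp
    show "d < b \<Longrightarrow> mass c d = l * (d - c)" using G(2) *[of d] cd by (auto simp: algebra_simps)
  qed
qed

lemma low_set_component:
  assumes C: "C \<in> components (low_set a b l)"
  obtains c d where "a \<le> c" "c < d" "d \<le> b" "C = {c<..<d}" "mass c d \<le> l * (d - c)"
    "\<And>y. a \<le> y \<Longrightarrow> y \<le> c \<Longrightarrow> l * (c - y) \<le> mass y c"
proof -
  let ?G = "\<lambda>x. l * x - mass a x"
  have "continuous_on {a..b} ?G" by (intro continuous_intros mass_cont)
  from rising_sun_component[OF this, of C] C
  obtain c d where cd: "a \<le> c" "c < d" "d \<le> b" "C = {c<..<d}"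
    and G: "\<forall>x\<in>{c..d}. ?G c \<le> ?G x" "\<forall>y\<in>{a..c}. ?G c \<le> ?G y"
    unfolding low_set_rising_sun by auto
  show ?thesis
  proof (rule that[OF cd])
    show "mass c d \<le> l * (d - c)"
      using G(1)[rule_format, of d] mass_split[of a c d] cd by (auto simp: algebra_simps)
    show "l * (c - y) \<le> mass y c" if "a \<le> y" "y \<le> c" for y
      using G(2)[rule_format, of y] mass_split[of a y c] that by (auto simp: algebra_simps)
  qed
qed

lemma measure_level_split:
  assumes "U \<in> sets lebesgue" "bounded U"
  shows "measure lebesgue U = measure lebesgue {x\<in>U. k \<le> f x} + measure lebesgue {x\<in>U. f x < k}"
proof -
  have "{x\<in>U. k \<le> f x} = U \<inter> {x. k \<le> f x}" "{x\<in>U. f x < k} = U \<inter> {x. f x < k}" by auto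
  then have "{x\<in>U. k \<le> f x} \<in> lmeasurable" "{x\<in>U. f x < k} \<in> lmeasurable"
    using assms by (auto intro!: bounded_set_imp_lmeasurable simp: bounded_Int)
  then have "measure lebesgue ({x\<in>U. k \<le> f x} \<union> {x\<in>U. f x < k}) =
      measure lebesgue {x\<in>U. k \<le> f x} + measure lebesgue {x\<in>U. f x < k}"
    by (subst measure_Un3) (auto simp: disjoint_iff[of "{x\<in>U. k \<le> f x}" "{x\<in>U. f x < k}", THEN iffD2])
  moreover have "{x\<in>U. k \<le> f x} \<union> {x\<in>U. f x < k} = U" by auto
  ultimately show ?thesis by simp
qed

lemma level_set_meas:
  assumes "U \<in> sets lebesgue"
  shows "{x\<in>U. k \<le> f x} \<in> sets lebesgue" "{x\<in>U. f x < k} \<in> sets lebesgue" "{x\<in>U. k < f x} \<in> sets lebesgue"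
proof -
  have "{x\<in>U. k \<le> f x} = U \<inter> {x. k \<le> f x}" "{x\<in>U. f x < k} = U \<inter> {x. f x < k}"
    "{x\<in>U. k < f x} = U \<inter> {x. k < f x}" by auto
  then show "{x\<in>U. k \<le> f x} \<in> sets lebesgue" "{x\<in>U. f x < k} \<in> sets lebesgue" "{x\<in>U. k < f x} \<in> sets lebesgue"
    using assms level_sets by auto
qed

lemma measure_level_components_ge:
  assumes U: "open U" "bounded U"
    and le: "\<And>C. C \<in> components U \<Longrightarrow> k * measure lebesgue C \<le> measure lebesgue {x\<in>C. l \<le> f x}"
  shows "k * measure lebesgue U \<le> measure lebesgue {x\<in>U. l \<le> f x}"
proof -
  have *: "{x\<in>U. l \<le> f x} = {x. l \<le> f x} \<inter> U" for U by auto
  show ?thesis using measure_components_ge[OF U level_sets(1)[of l]] le unfolding * by blast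
qed

text \<open>
  If all left averages at \<open>b\<close> are at most \<open>l\<close>, the exceptional component ending at \<open>b\<close> also has
  average exactly \<open>l\<close>, and the mass of the set equals \<open>l\<close> times its length.
\<close>

lemma high_set_mass:
  assumes l: "l0 \<le> l" and b: "\<And>c. a \<le> c \<Longrightarrow> c \<le> b \<Longrightarrow> mass c b \<le> l0 * (b - c)"
  shows "(LINT x:high_set a b l|lebesgue. f x) = l * measure lebesgue (high_set a b l)"
proof -
  have eq: "(LINT x:C|lebesgue. f x) = l * measure lebesgue C" if C: "C \<in> components (high_set a b l)" for C
  proof -
    obtain c d where cd: "a \<le> c" "c < d" "d \<le> b" "C = {c<..<d}" "l * (d - c) \<le> mass c d" 
      "d < b \<Longrightarrow> mass c d = l * (d - c)" using high_set_component[OF C] by metis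
    have "mass c d \<le> l * (d - c)"
    proof (cases "d < b")
      case False
      then have "mass c d \<le> l0 * (d - c)" using b[of c] cd by auto
      also have "\<dots> \<le> l * (d - c)" using l cd by (intro mult_right_mono) auto
      finally show ?thesis .
    qed (use cd in auto)
    then show ?thesis using cd by (simp add: integral_Ioo)
  qed
  show ?thesis
    using eq component_integral_le[OF open_high_set bounded_high_set] component_integral_ge[OF open_high_set bounded_high_set]
    by (intro antisym) auto
qed

text \<open>
  On a component \<open>(c, d)\<close> all averages over \<open>(c, x)\<close> are at least \<open>l\<close>. Applying the condition to the two
  halves of \<open>(c, d)\<close> produces large values in the right half, whence the loss of a factor 2.
\<close>

lemma high_set_level:
  assumes A: "A_inf \<beta> s" and l: "0 < l"
  shows "s / 2 * measure lebesgue (high_set a b l) \<le> measure lebesgue {x\<in>high_set a b l. \<beta> * l \<le> f x}"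
proof (rule measure_level_components_ge[OF open_high_set bounded_high_set])
  fix C assume C: "C \<in> components (high_set a b l)"
  obtain c d where cd: "c < d" "C = {c<..<d}" "\<And>x. c \<le> x \<Longrightarrow> x \<le> d \<Longrightarrow> l * (x - c) \<le> mass c x"
    using high_set_component[OF C] by metis
  define h where "h = (d - c) / 2"
  have h: "h > 0" "c + 2 * h = d" using cd by (auto simp: h_def field_simps)
  have "s * h \<le> measure lebesgue {x\<in>{(c + h)<..<(c + h) + h}. \<beta> * l \<le> f x}"
    by (rule A_infD[OF A]) (use h l cd(3)[of "c+h"] in auto)
  also have "\<dots> \<le> measure lebesgue {x\<in>C. \<beta> * l \<le> f x}"
  proof (rule measure_mono_bounded)
    show "bounded {x\<in>C. \<beta> * l \<le> f x}" by (rule bounded_restrict) (simp add: cd)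
  qed (use h cd in \<open>auto intro!: level_set_meas\<close>)
  finally show "s / 2 * measure lebesgue C \<le> measure lebesgue {x\<in>C. \<beta> * l \<le> f x}"
    using cd by (simp add: h_def)
qed

text \<open>
  Let \<open>U\<close> and \<open>V \<subseteq> U\<close> be the sets for the levels \<open>l\<close> and \<open>K l\<close>. Comparing masses, \<open>V\<close> has at most
  \<open>1 / K\<close> of the length of \<open>U\<close>, whereas the points of \<open>U\<close> with \<open>f \<ge> \<beta> l\<close> occupy at least \<open>2 / K\<close>
  of it. So \<open>U - V\<close> carries a fixed proportion of the mass of \<open>U\<close>, and \<open>V\<close> is shorter than \<open>U\<close> by a factor
  strictly smaller than the \<open>1 / K\<close> that comparing masses gives.
\<close>

lemma high_set_step:
  assumes A: "A_inf \<beta> s" and s: "0 < s" "s < 1" "0 < \<beta>" "\<beta> \<le> 1" and l: "0 < l0" "l0 \<le> l"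
    and b: "\<And>c. a \<le> c \<Longrightarrow> c \<le> b \<Longrightarrow> mass c b \<le> l0 * (b - c)"
  shows "measure lebesgue (high_set a b (4 / s * l)) \<le> (1 - \<beta> * s / 4) * s / 4 * measure lebesgue (high_set a b l)"
proof -
  \<comment> \<open>The choice that makes the proportion \<open>s / 2\<close> from the previous lemma equal to \<open>2 / K\<close>.\<close>
  define K where "K = 4 / s"
  have K: "K \<ge> 1" "K > 0" "s / 2 = 2 / K" using s by (auto simp: K_def field_simps)
  define U V where "U = high_set a b l" and "V = high_set a b (K * l)"
  have lK: "l \<le> K * l" using K l by (simp add: mult_le_cancel_right1)
  have VU: "V \<subseteq> U" unfolding U_def V_def by (rule high_set_mono[OF lK])
  have UV: "open U" "bounded U" "open V" "bounded V" unfolding U_def V_def using open_high_set bounded_high_set by auto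
  then have meas: "U \<in> sets lebesgue" "V \<in> sets lebesgue" "U - V \<in> sets lebesgue" by auto
  have IU: "(LINT x:U|lebesgue. f x) = l * measure lebesgue U"
    unfolding U_def by (rule high_set_mass[OF l(2) b])
  have IV: "(LINT x:V|lebesgue. f x) = K * l * measure lebesgue V"
    unfolding V_def by (rule high_set_mass[OF order_trans[OF l(2) lK] b])
  have IUV: "(LINT x:U|lebesgue. f x) = (LINT x:V|lebesgue. f x) + (LINT x:U - V|lebesgue. f x)"
  proof -
    have "U = V \<union> (U - V)" using VU by auto
    then show ?thesis
      using set_integral_Un[of V "U - V" lebesgue f] integrable_on[OF meas(2) UV(4)]
        integrable_on[OF meas(3) bounded_restrict(2)[OF UV(2)]] by (metis Diff_disjoint)
  qed
  have "K * l * measure lebesgue V \<le> l * measure lebesgue U"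
    using integral_subset_le[OF meas(2,1) UV(2) VU] IU IV by simp
  then have V_le: "measure lebesgue V \<le> measure lebesgue U / K" using l K by (simp add: field_simps)
  have "2 / K * measure lebesgue U \<le> measure lebesgue {x\<in>U. \<beta> * l \<le> f x}"
    using high_set_level[OF A, of l a b] l K unfolding U_def by auto
  also have "\<dots> \<le> measure lebesgue ({x\<in>U - V. \<beta> * l \<le> f x} \<union> V)"
  proof (rule measure_mono_bounded)
    show "bounded ({x\<in>U - V. \<beta> * l \<le> f x} \<union> V)" using UV by (intro bounded_Un[THEN iffD2] conjI bounded_restrict)
  qed (use meas in \<open>auto intro!: level_set_meas sets.Un\<close>)
  also have "\<dots> \<le> measure lebesgue {x\<in>U - V. \<beta> * l \<le> f x} + measure lebesgue V"
    by (rule measure_Un_le) (use meas in \<open>auto intro!: level_set_meas\<close>)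
  finally have "measure lebesgue U / K \<le> measure lebesgue {x\<in>U - V. \<beta> * l \<le> f x}"
    using V_le by simp
  then have "\<beta> * l * (measure lebesgue U / K) \<le> \<beta> * l * measure lebesgue {x\<in>U - V. \<beta> * l \<le> f x}"
    using s l by (intro mult_left_mono) auto
  also have "\<dots> \<le> (LINT x:U - V|lebesgue. f x)"
    by (rule Chebyshev) (use meas UV in \<open>auto intro!: bounded_restrict\<close>)
  also have "\<dots> = l * measure lebesgue U - K * l * measure lebesgue V" using IU IV IUV by simp
  finally have "l * (K * measure lebesgue V) \<le> l * ((1 - \<beta> / K) * measure lebesgue U)"
    by (simp add: algebra_simps)
  then have "K * measure lebesgue V \<le> (1 - \<beta> / K) * measure lebesgue U" using l by simp
  then have "measure lebesgue V \<le> (1 - \<beta> / K) / K * measure lebesgue U" using K by (simp add: field_simps)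
  then show ?thesis unfolding U_def V_def K_def using s by (simp add: field_simps)
qed

text \<open>
  One-sided reverse Hoelder inequality in weak form. Each multiplication of the level by \<open>4 / s\<close>
  divides the length by at least \<open>4 / s\<close> times a fixed factor greater than 1, and this further
  factor pushes the exponent \<open>q\<close> above 1.
\<close>

theorem upper_level_decay:
  assumes A: "A_inf \<beta> s" and s: "0 < s" "s < 1" "0 < \<beta>" "\<beta> \<le> 1"
  obtains C q where "C > 0" "q > 1"
    "\<And>a b l0 t. a < b \<Longrightarrow> 0 < l0 \<Longrightarrow> \<forall>c\<in>{a..b}. mass c b \<le> l0 * (b - c) \<Longrightarrow> 0 < t \<Longrightarrow>
      measure lebesgue {x\<in>{a<..<b}. t * l0 < f x} \<le> C * (b - a) * (1 / t) powr q"
proof -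
  define \<theta> where "\<theta> = (1 - \<beta> * s / 4) * s / 4"
  define \<gamma> where "\<gamma> = s / 4"
  have "\<beta> * s \<le> 1 * s" using s by (intro mult_right_mono) auto
  then have "\<beta> * s < 1" using s by linarith
  have bs: "0 < \<beta> * s" using s by simp
  have "\<theta> = (1 - \<beta> * s / 4) * \<gamma>" "0 < \<gamma>" using s by (auto simp: \<theta>_def \<gamma>_def)
  moreover have "0 < (1 - \<beta> * s / 4) * \<gamma>" "(1 - \<beta> * s / 4) * \<gamma> < 1 * \<gamma>"
    using \<open>\<beta> * s < 1\<close> bs \<open>0 < \<gamma>\<close> by (intro mult_pos_pos mult_strict_right_mono; simp)+
  ultimately have th: "0 < \<theta>" "\<theta> < \<gamma>" by auto
  have g: "0 < \<gamma>" "\<gamma> < 1" using s by (auto simp: \<gamma>_def)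
  define q where "q = log \<gamma> \<theta>"
  have q: "q > 1"
  proof -
    have "ln \<theta> < ln \<gamma>" "ln \<gamma> < 0" using th g by auto
    then show ?thesis unfolding q_def log_def by (simp add: divide_simps)
  qed
  show ?thesis
  proof (rule that[of "1 / \<theta>" q])
    fix a b l0 t :: real
    assume ab: "a < b" and l0: "0 < l0" and b': "\<forall>c\<in>{a..b}. mass c b \<le> l0 * (b - c)" and t: "0 < t"
    have b: "mass c b \<le> l0 * (b - c)" if "a \<le> c" "c \<le> b" for c using b' that by simp
    define \<phi> where "\<phi> u = measure lebesgue (high_set a b (l0 / u))" for u
    have \<phi>_le: "\<phi> u \<le> b - a" for u
    proof -
      have "\<phi> u \<le> measure lebesgue {a<..<b}"
        unfolding \<phi>_def by (rule measure_mono_bounded) (auto simp: open_high_set, auto simp: high_set_def)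
      then show ?thesis using ab by simp
    qed
    have geo: "\<phi> (\<gamma> ^ k) \<le> (b - a) * \<theta> ^ k" for k
    proof (induction k)
      case 0 then show ?case using \<phi>_le[of 1] by simp
    next
      case (Suc k)
      have "\<gamma> ^ k > 0" "\<gamma> ^ k \<le> 1" using g by (auto intro: power_le_one)
      then have "l0 \<le> l0 / \<gamma> ^ k" using l0 by (simp add: field_simps)
      from high_set_step[OF A s l0 this b]
      have "\<phi> (\<gamma> ^ Suc k) \<le> \<theta> * \<phi> (\<gamma> ^ k)"
        unfolding \<phi>_def \<theta>_def by (simp add: \<gamma>_def field_simps)
      also have "\<dots> \<le> \<theta> * ((b - a) * \<theta> ^ k)" using Suc th by (intro mult_left_mono) auto
      finally show ?case by (simp add: algebra_simps)
    qed
    have sub: "measure lebesgue {x\<in>{a<..<b}. t * l0 < f x} \<le> \<phi> (1 / t)"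
    proof -
      have "measure lebesgue {x\<in>{a<..<b}. t * l0 < f x} \<le> measure lebesgue (high_set a b (t * l0) \<union> N)"
      proof (rule measure_mono_fmeasurable)
        show "{x\<in>{a<..<b}. t * l0 < f x} \<subseteq> high_set a b (t * l0) \<union> N"
          using local_average_greater[of _ "t * l0" a] unfolding high_set_def by auto
        show "high_set a b (t * l0) \<union> N \<in> lmeasurable"
          using bounded_set_imp_lmeasurable[OF bounded_high_set] open_high_set fmeasurableI_null_sets[OF null]
          by (intro fmeasurable.Un) auto
      qed (auto intro!: level_set_meas)
      also have "\<dots> = measure lebesgue (high_set a b (t * l0))"
        using null open_high_set by (intro measure_Un_null_set) auto
      finally show ?thesis by (simp add: \<phi>_def mult.commute)
    qed
    show "measure lebesgue {x\<in>{a<..<b}. t * l0 < f x} \<le> 1 / \<theta> * (b - a) * (1 / t) powr q"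
    proof (cases "t \<ge> 1")
      case True
      have "\<phi> (1 / t) \<le> (b - a) / \<theta> * (1 / t) powr log \<gamma> \<theta>"
      proof (rule geometric_decay_imp_power_decay[OF g th(1)])
        fix u v :: real assume "0 < u" "u \<le> v"
        then show "\<phi> u \<le> \<phi> v" unfolding \<phi>_def using l0
          by (intro measure_mono_bounded high_set_mono bounded_high_set)
             (auto simp: open_high_set divide_left_mono)
      qed (use th g True ab geo in auto)
      then show ?thesis using sub by (simp add: q_def)
    next
      case False
      have "1 powr q \<le> (1 / t) powr q" using False t q by (intro powr_mono2) auto
      moreover have "1 \<le> 1 / \<theta>" using th g by simp
      ultimately have "1 * 1 \<le> 1 / \<theta> * (1 / t) powr q" using th by (intro mult_mono) auto
      then have "(b - a) * 1 \<le> (b - a) * (1 / \<theta> * (1 / t) powr q)" using ab by (intro mult_left_mono) auto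
      then show ?thesis using sub \<phi>_le[of "1/t"] by (simp add: algebra_simps)
    qed
  qed (use q th in auto)
qed

text \<open>
  On a component \<open>(c, d)\<close> all averages over \<open>(y, c)\<close> with \<open>y \<ge> a\<close> are at least \<open>l\<close>, so the condition
  applies to \<open>(c - (d - c), c)\<close> and \<open>(c, d)\<close>. The starting point \<open>c0\<close> is there for the case that the
  former interval sticks out on the left of \<open>a\<close>: it then contains \<open>(a, c0)\<close>, which has mass at least
  \<open>3 / 4 l0 h\<close>, while its length is at most \<open>2 h\<close>.
\<close>

lemma low_set_level:
  assumes A: "A_inf \<beta> s" and l: "0 < l" "l \<le> l0 / 4" and h: "0 < h"
    and c0: "a \<le> c0" "c0 \<le> a + h" "\<And>y. a \<le> y \<Longrightarrow> y \<le> c0 \<Longrightarrow> l0 / 4 * (c0 - y) \<le> mass y c0"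
    and big: "3 / 4 * (l0 * h) \<le> mass a c0"
  shows "s * measure lebesgue (low_set c0 (a + 2 * h) l)
    \<le> measure lebesgue {x\<in>low_set c0 (a + 2 * h) l. \<beta> * l \<le> f x}"
proof (rule measure_level_components_ge[OF open_low_set bounded_low_set])
  fix C assume C: "C \<in> components (low_set c0 (a + 2 * h) l)"
  obtain c d where cd: "c0 \<le> c" "c < d" "d \<le> a + 2 * h" "C = {c<..<d}"
    and left: "\<And>y. c0 \<le> y \<Longrightarrow> y \<le> c \<Longrightarrow> l * (c - y) \<le> mass y c"
    using low_set_component[OF C] by metis
  have left': "l * (c - y) \<le> mass y c" if y: "a \<le> y" "y \<le> c" for y
  proof (cases "y < c0")
    case True
    have "l * (c0 - y) \<le> l0 / 4 * (c0 - y)" using l True by (intro mult_right_mono) auto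
    also have "\<dots> \<le> mass y c0" using c0(3) y True by auto
    finally show ?thesis
      using left[of c0] mass_split[of y c0 c] cd True by (simp add: algebra_simps)
  qed (use left y in auto)
  have "l * (d - c) \<le> mass (c - (d - c)) c"
  proof (cases "a \<le> c - (d - c)")
    case True then show ?thesis using left'[of "c - (d - c)"] cd by auto
  next
    case False
    have "l * (d - c) \<le> l0 / 4 * (2 * h)" using l cd c0 by (intro mult_mono) auto
    also have "\<dots> \<le> 3 / 4 * (l0 * h)" using l h by simp
    also have "\<dots> \<le> mass a c0" by (rule big)
    also have "\<dots> \<le> mass (c - (d - c)) c" using False cd by (intro mass_mono) auto
    finally show ?thesis .
  qed
  from A_infD[OF A _ l(1) this] show "s * measure lebesgue C \<le> measure lebesgue {x\<in>C. \<beta> * l \<le> f x}"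
    using cd by simp
qed

text \<open>
  On the smaller set the average is at most \<open>\<beta> s l / 2\<close>, so by Chebyshev's inequality
  \<open>f \<ge> \<beta> l\<close> holds on at most the proportion \<open>s / 2\<close> of it; the points with \<open>f < \<beta> l\<close> are at most
  the proportion \<open>1 - s\<close> of the larger set.
\<close>

lemma low_set_step:
  assumes A: "A_inf \<beta> s" and s: "0 < s" "s < 1" "0 < \<beta>" "\<beta> \<le> 1" and l: "0 < l" "l \<le> l0 / 4" and h: "0 < h"
    and c0: "a \<le> c0" "c0 \<le> a + h" "\<And>y. a \<le> y \<Longrightarrow> y \<le> c0 \<Longrightarrow> l0 / 4 * (c0 - y) \<le> mass y c0"
    and big: "3 / 4 * (l0 * h) \<le> mass a c0"
  shows "measure lebesgue (low_set c0 (a + 2 * h) (\<beta> * s / 2 * l))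
    \<le> (1 - s) / (1 - s / 2) * measure lebesgue (low_set c0 (a + 2 * h) l)"
proof -
  define U V where "U = low_set c0 (a + 2 * h) l" and "V = low_set c0 (a + 2 * h) (\<beta> * s / 2 * l)"
  have "\<beta> * s \<le> 1 * 1" using s by (intro mult_mono) auto
  then have "\<beta> * s / 2 * l \<le> l" using l by (simp add: mult_le_cancel_right1)
  then have VU: "V \<subseteq> U" unfolding U_def V_def by (rule low_set_mono)
  have UV: "open U" "bounded U" "open V" "bounded V" unfolding U_def V_def using open_low_set bounded_low_set by auto
  then have meas: "U \<in> sets lebesgue" "V \<in> sets lebesgue" by auto
  have "(LINT x:V|lebesgue. f x) \<le> \<beta> * s / 2 * l * measure lebesgue V"
    unfolding V_def
  proof (rule component_integral_le[OF open_low_set bounded_low_set])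
    fix C assume "C \<in> components (low_set c0 (a + 2 * h) (\<beta> * s / 2 * l))"
    from low_set_component[OF this] obtain c d where
      "c < d" "C = {c<..<d}" "mass c d \<le> \<beta> * s / 2 * l * (d - c)" by metis
    then show "(LINT x:C|lebesgue. f x) \<le> \<beta> * s / 2 * l * measure lebesgue C"
      by (simp add: integral_Ioo)
  qed
  with Chebyshev[OF meas(2) UV(4), of "\<beta> * l"]
  have "\<beta> * l * measure lebesgue {x\<in>V. \<beta> * l \<le> f x} \<le> \<beta> * l * (s / 2 * measure lebesgue V)"
    by (simp add: algebra_simps)
  then have 1: "measure lebesgue {x\<in>V. \<beta> * l \<le> f x} \<le> s / 2 * measure lebesgue V" using s l by simp
  have "measure lebesgue {x\<in>V. f x < \<beta> * l} \<le> measure lebesgue {x\<in>U. f x < \<beta> * l}"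
    by (rule measure_mono_bounded) (use VU UV meas in \<open>auto intro!: level_set_meas intro: bounded_restrict\<close>)
  also have "\<dots> \<le> (1 - s) * measure lebesgue U"
    using low_set_level[OF A l h c0 big] measure_level_split[OF meas(1) UV(2), of "\<beta> * l"]
    unfolding U_def by (simp add: algebra_simps)
  finally have "(1 - s / 2) * measure lebesgue V \<le> (1 - s) * measure lebesgue U"
    using 1 measure_level_split[OF meas(2) UV(4), of "\<beta> * l"] by (simp add: algebra_simps)
  then show ?thesis unfolding U_def V_def using s by (simp add: field_simps)
qed

theorem lower_level_decay:
  assumes A: "A_inf \<beta> s" and s: "0 < s" "s < 1" "0 < \<beta>" "\<beta> \<le> 1"
  obtains C q where "C > 0" "q > 0"
    "\<And>a h l0 t. 0 < h \<Longrightarrow> 0 < l0 \<Longrightarrow> l0 * h \<le> mass a (a + h) \<Longrightarrow> 0 < t \<Longrightarrow>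
      measure lebesgue {x\<in>{a+h<..<a+2*h}. f x < t * l0} \<le> C * h * t powr q"
proof -
  define \<theta> where "\<theta> = (1 - s) / (1 - s / 2)"
  define \<gamma> where "\<gamma> = \<beta> * s / 2"
  have "\<beta> * s \<le> 1 * s" using s by (intro mult_right_mono) auto
  then have "\<beta> * s < 1" using s by linarith
  then have g: "0 < \<gamma>" "\<gamma> < 1" using s by (auto simp: \<gamma>_def)
  have th: "0 < \<theta>" "\<theta> < 1" using s by (auto simp: \<theta>_def field_simps)
  define q where "q = log \<gamma> \<theta>"
  have q: "q > 0" using th g unfolding q_def log_def by (simp add: divide_simps)
  show ?thesis
  proof (rule that[of "2 / \<theta> * 4 powr q" q])
    fix a h l0 t :: real
    assume h: "0 < h" and l0: "0 < l0" and avg: "l0 * h \<le> mass a (a + h)" and t: "0 < t"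
    \<comment> \<open>A maximum point of this function on the left half has all left averages down to \<open>a\<close>
    at least \<open>l0 / 4\<close>, and at most a quarter of the mass lies to its right in that half.\<close>
    let ?G = "\<lambda>x. mass a x - l0 / 4 * x"
    have "continuous_on {a..a+h} ?G" by (intro continuous_intros mass_cont)
    then obtain c0 where c0: "c0 \<in> {a..a+h}" "\<And>y. y \<in> {a..a+h} \<Longrightarrow> ?G y \<le> ?G c0"
      using continuous_attains_sup[of "{a..a+h}" ?G] h by auto
    have c0_left: "l0 / 4 * (c0 - y) \<le> mass y c0" if "a \<le> y" "y \<le> c0" for y
      using c0(2)[of y] c0(1) mass_split[of a y c0] that by (auto simp: algebra_simps)
    have big: "3 / 4 * (l0 * h) \<le> mass a c0"
    proof -
      have "l0 * c0 \<ge> l0 * a" using c0 l0 by simp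
      moreover have "mass a (a + h) - l0 / 4 * (a + h) \<le> mass a c0 - l0 / 4 * c0" using c0(2)[of "a + h"] h by auto
      moreover have "l0 / 4 * (a + h) = l0 * a / 4 + l0 * h / 4" by (simp add: field_simps)
      ultimately show ?thesis using avg by linarith
    qed
    define b where "b = a + 2 * h"
    define \<phi> where "\<phi> u = measure lebesgue (low_set c0 b (u * l0 / 4))" for u
    have \<phi>_le: "\<phi> u \<le> 2 * h" for u
    proof -
      have "\<phi> u \<le> measure lebesgue {a<..<b}"
        unfolding \<phi>_def by (rule measure_mono_bounded) (auto simp: open_low_set, use c0 in \<open>auto simp: low_set_def\<close>)
      then show ?thesis using h by (simp add: b_def)
    qed
    have geo: "\<phi> (\<gamma> ^ k) \<le> (2 * h) * \<theta> ^ k" for k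
    proof (induction k)
      case 0 then show ?case using \<phi>_le[of 1] by simp
    next
      case (Suc k)
      have "\<gamma> ^ k > 0" "\<gamma> ^ k \<le> 1" using g by (auto intro: power_le_one)
      then have "0 < \<gamma> ^ k * l0 / 4" "\<gamma> ^ k * l0 / 4 \<le> l0 / 4" using l0 by (auto simp: mult_le_cancel_right1)
      from low_set_step[OF A s this h _ _ c0_left big] c0(1)
      have "\<phi> (\<gamma> ^ Suc k) \<le> \<theta> * \<phi> (\<gamma> ^ k)"
        unfolding \<phi>_def \<theta>_def b_def by (simp add: \<gamma>_def algebra_simps)
      also have "\<dots> \<le> \<theta> * ((2 * h) * \<theta> ^ k)" using Suc th by (intro mult_left_mono) auto
      finally show ?case by (simp add: algebra_simps)
    qed
    have sub: "measure lebesgue {x\<in>{a+h<..<b}. f x < t * l0} \<le> \<phi> (4 * t)"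
    proof -
      have "measure lebesgue {x\<in>{a+h<..<b}. f x < t * l0} \<le> measure lebesgue (low_set c0 b (t * l0) \<union> N)"
      proof (rule measure_mono_fmeasurable)
        show "{x\<in>{a+h<..<b}. f x < t * l0} \<subseteq> low_set c0 b (t * l0) \<union> N"
          using local_average_less[of _ "t * l0" c0] c0(1) unfolding low_set_def by auto
        show "low_set c0 b (t * l0) \<union> N \<in> lmeasurable"
          using bounded_set_imp_lmeasurable[OF bounded_low_set] open_low_set fmeasurableI_null_sets[OF null]
          by (intro fmeasurable.Un) auto
      qed (auto intro!: level_set_meas)
      also have "\<dots> = measure lebesgue (low_set c0 b (t * l0))"
        using null open_low_set by (intro measure_Un_null_set) auto
      finally show ?thesis by (simp add: \<phi>_def mult.commute)
    qed
    have "measure lebesgue {x\<in>{a+h<..<b}. f x < t * l0} \<le> 2 * h / \<theta> * (4 * t) powr q"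
    proof (cases "4 * t \<le> 1")
      case True
      have "\<phi> (4 * t) \<le> (2 * h) / \<theta> * (4 * t) powr log \<gamma> \<theta>"
      proof (rule geometric_decay_imp_power_decay[OF g th])
        fix u v :: real assume "0 < u" "u \<le> v"
        then show "\<phi> u \<le> \<phi> v" unfolding \<phi>_def using l0
          by (intro measure_mono_bounded low_set_mono bounded_low_set) (auto simp: open_low_set)
      qed (use True h t geo in auto)
      then show ?thesis using sub by (simp add: q_def)
    next
      case False
      have "1 powr q \<le> (4 * t) powr q" using False t q by (intro powr_mono2) auto
      moreover have "1 \<le> 1 / \<theta>" using th by simp
      ultimately have "1 * 1 \<le> 1 / \<theta> * (4 * t) powr q" using th by (intro mult_mono) auto
      then have "(2 * h) * 1 \<le> (2 * h) * (1 / \<theta> * (4 * t) powr q)" using h by (intro mult_left_mono) auto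
      then show ?thesis using sub \<phi>_le[of "4 * t"] by (simp add: algebra_simps)
    qed
    then show "measure lebesgue {x\<in>{a+h<..<a+2*h}. f x < t * l0} \<le> 2 / \<theta> * 4 powr q * h * t powr q"
      using t by (simp add: b_def powr_mult algebra_simps)
  qed (use q th in auto)
qed

end

section \<open>From weak type bounds to integrals\<close>

text \<open>
  The constant from summing the geometric series over the dyadic levels of a function with tails
  of order \<open>t powr (- q)\<close>, integrated to the power \<open>\<alpha>\<close>.
\<close>
definition weak_const :: "real \<Rightarrow> real \<Rightarrow> real" where
  "weak_const \<alpha> q = 1 + 2 powr \<alpha> / (1 - 2 powr (\<alpha> - q))"

lemma weak_const_pos: "0 < \<alpha> \<Longrightarrow> \<alpha> < q \<Longrightarrow> 0 < weak_const \<alpha> q"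
proof -
  assume "0 < \<alpha>" "\<alpha> < q"
  then have "2 powr (\<alpha> - q) < (1::real)" using powr_less_mono[of "\<alpha> - q" 0 2] by auto
  then show ?thesis unfolding weak_const_def by (intro add_pos_nonneg) auto
qed

text \<open>
  The function is compared with the sum of the dyadic values \<open>2 powr (p (k+1))\<close> on the
  sets \<open>{g > 2 ^ k}\<close>, whose measures decay faster than these values grow because \<open>p < q\<close>.
\<close>

lemma weak_type_nn_integral_le:
  fixes g :: "real \<Rightarrow> real"
  assumes S: "S \<in> sets lebesgue" "bounded S" and g [measurable]: "g \<in> borel_measurable lebesgue"
    and g0: "\<And>x. 0 \<le> g x"
    and pq: "0 < p" "p < q" and K: "measure lebesgue S \<le> K"
    and weak: "\<And>t. 1 \<le> t \<Longrightarrow> measure lebesgue {x\<in>S. t < g x} \<le> K * t powr (- q)"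
  shows "(\<integral>\<^sup>+x\<in>S. ennreal (g x powr p) \<partial>lebesgue) \<le> ennreal (K * weak_const p q)"
proof -
  define A where "A k = {x\<in>S. 2 ^ k < g x}" for k :: nat
  define c where "c k = 2 powr (p * real (Suc k))" for k :: nat
  define r where "r = 2 powr (p - q)"
  have r: "0 < r" "r < 1" unfolding r_def using pq powr_less_mono[of "p - q" 0 2] by auto
  have K0: "0 \<le> K" using K measure_nonneg[of lebesgue S] by linarith
  have A: "A k \<in> sets lebesgue" "bounded (A k)" for k
  proof -
    have "A k = S \<inter> {x\<in>space lebesgue. 2 ^ k < g x}" unfolding A_def by auto
    also have "\<dots> \<in> sets lebesgue" using S by measurable
    finally show "A k \<in> sets lebesgue" .
    show "bounded (A k)" unfolding A_def using S(2) by (rule bounded_restrict)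
  qed
  have em: "emeasure lebesgue (A k) \<le> ennreal (K * (2 ^ k) powr (- q))" for k
    using weak[of "2 ^ k"] A[of k] emeasure_eq_measure2[OF bounded_set_imp_lmeasurable[of "A k"]]
    unfolding A_def by (simp add: ennreal_leI)
  have emS: "emeasure lebesgue S \<le> ennreal K"
    using K S emeasure_eq_measure2[OF bounded_set_imp_lmeasurable[of S]] by (simp add: ennreal_leI)
  have sng: "F k \<le> suminf F" for F :: "nat \<Rightarrow> ennreal" and k
    using sum_le_suminf[of F "{k}"] by simp
  have pw: "ennreal (g x powr p) * indicator S x \<le> indicator S x + (\<Sum>k. ennreal (c k) * indicator (A k) x)" for x
  proof (cases "x \<in> S \<and> 1 < g x")
    case True
    obtain n where n: "g x < 2 ^ n" using real_arch_pow[of 2 "g x"] by auto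
    define m where "m = (LEAST n. g x \<le> 2 ^ n)"
    have m: "g x \<le> 2 ^ m" unfolding m_def using n by (intro LeastI) (rule less_imp_le)
    have "m \<noteq> 0" using m True by (cases m) auto
    then obtain k where k: "m = Suc k" using not0_implies_Suc by blast
    have "\<not> g x \<le> 2 ^ k" using not_less_Least[of k "\<lambda>n. g x \<le> 2 ^ n"] k m_def by auto
    then have xA: "x \<in> A k" using True unfolding A_def by auto
    have "g x powr p \<le> (2 ^ m) powr p" using m g0 pq by (intro powr_mono2) auto
    also have "\<dots> = c k" unfolding c_def k by (simp add: powr_powr mult.commute del: power_Suc flip: powr_realpow)
    finally have "ennreal (g x powr p) * indicator S x \<le> ennreal (c k) * indicator (A k) x"
      using xA True by (simp add: ennreal_leI)
    also have "\<dots> \<le> (\<Sum>k. ennreal (c k) * indicator (A k) x)"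
      by (rule sng)
    finally show ?thesis by (intro add_increasing) auto
  next
    case False
    have "ennreal (g x powr p) * indicator S x \<le> indicator S x"
    proof (cases "x \<in> S")
      case True
      then have "g x powr p \<le> 1 powr p" using False g0 pq by (intro powr_mono2) auto
      then show ?thesis using True by simp
    qed simp
    then show ?thesis by (intro add_increasing2) auto
  qed
  have summand: "ennreal (c k) * emeasure lebesgue (A k) \<le> ennreal (K * 2 powr p * r ^ k)" for k
  proof -
    have "ennreal (c k) * emeasure lebesgue (A k) \<le> ennreal (c k) * ennreal (K * (2 ^ k) powr (- q))"
      by (intro mult_left_mono em) simp
    also have "\<dots> = ennreal (c k * (K * (2 ^ k) powr (- q)))" using K0 by (simp add: ennreal_mult c_def)
    also have "c k * (K * (2 ^ k) powr (- q)) = K * 2 powr p * r ^ k"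
    proof -
      have "(2 ^ k) powr (- q) = (2::real) powr (- q * k)"
        by (simp add: powr_powr mult.commute flip: powr_realpow)
      moreover have "r ^ k = 2 powr ((p - q) * k)" unfolding r_def by (simp add: powr_powr flip: powr_realpow)
      ultimately show ?thesis unfolding c_def by (simp add: powr_add[symmetric] algebra_simps)
    qed
    finally show ?thesis .
  qed
  have "(\<integral>\<^sup>+x\<in>S. ennreal (g x powr p) \<partial>lebesgue)
      \<le> (\<integral>\<^sup>+x. indicator S x + (\<Sum>k. ennreal (c k) * indicator (A k) x) \<partial>lebesgue)"
    by (intro nn_integral_mono pw)
  also have "\<dots> = emeasure lebesgue S + (\<integral>\<^sup>+x. (\<Sum>k. ennreal (c k) * indicator (A k) x) \<partial>lebesgue)"
    using S A by (subst nn_integral_add) (auto intro!: borel_measurable_suminf)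
  also have "(\<integral>\<^sup>+x. (\<Sum>k. ennreal (c k) * indicator (A k) x) \<partial>lebesgue) = (\<Sum>k. ennreal (c k) * emeasure lebesgue (A k))"
    using A by (subst nn_integral_suminf) (auto simp: nn_integral_cmult_indicator)
  also have "\<dots> \<le> (\<Sum>k. ennreal (K * 2 powr p * r ^ k))"
    by (intro suminf_le summand summableI)
  also have "\<dots> = ennreal (K * 2 powr p * (1 / (1 - r)))"
    using r K0 by (intro suminf_ennreal_eq sums_mult geometric_sums) auto
  finally have "(\<integral>\<^sup>+x\<in>S. ennreal (g x powr p) \<partial>lebesgue) \<le> ennreal K + ennreal (K * 2 powr p * (1 / (1 - r)))"
    using emS by (meson add_mono order_trans order_refl)
  also have "\<dots> = ennreal (K * (1 + 2 powr p / (1 - r)))"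
    using K0 r by (simp add: ennreal_plus[symmetric] algebra_simps del: ennreal_plus)
  finally show ?thesis unfolding r_def weak_const_def .
qed

section \<open>Gap lengths and the distance to the set\<close>

lemma admissible_length_le:
  assumes "admissible_length s E a b l" "0 < l"
  shows "l \<le> b - a"
proof -
  obtain k :: nat and u v :: "nat \<Rightarrow> real" where "k \<ge> 1" and uv: "\<And>i. i \<in> {1..k} \<Longrightarrow> {u i<..<v i} \<subseteq> {a<..<b} - E \<and> l \<le> v i - u i"
    using assms(1) unfolding admissible_length_def by blast
  then have "{u 1<..<v 1} \<subseteq> {a<..<b}" "l \<le> v 1 - u 1" by (auto dest: uv[of 1])
  then show ?thesis using assms(2) by (auto simp: greaterThanLessThan_subseteq_greaterThanLessThan)
qed

lemma admissible_length_le_L_s: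
  assumes "admissible_length s E a b l" "0 < l"
  shows "l \<le> L_s s E a b"
proof -
  have "l \<le> Sup {l. l > 0 \<and> admissible_length s E a b l}"
    using assms admissible_length_le by (intro cSup_upper) (auto intro!: bdd_aboveI)
  then show ?thesis using assms unfolding L_s_def by auto
qed

lemma admissible_length_above:
  assumes "0 < L_s s E a b" "l < L_s s E a b"
  obtains l' where "l < l'" "0 < l'" "admissible_length s E a b l'"
proof -
  have ex: "\<exists>l>0. admissible_length s E a b l" using assms(1) unfolding L_s_def by (auto split: if_splits)
  then have "l < Sup {l. l > 0 \<and> admissible_length s E a b l}" using assms(2) unfolding L_s_def by auto
  then obtain l' where "l' \<in> {l. l > 0 \<and> admissible_length s E a b l}" "l < l'"
    using less_cSupD[of "{l. l > 0 \<and> admissible_length s E a b l}" l] ex by auto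
  then show ?thesis using that by auto
qed

lemma L_s_nonneg: "0 \<le> L_s s E a b"
proof (cases "\<exists>l>0. admissible_length s E a b l")
  case True
  then show ?thesis using admissible_length_le_L_s by (meson less_imp_le order_trans)
next
  case False
  then have "L_s s E a b = 0" unfolding L_s_def by (rule if_not_P)
  then show ?thesis by simp
qed

lemma le_infdistI:
  fixes E :: "real set"
  assumes "E \<noteq> {}" "\<And>y. y \<in> E \<Longrightarrow> r \<le> dist x y"
  shows "r \<le> infdist x E"
  using assms by (simp add: infdist_notempty cINF_greatest)

lemma measure_disjoint_Ioo:
  fixes u v :: "nat \<Rightarrow> real"
  assumes "disjoint_family_on (\<lambda>i. {u i<..<v i}) {1..k}" "\<And>i. i \<in> {1..k} \<Longrightarrow> u i \<le> v i"
  shows "measure lebesgue (\<Union>i\<in>{1..k}. {u i<..<v i}) = (\<Sum>i=1..k. v i - u i)"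
proof -
  have "measure lebesgue (\<Union>i\<in>{1..k}. {u i<..<v i}) = (\<Sum>i\<in>{1..k}. measure lebesgue {u i<..<v i})"
    by (rule measure_finite_Union) (use assms in \<open>auto simp: less_top\<close>)
  also have "\<dots> = (\<Sum>i=1..k. v i - u i)" using assms(2) by (intro sum.cong) auto
  finally show ?thesis .
qed

lemma borel_measurable_infdist [measurable]: "(\<lambda>x::real. infdist x E) \<in> borel_measurable borel"
  by (intro borel_measurable_continuous_onI continuous_intros)

lemma infdist_level_set_meas:
  fixes E :: "real set"
  assumes "U \<in> sets lebesgue"
  shows "{x\<in>U. r < infdist x E} \<in> sets lebesgue" "{x\<in>U. r \<le> infdist x E} \<in> sets lebesgue"
    "{x\<in>U. infdist x E \<le> r} \<in> sets lebesgue" "{x\<in>U. infdist x E < r} \<in> sets lebesgue"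
proof -
  have "{x\<in>space borel. r < infdist x E} \<in> sets borel" "{x\<in>space borel. r \<le> infdist x E} \<in> sets borel"
    "{x\<in>space borel. infdist x E \<le> r} \<in> sets borel" "{x\<in>space borel. infdist x E < r} \<in> sets borel"
    by measurable
  then have *: "{x. r < infdist x E} \<in> sets lebesgue" "{x. r \<le> infdist x E} \<in> sets lebesgue"
    "{x. infdist x E \<le> r} \<in> sets lebesgue" "{x. infdist x E < r} \<in> sets lebesgue" by auto
  have **: "{x\<in>U. P x} = U \<inter> {x. P x}" for P by auto
  show "{x\<in>U. r < infdist x E} \<in> sets lebesgue" "{x\<in>U. r \<le> infdist x E} \<in> sets lebesgue"
    "{x\<in>U. infdist x E \<le> r} \<in> sets lebesgue" "{x\<in>U. infdist x E < r} \<in> sets lebesgue"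
    using * assms by (subst **, blast)+
qed

text \<open>
  The middle half of a gap of length at least \<open>l\<close> has distance at least \<open>l / 4\<close> from \<open>E\<close>, and the
  middle halves together make up half of the total length of the gaps.
\<close>

lemma admissible_length_far:
  fixes E :: "real set"
  assumes E: "E \<noteq> {}" and adm: "admissible_length s E a b l" and l: "0 < l"
  shows "(1 - s) * (b - a) / 2 \<le> measure lebesgue {x\<in>{a<..<b}. l / 4 \<le> infdist x E}"
    and "(1 - s) * (b - a) \<le> measure lebesgue ({a<..<b} - closure E)"
proof -
  obtain k :: nat and u v :: "nat \<Rightarrow> real" where dis: "disjoint_family_on (\<lambda>i. {u i<..<v i}) {1..k}"
    and uv: "\<And>i. i \<in> {1..k} \<Longrightarrow> {u i<..<v i} \<subseteq> {a<..<b} - E" "\<And>i. i \<in> {1..k} \<Longrightarrow> l \<le> v i - u i"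
    and tot: "(1 - s) * (b - a) \<le> (\<Sum>i=1..k. v i - u i)"
    using adm unfolding admissible_length_def by blast
  have le: "u i \<le> v i" if "i \<in> {1..k}" for i using uv(2)[OF that] l by simp
  have "(\<Union>i\<in>{1..k}. {u i<..<v i}) \<subseteq> {a<..<b} - closure E"
  proof -
    have "{u i<..<v i} \<inter> closure E = {}" if "i \<in> {1..k}" for i
      using uv(1)[OF that] open_Int_closure_eq_empty[of "{u i<..<v i}" E] by auto
    then show ?thesis using uv(1) by blast
  qed
  then have "measure lebesgue (\<Union>i\<in>{1..k}. {u i<..<v i}) \<le> measure lebesgue ({a<..<b} - closure E)"
    by (rule measure_mono_bounded) (auto intro!: bounded_restrict)
  then show "(1 - s) * (b - a) \<le> measure lebesgue ({a<..<b} - closure E)"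
    using measure_disjoint_Ioo[OF dis le] tot by simp
  define u' v' where "u' i = u i + (v i - u i) / 4" and "v' i = v i - (v i - u i) / 4" for i
  have sub: "{u' i<..<v' i} \<subseteq> {u i<..<v i}" if "i \<in> {1..k}" for i
    using le[OF that] by (auto simp: u'_def v'_def field_simps)
  have dis': "disjoint_family_on (\<lambda>i. {u' i<..<v' i}) {1..k}"
    using dis sub unfolding disjoint_family_on_def by blast
  have le': "u' i \<le> v' i" if "i \<in> {1..k}" for i using le[OF that] by (simp add: u'_def v'_def field_simps)
  have "(\<Union>i\<in>{1..k}. {u' i<..<v' i}) \<subseteq> {x\<in>{a<..<b}. l / 4 \<le> infdist x E}"
  proof clarify
    fix i x assume i: "i \<in> {1..k}" and x: "x \<in> {u' i<..<v' i}"
    have "l / 4 \<le> infdist x E"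
    proof (rule le_infdistI[OF E])
      fix y assume "y \<in> E"
      then have "y \<notin> {u i<..<v i}" using uv(1)[OF i] by auto
      then have "y \<le> u i \<or> v i \<le> y" by auto
      moreover have "u' i \<le> x" "x \<le> v' i" using x by auto
      then have "u i + l / 4 \<le> x \<and> x \<le> v i - l / 4"
        using uv(2)[OF i] unfolding u'_def v'_def by argo
      ultimately show "l / 4 \<le> dist x y" unfolding dist_real_def by linarith
    qed
    moreover have "x \<in> {a<..<b}" using sub[OF i] uv(1)[OF i] x by blast
    ultimately show "x \<in> {a<..<b} \<and> l / 4 \<le> infdist x E" by blast
  qed
  then have "measure lebesgue (\<Union>i\<in>{1..k}. {u' i<..<v' i}) \<le> measure lebesgue {x\<in>{a<..<b}. l / 4 \<le> infdist x E}"
    by (rule measure_mono_bounded)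
       (intro sets.finite_UN infdist_level_set_meas bounded_restrict; simp)+
  also have "measure lebesgue (\<Union>i\<in>{1..k}. {u' i<..<v' i}) = (\<Sum>i=1..k. v i - u i) / 2"
  proof -
    have half: "v' i - u' i = (v i - u i) / 2" for i by (simp add: u'_def v'_def field_simps)
    show ?thesis using measure_disjoint_Ioo[OF dis' le'] unfolding half sum_divide_distrib .
  qed
  finally show "(1 - s) * (b - a) / 2 \<le> measure lebesgue {x\<in>{a<..<b}. l / 4 \<le> infdist x E}"
    using tot by simp
qed

text \<open>
  If \<open>x \<in> (a + \<rho>, b)\<close> has distance more than \<open>\<rho>\<close> from \<open>E\<close>, then \<open>[x - \<rho>, x]\<close> lies in one component of
  \<open>(a, b) - closure E\<close>. The components reached in this way have length at least \<open>\<rho>\<close>, so there are only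
  finitely many, and they cover the far points. Points close to \<open>a\<close> are left out since the
  component containing them may be cut off at \<open>a\<close>.
\<close>

lemma admissible_length_of_far_set:
  fixes E :: "real set"
  assumes E: "E \<noteq> {}" and ab: "a < b" and s: "s < 1" and \<rho>: "0 < \<rho>"
    and far: "(1 - s) * (b - a) \<le> measure lebesgue {x\<in>{a+\<rho><..<b}. \<rho> < infdist x E}"
  shows "admissible_length s E a b \<rho>"
proof -
  define T where "T = {x\<in>{a+\<rho><..<b}. \<rho> < infdist x E}"
  define U where "U = {a<..<b} - closure E"
  have U: "open U" "bounded U" unfolding U_def by (auto intro!: bounded_restrict open_Diff)
  define D where "D = {C \<in> components U. C \<inter> T \<noteq> {}}"
  have xU: "{x - \<rho>..x} \<subseteq> U" if x: "x \<in> T" for x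
  proof
    fix y assume y: "y \<in> {x - \<rho>..x}"
    have "y \<notin> closure E"
    proof
      assume "y \<in> closure E"
      then have "infdist y E = 0" using in_closure_iff_infdist_zero[OF E] by simp
      then have "infdist x E \<le> dist x y" using infdist_triangle[of x E y] by simp
      then show False using y x by (auto simp: T_def dist_real_def)
    qed
    then show "y \<in> U" using y x \<rho> by (auto simp: U_def T_def)
  qed
  have TD: "T \<subseteq> \<Union>D"
  proof
    fix x assume x: "x \<in> T"
    then have "x \<in> U" using xU[OF x] \<rho> by auto
    then obtain C where "C \<in> components U" "x \<in> C" using Union_components[of U] by blast
    then show "x \<in> \<Union>D" using x by (auto simp: D_def)
  qed
  have DU: "D \<subseteq> components U" unfolding D_def by auto
  have comp: "C = {Inf C<..<Sup C} \<and> \<rho> \<le> Sup C - Inf C" if C: "C \<in> D" for C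
  proof -
    obtain c d where cd: "c < d" "C = {c<..<d}"
      using component_of_bounded_open_real[OF U] C DU by blast
    obtain x where x: "x \<in> C" "x \<in> T" using C unfolding D_def by auto
    have "{x - \<rho>..x} \<subseteq> C"
      using C DU x xU[OF x(2)] \<rho> by (intro components_maximal[of C U]) auto
    then have "x - \<rho> \<in> C" using \<rho> by auto
    then have "\<rho> \<le> d - c" using cd x(1) by auto
    then show ?thesis using cd by simp
  qed
  have mC: "\<rho> \<le> measure lebesgue C" "C \<in> lmeasurable" if "C \<in> D" for C
  proof -
    have C: "C = {Inf C<..<Sup C}" "\<rho> \<le> Sup C - Inf C" using comp[OF that] by auto
    show "C \<in> lmeasurable" by (subst C(1)) simp
    have "measure lebesgue C = Sup C - Inf C" by (subst C(1)) (use C(2) \<rho> in simp)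
    then show "\<rho> \<le> measure lebesgue C" using C(2) by simp
  qed
  have sum_eq: "measure lebesgue (\<Union>D') = (\<Sum>C\<in>D'. measure lebesgue C)" if D': "finite D'" "D' \<subseteq> D" for D'
  proof -
    have "disjoint_family_on (\<lambda>C. C) D'"
      unfolding disjoint_family_on_def using D' DU components_nonoverlap by blast
    then have "measure lebesgue (\<Union>C\<in>D'. C) = (\<Sum>C\<in>D'. measure lebesgue C)"
      using D' mC by (intro measure_finite_Union) (auto simp: fmeasurable_def less_top)
    then show ?thesis by simp
  qed
  have finD: "finite D"
  proof (rule finite_if_finite_subsets_card_bdd[THEN conjunct1])
    fix D' assume D': "D' \<subseteq> D" "finite D'"
    have "\<rho> * card D' \<le> (\<Sum>C\<in>D'. measure lebesgue C)"
      using sum_mono[of D' "\<lambda>_. \<rho>" "measure lebesgue"] mC(1) D' by (simp add: mult.commute subset_iff)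
    also have "\<dots> = measure lebesgue (\<Union>D')" using sum_eq D' by simp
    also have "\<dots> \<le> measure lebesgue {a<..<b}"
    proof (rule measure_mono_bounded)
      show "\<Union>D' \<subseteq> {a<..<b}" using D' DU in_components_subset[of _ U] unfolding U_def by blast
      show "\<Union>D' \<in> sets lebesgue" using D' mC by (intro sets.finite_Union) (auto simp: fmeasurable_def)
    qed auto
    finally have "card D' \<le> (b - a) / \<rho>" using \<rho> ab by (simp add: field_simps)
    then show "card D' \<le> nat \<lfloor>(b - a) / \<rho>\<rfloor>" by (simp add: le_nat_floor)
  qed
  have "0 < measure lebesgue T" using far s ab unfolding T_def by (smt (verit) mult_pos_pos)
  then have "D \<noteq> {}" using TD by auto
  obtain h where h: "bij_betw h {1..card D} D" using ex_bij_betw_nat_finite_1[OF finD] by blast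
  define u v where "u i = Inf (h i)" and "v i = Sup (h i)" for i
  have hD: "h i \<in> D" if "i \<in> {1..card D}" for i using h that by (auto simp: bij_betw_def)
  have uv: "{u i<..<v i} = h i" "\<rho> \<le> v i - u i" if "i \<in> {1..card D}" for i
    using comp[OF hD[OF that]] by (auto simp: u_def v_def)
  have dis: "disjoint_family_on (\<lambda>i. {u i<..<v i}) {1..card D}"
    unfolding disjoint_family_on_def
  proof (intro ballI impI)
    fix i j assume ij: "i \<in> {1..card D}" "j \<in> {1..card D}" "i \<noteq> j"
    then have "h i \<noteq> h j" using inj_onD[OF bij_betw_imp_inj_on[OF h]] by blast
    then show "{u i<..<v i} \<inter> {u j<..<v j} = {}"
      using components_nonoverlap[of "h i" U "h j"] hD[OF ij(1)] hD[OF ij(2)] DU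
      unfolding uv(1)[OF ij(1)] uv(1)[OF ij(2)] by blast
  qed
  have "(1 - s) * (b - a) \<le> measure lebesgue T" using far unfolding T_def .
  also have "\<dots> \<le> measure lebesgue (\<Union>i\<in>{1..card D}. {u i<..<v i})"
  proof (rule measure_mono_bounded)
    have "(\<Union>i\<in>{1..card D}. {u i<..<v i}) = \<Union>(h ` {1..card D})" using uv by simp
    then show "T \<subseteq> (\<Union>i\<in>{1..card D}. {u i<..<v i})"
      using TD unfolding bij_betw_imp_surj_on[OF h] by simp
    show "T \<in> sets lebesgue" unfolding T_def by (rule infdist_level_set_meas) auto
  qed auto
  also have "\<dots> = (\<Sum>i=1..card D. v i - u i)"
    using dis uv(2) \<rho> by (intro measure_disjoint_Ioo) force+
  finally have tot: "(1 - s) * (b - a) \<le> (\<Sum>i=1..card D. v i - u i)" .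
  have "{u i<..<v i} \<subseteq> {a<..<b} - E" if "i \<in> {1..card D}" for i
    using uv(1)[OF that] hD[OF that] DU in_components_subset[of "h i" U] closure_subset[of E] unfolding U_def by auto
  moreover have "1 \<le> card D" using finD \<open>D \<noteq> {}\<close> by (simp add: Suc_le_eq card_gt_0_iff)
  ultimately show ?thesis unfolding admissible_length_def using dis uv(2) tot by blast
qed

section \<open>Distance weights and the Muckenhoupt condition\<close>

lemma ennpowr_ennreal: "0 < r \<Longrightarrow> ennpowr (ennreal r) a = ennreal (r powr a)"
  unfolding ennpowr_def by (auto simp: ennreal_eq_0_iff)

lemma ennpowr_mono:
  assumes "0 < a" "x \<le> y" shows "ennpowr x a \<le> ennpowr y a"
proof (cases "y = \<infinity> \<or> x = 0")
  case True then show ?thesis using assms unfolding ennpowr_def by (auto simp: top_unique)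
next
  case False
  then have "x \<noteq> \<infinity>" "y \<noteq> 0" using assms by (auto simp: top_unique)
  moreover have "enn2real x \<le> enn2real y" using assms False by (intro enn2real_mono) (auto simp: less_top)
  ultimately show ?thesis using assms False unfolding ennpowr_def
    by (auto intro!: ennreal_leI powr_mono2)
qed

text \<open>
  A real-valued version of \<open>dist_weight\<close>. It takes the value 0 instead of \<open>\<infinity>\<close> on the closure of
  \<open>E\<close>, so the two agree almost everywhere once that closure is a null set.
\<close>
definition real_dist_weight :: "real set \<Rightarrow> real \<Rightarrow> real \<Rightarrow> real" where
  "real_dist_weight E \<alpha> x = infdist x E powr (- \<alpha>)"

lemma infdist_eq_0_iff_closure: "E \<noteq> {} \<Longrightarrow> infdist x E = 0 \<longleftrightarrow> x \<in> closure E"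
  using in_closure_iff_infdist_zero by blast

lemma infdist_pos_iff_closure: "E \<noteq> {} \<Longrightarrow> 0 < infdist x E \<longleftrightarrow> x \<notin> closure E"
  using infdist_eq_0_iff_closure[of E x] infdist_nonneg[of x E] by linarith

lemma dist_weight_eq_real:
  "E \<noteq> {} \<Longrightarrow> x \<notin> closure E \<Longrightarrow> dist_weight E \<alpha> x = ennreal (real_dist_weight E \<alpha> x)"
  unfolding dist_weight_def real_dist_weight_def using infdist_eq_0_iff_closure by auto

lemma real_dist_weight_pos: "E \<noteq> {} \<Longrightarrow> x \<notin> closure E \<Longrightarrow> 0 < real_dist_weight E \<alpha> x"
  unfolding real_dist_weight_def using infdist_eq_0_iff_closure by auto

lemma borel_measurable_real_dist_weight [measurable]: "real_dist_weight E \<alpha> \<in> borel_measurable borel"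
  unfolding real_dist_weight_def by measurable

lemma borel_measurable_dist_weight [measurable]: "dist_weight E \<alpha> \<in> borel_measurable borel"
  unfolding dist_weight_def by measurable

lemma AE_notin_closure:
  assumes "closure E \<in> null_sets lebesgue" shows "AE x::real in lebesgue. x \<notin> closure E"
  using assms by (rule AE_not_in)

lemma set_nn_integral_dist_weight:
  assumes "E \<noteq> {}" "closure E \<in> null_sets lebesgue"
  shows "(\<integral>\<^sup>+x\<in>U. dist_weight E \<alpha> x \<partial>lebesgue) = (\<integral>\<^sup>+x\<in>U. ennreal (real_dist_weight E \<alpha> x) \<partial>lebesgue)"
  using AE_notin_closure[OF assms(2)] dist_weight_eq_real[OF assms(1)]
  by (intro nn_integral_cong_AE) auto

lemma regular_real_dist_weight:
  assumes E: "E \<noteq> {}" "closure E \<in> null_sets lebesgue"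
    and fin: "\<And>a b. (\<integral>\<^sup>+x\<in>{a..b}. dist_weight E \<alpha> x \<partial>lebesgue) < \<infinity>"
  shows "regular_weight (real_dist_weight E \<alpha>) (closure E)"
proof
  show "set_integrable lebesgue {a..b} (real_dist_weight E \<alpha>)" for a b
    unfolding set_integrable_def
  proof (rule integrableI_bounded)
    show "(\<lambda>x. indicat_real {a..b} x *\<^sub>R real_dist_weight E \<alpha> x) \<in> borel_measurable lebesgue"
      by (intro borel_measurable_scaleR borel_measurable_indicator measurable_completion) auto
    have "(\<integral>\<^sup>+x. ennreal (norm (indicat_real {a..b} x *\<^sub>R real_dist_weight E \<alpha> x)) \<partial>lebesgue)
      = (\<integral>\<^sup>+x\<in>{a..b}. ennreal (real_dist_weight E \<alpha> x) \<partial>lebesgue)"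
      by (intro nn_integral_cong) (auto simp: indicator_def real_dist_weight_def)
    then show "(\<integral>\<^sup>+x. ennreal (norm (indicat_real {a..b} x *\<^sub>R real_dist_weight E \<alpha> x)) \<partial>lebesgue) < \<infinity>"
      using fin[of a b] set_nn_integral_dist_weight[OF E] by simp
  qed
  show "isCont (real_dist_weight E \<alpha>) x" if "x \<notin> closure E" for x
    unfolding real_dist_weight_def using that infdist_eq_0_iff_closure[OF E(1), of x]
    by (intro continuous_intros) auto
qed (auto simp: real_dist_weight_def[of E \<alpha>] assms)

context regular_weight
begin

lemma set_nn_integral_eq_mass:
  "(\<integral>\<^sup>+x\<in>{a<..<b}. ennreal (f x) \<partial>lebesgue) = ennreal (mass a b)"
proof -
  have int: "set_integrable lebesgue {a<..<b} f" by (rule integrable_on) auto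
  have "(\<integral>\<^sup>+x\<in>{a<..<b}. ennreal (f x) \<partial>lebesgue) = (\<integral>\<^sup>+x. ennreal (indicat_real {a<..<b} x *\<^sub>R f x) \<partial>lebesgue)"
    by (intro nn_integral_cong) (auto simp: indicator_def)
  also have "\<dots> = ennreal (LINT x:{a<..<b}|lebesgue. f x)"
    unfolding set_lebesgue_integral_def
    by (intro nn_integral_eq_integral) (use int nonneg in \<open>auto simp: set_integrable_def\<close>)
  finally show ?thesis by (simp add: integral_Ioo)
qed

end

text \<open>
  The weight is infinite on the closure of \<open>E\<close> and has finite integral over compact sets.
\<close>

lemma Ap_plus_imp_closure_null:
  assumes "E \<noteq> {}" "weight (dist_weight E \<alpha>)"
  shows "closure E \<in> null_sets lebesgue"
proof -
  have "closure E \<inter> {- real n..real n} \<in> null_sets lebesgue" for n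
  proof -
    let ?K = "closure E \<inter> {- real n..real n}"
    have "compact ?K" by (intro closed_Int_compact) auto
    then have "(\<integral>\<^sup>+x\<in>?K. dist_weight E \<alpha> x \<partial>lebesgue) < \<infinity>" using assms(2) unfolding weight_def by blast
    moreover have "(\<integral>\<^sup>+x\<in>?K. dist_weight E \<alpha> x \<partial>lebesgue) = (\<integral>\<^sup>+x. \<infinity> * indicator ?K x \<partial>lebesgue)"
      using infdist_eq_0_iff_closure[OF assms(1)]
      by (intro nn_integral_cong) (auto simp: dist_weight_def indicator_def)
    moreover have "?K \<in> sets lebesgue" by auto
    ultimately have "\<infinity> * emeasure lebesgue ?K < (\<infinity>::ennreal)"
      by (simp add: nn_integral_cmult_indicator)
    then have "emeasure lebesgue ?K = 0" by (auto simp: ennreal_top_mult split: if_splits)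
    then show ?thesis by (intro null_setsI) auto
  qed
  then have "(\<Union>n. closure E \<inter> {- real n..real n}) \<in> null_sets lebesgue" by (intro null_sets_UN) auto
  moreover have "(\<Union>n. closure E \<inter> {- real n..real n}) = closure E"
  proof -
    have "\<exists>n. x \<in> {- real n..real n}" for x :: real
    proof -
      obtain n where "\<bar>x\<bar> \<le> real n" using real_arch_simple by blast
      then have "x \<in> {- real n..real n}" by auto
      then show ?thesis by blast
    qed
    then show ?thesis by blast
  qed
  ultimately show ?thesis by simp
qed

text \<open>
  If \<open>w < \<kappa>\<close> on the proportion \<open>\<eta>\<close> of the right half, the dual factor in the \<open>A\<^sub>p\<^sup>+\<close> product is at
  least \<open>\<eta> powr (p - 1) / \<kappa>\<close>. Apart from local integrability, this is all that the
  proof extracts from \<open>A\<^sub>p\<^sup>+\<close>.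
\<close>

lemma Ap_plus_level_bound:
  assumes E: "E \<noteq> {}" and p: "1 < p" and Ap: "dist_weight E \<alpha> \<in> Ap_plus p"
  shows "regular_weight (real_dist_weight E \<alpha>) (closure E)"
    and "\<exists>A\<ge>1. \<forall>m h l \<eta> \<kappa>. 0 < h \<longrightarrow> 0 < l \<longrightarrow> 0 < \<eta> \<longrightarrow> 0 < \<kappa> \<longrightarrow>
      l * h \<le> regular_weight.mass (real_dist_weight E \<alpha>) (m - h) m \<longrightarrow>
      \<eta> * h \<le> measure lebesgue {x\<in>{m<..<m+h}. real_dist_weight E \<alpha> x < \<kappa>} \<longrightarrow> l * \<eta> powr (p - 1) \<le> A * \<kappa>"
proof -
  have w: "weight (dist_weight E \<alpha>)" using Ap unfolding Ap_plus_def by simp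
  have null: "closure E \<in> null_sets lebesgue" by (rule Ap_plus_imp_closure_null[OF E w])
  show reg: "regular_weight (real_dist_weight E \<alpha>) (closure E)"
    using w unfolding weight_def by (intro regular_real_dist_weight E null) auto
  interpret regular_weight "real_dist_weight E \<alpha>" "closure E" by (rule reg)
  let ?w = "dist_weight E \<alpha>" and ?f = "real_dist_weight E \<alpha>"
  let ?Q = "\<lambda>a b. ((\<integral>\<^sup>+x\<in>{a<..<(a+b)/2}. ?w x \<partial>lebesgue) / emeasure lebesgue {a<..<(a+b)/2}) *
        ennpowr ((\<integral>\<^sup>+x\<in>{(a+b)/2<..<b}. ennpowr (?w x) (- 1 / (p - 1)) \<partial>lebesgue)
             / emeasure lebesgue {(a+b)/2<..<b}) (p - 1)"
  define Z where "Z = (SUP (a, b) \<in> {(a, b). a < b}. ?Q a b)"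
  have "Z < \<infinity>" using Ap unfolding Ap_plus_def Z_def by blast
  then obtain A where A: "Z = ennreal A" "0 \<le> A" by (cases Z) auto
  have Q: "?Q a b \<le> ennreal A" if "a < b" for a b
    unfolding A(1)[symmetric] Z_def by (rule SUP_upper2[of "(a, b)"]) (use that in auto)
  show "\<exists>A\<ge>1. \<forall>m h l \<eta> \<kappa>. 0 < h \<longrightarrow> 0 < l \<longrightarrow> 0 < \<eta> \<longrightarrow> 0 < \<kappa> \<longrightarrow>
      l * h \<le> mass (m - h) m \<longrightarrow>
      \<eta> * h \<le> measure lebesgue {x\<in>{m<..<m+h}. ?f x < \<kappa>} \<longrightarrow> l * \<eta> powr (p - 1) \<le> A * \<kappa>"
  proof (intro exI[of _ "max A 1"] conjI allI impI)
    fix m h l \<eta> \<kappa> :: real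
    assume h: "0 < h" and l: "0 < l" and \<eta>: "0 < \<eta>" and \<kappa>: "0 < \<kappa>"
      and avg: "l * h \<le> mass (m - h) m"
      and lev: "\<eta> * h \<le> measure lebesgue {x\<in>{m<..<m+h}. ?f x < \<kappa>}"
    define e where "e = - 1 / (p - 1)"
    have e: "e < 0" "e * (p - 1) = - 1" using p by (auto simp: e_def)
    have "ennreal l \<le> ennreal (mass (m - h) m / h)" using avg h by (intro ennreal_leI) (simp add: field_simps)
    also have "\<dots> = (\<integral>\<^sup>+x\<in>{m-h<..<m}. ?w x \<partial>lebesgue) / emeasure lebesgue {m-h<..<m}"
      using h by (simp add: set_nn_integral_dist_weight[OF E null] set_nn_integral_eq_mass divide_ennreal mass_nonneg)
    finally have X: "ennreal l \<le> (\<integral>\<^sup>+x\<in>{m-h<..<m}. ?w x \<partial>lebesgue) / emeasure lebesgue {m-h<..<m}" .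
    define T where "T = {x\<in>{m<..<m+h}. ?f x < \<kappa>} - closure E"
    have mT0: "{x\<in>{m<..<m+h}. ?f x < \<kappa>} \<in> sets lebesgue" by (rule level_set_meas) auto
    then have mT: "T \<in> lmeasurable" unfolding T_def
      by (intro bounded_set_imp_lmeasurable bounded_restrict) auto
    have "measure lebesgue T = measure lebesgue {x\<in>{m<..<m+h}. ?f x < \<kappa>}"
      unfolding T_def using null mT0 by (intro measure_Diff_null_set) auto
    then have eT: "ennreal (\<eta> * h) \<le> emeasure lebesgue T"
      using lev by (simp add: emeasure_eq_measure2[OF mT] ennreal_leI)
    have "ennreal (\<kappa> powr e * \<eta> * h) = ennreal (\<kappa> powr e) * ennreal (\<eta> * h)"
      using \<eta> h by (simp add: ennreal_mult[symmetric] mult.assoc)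
    also have "\<dots> \<le> ennreal (\<kappa> powr e) * emeasure lebesgue T" by (intro mult_left_mono eT) simp
    also have "\<dots> = (\<integral>\<^sup>+x. ennreal (\<kappa> powr e) * indicator T x \<partial>lebesgue)"
      using mT by (intro nn_integral_cmult_indicator[symmetric]) auto
    also have "\<dots> \<le> (\<integral>\<^sup>+x\<in>{m<..<m+h}. ennpowr (?w x) e \<partial>lebesgue)"
    proof (rule nn_integral_mono)
      fix x
      show "ennreal (\<kappa> powr e) * indicator T x \<le> ennpowr (?w x) e * indicator {m<..<m+h} x"
      proof (cases "x \<in> T")
        case True
        then have x: "x \<notin> closure E" "?f x < \<kappa>" "x \<in> {m<..<m+h}" unfolding T_def by auto
        have "\<kappa> powr e \<le> ?f x powr e"
          using x e real_dist_weight_pos[OF E x(1), of \<alpha>] by (intro powr_mono2') auto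
        then show ?thesis using x True
          by (simp add: dist_weight_eq_real[OF E x(1)] ennpowr_ennreal[OF real_dist_weight_pos[OF E x(1)]] ennreal_leI)
      qed simp
    qed
    finally have "ennreal (\<kappa> powr e * \<eta> * h) / ennreal h \<le> (\<integral>\<^sup>+x\<in>{m<..<m+h}. ennpowr (?w x) e \<partial>lebesgue) / ennreal h"
      by (rule divide_right_mono_ennreal)
    then have "ennreal (\<kappa> powr e * \<eta>) \<le> (\<integral>\<^sup>+x\<in>{m<..<m+h}. ennpowr (?w x) e \<partial>lebesgue) / emeasure lebesgue {m<..<m+h}"
      using h \<eta> by (simp add: divide_ennreal)
    then have "ennpowr (ennreal (\<kappa> powr e * \<eta>)) (p - 1)
       \<le> ennpowr ((\<integral>\<^sup>+x\<in>{m<..<m+h}. ennpowr (?w x) e \<partial>lebesgue) / emeasure lebesgue {m<..<m+h}) (p - 1)"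
      using p by (intro ennpowr_mono) auto
    moreover have "ennpowr (ennreal (\<kappa> powr e * \<eta>)) (p - 1) = ennreal (\<eta> powr (p - 1) / \<kappa>)"
    proof -
      have "(\<kappa> powr e * \<eta>) powr (p - 1) = \<kappa> powr (e * (p - 1)) * \<eta> powr (p - 1)"
        using \<kappa> \<eta> by (simp only: powr_mult powr_powr)
      also have "\<dots> = \<eta> powr (p - 1) / \<kappa>" unfolding e(2) using \<kappa> by (simp add: powr_minus_divide)
      finally show ?thesis using \<kappa> \<eta> by (subst ennpowr_ennreal) auto
    qed
    ultimately have Y: "ennreal (\<eta> powr (p - 1) / \<kappa>) \<le>
      ennpowr ((\<integral>\<^sup>+x\<in>{m<..<m+h}. ennpowr (?w x) e \<partial>lebesgue) / emeasure lebesgue {m<..<m+h}) (p - 1)"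
      by simp
    have "(m - h + (m + h)) / 2 = m" by simp
    then have Q': "(\<integral>\<^sup>+x\<in>{m-h<..<m}. ?w x \<partial>lebesgue) / emeasure lebesgue {m-h<..<m} *
      ennpowr ((\<integral>\<^sup>+x\<in>{m<..<m+h}. ennpowr (?w x) e \<partial>lebesgue) / emeasure lebesgue {m<..<m+h}) (p - 1) \<le> ennreal A"
      using Q[of "m - h" "m + h"] h unfolding e_def by simp
    have "ennreal (l * (\<eta> powr (p - 1) / \<kappa>)) = ennreal l * ennreal (\<eta> powr (p - 1) / \<kappa>)"
      using l \<kappa> by (intro ennreal_mult) auto
    also have "\<dots> \<le> ennreal A" using mult_mono[OF X Y] Q' by (rule order_trans) auto
    finally have "l * (\<eta> powr (p - 1) / \<kappa>) \<le> A" using A(2) by (simp add: ennreal_le_iff)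
    then have "l * \<eta> powr (p - 1) \<le> A * \<kappa>" using \<kappa> by (simp add: field_simps)
    also have "\<dots> \<le> max A 1 * \<kappa>" using \<kappa> by (intro mult_right_mono) auto
    finally show "l * \<eta> powr (p - 1) \<le> max A 1 * \<kappa>" .
  qed simp
qed

text \<open>
  By the decay of sublevel sets, \<open>(\<lambda> / w) powr (q / 2)\<close> has bounded average on the right half,
  where \<open>\<lambda>\<close> is the average of \<open>w\<close> on the left half. This is \<open>A\<^sub>p\<^sup>+\<close> for \<open>1 / (p - 1) = q / 2\<close>.
\<close>

lemma A_inf_imp_Ap_plus:
  assumes E: "E \<noteq> {}" and null: "closure E \<in> null_sets lebesgue"
    and fin: "\<And>a b. (\<integral>\<^sup>+x\<in>{a..b}. dist_weight E \<alpha> x \<partial>lebesgue) < \<infinity>"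
    and A_inf: "regular_weight.A_inf (real_dist_weight E \<alpha>) \<beta> s"
    and s: "0 < s" "s < 1" "0 < \<beta>" "\<beta> \<le> 1"
  shows "\<exists>p>1. dist_weight E \<alpha> \<in> Ap_plus p"
proof -
  let ?w = "dist_weight E \<alpha>" and ?f = "real_dist_weight E \<alpha>"
  interpret regular_weight "real_dist_weight E \<alpha>" "closure E"
    by (rule regular_real_dist_weight[OF E null fin])
  obtain C q where C: "C > 0" and q: "q > 0" and
    decay: "\<And>a h l0 t. 0 < h \<Longrightarrow> 0 < l0 \<Longrightarrow> l0 * h \<le> mass a (a + h) \<Longrightarrow> 0 < t \<Longrightarrow>
      measure lebesgue {x\<in>{a+h<..<a+2*h}. ?f x < t * l0} \<le> C * h * t powr q"
    by (rule lower_level_decay[OF A_inf s]) (rule that)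
  have w_pos: "?w x > 0" for x
    unfolding dist_weight_def by (auto simp: infdist_nonneg)
  have "weight ?w"
    unfolding weight_def
  proof (intro conjI allI impI)
    show "?w \<in> borel_measurable lebesgue" by (intro measurable_completion) auto
    show "AE x in lebesgue. 0 < ?w x" using w_pos by simp
    fix K :: "real set" assume "compact K"
    then have "bounded K" by (rule compact_imp_bounded)
    then obtain b where "\<forall>x\<in>K. \<bar>x\<bar> \<le> b" unfolding bounded_iff by auto
    then have "K \<subseteq> {-b..b}" by (force simp: abs_le_iff)
    then have "(\<integral>\<^sup>+x\<in>K. ?w x \<partial>lebesgue) \<le> (\<integral>\<^sup>+x\<in>{-b..b}. ?w x \<partial>lebesgue)"
      by (intro nn_integral_mono) (auto simp: indicator_def)
    then show "(\<integral>\<^sup>+x\<in>K. ?w x \<partial>lebesgue) < \<infinity>" using fin[of "-b" b] by (rule le_less_trans)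
  qed
  define B where "B = max C 1 * weak_const (q / 2) q"
  have B: "B > 0" unfolding B_def using weak_const_pos[of "q / 2" q] q by simp
  have bound: "((\<integral>\<^sup>+x\<in>{a<..<a+h}. ?w x \<partial>lebesgue) / emeasure lebesgue {a<..<a+h}) *
        ennpowr ((\<integral>\<^sup>+x\<in>{a+h<..<a+2*h}. ennpowr (?w x) (- (q / 2)) \<partial>lebesgue)
             / emeasure lebesgue {a+h<..<a+2*h}) (2 / q) \<le> ennreal (B powr (2 / q))" if h: "0 < h" for a h
  proof -
    define l0 where "l0 = mass a (a + h) / h"
    have X: "(\<integral>\<^sup>+x\<in>{a<..<a+h}. ?w x \<partial>lebesgue) / emeasure lebesgue {a<..<a+h} = ennreal l0"
      using h by (simp add: set_nn_integral_dist_weight[OF E null] set_nn_integral_eq_mass divide_ennreal mass_nonneg l0_def)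
    show ?thesis
    proof (cases "l0 = 0")
      case True then show ?thesis unfolding X by simp
    next
      case False
      have l0: "l0 > 0" using False h mass_nonneg[of a "a+h"] by (auto simp: l0_def less_le)
      let ?S = "{a+h<..<a+2*h}"
      define g where "g x = l0 / ?f x" for x
      have "(\<integral>\<^sup>+x\<in>?S. ennreal (g x powr (q / 2)) \<partial>lebesgue)
        \<le> ennreal (max C 1 * h * weak_const (q / 2) q)"
      proof (rule weak_type_nn_integral_le)
        show "g \<in> borel_measurable lebesgue" unfolding g_def by (intro measurable_completion) auto
        show "0 \<le> g x" for x unfolding g_def using l0 nonneg by simp
        show "measure lebesgue ?S \<le> max C 1 * h" using h by (simp add: mult_le_cancel_right1)
        fix t :: real assume t: "1 \<le> t"
        have "measure lebesgue {x\<in>?S. t < g x} \<le> measure lebesgue {x\<in>?S. ?f x < 1 / t * l0}"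
        proof (rule measure_mono_bounded)
          show "{x\<in>?S. t < g x} \<subseteq> {x\<in>?S. ?f x < 1 / t * l0}"
          proof
            fix x assume "x \<in> {x\<in>?S. t < g x}"
            then have "x \<in> ?S" "t < g x" by auto
            moreover from this have "?f x > 0" using t nonneg[of x] unfolding g_def by (cases "?f x = 0") auto
            ultimately show "x \<in> {x\<in>?S. ?f x < 1 / t * l0}" using t unfolding g_def by (auto simp: field_simps)
          qed
          have "{x\<in>?S. t < g x} = ?S \<inter> {x\<in>space borel. t < l0 / ?f x}" unfolding g_def by auto
          also have "\<dots> \<in> sets borel" by measurable
          finally show "{x\<in>?S. t < g x} \<in> sets lebesgue" by auto
          show "bounded {x\<in>?S. ?f x < 1 / t * l0}" by (rule bounded_restrict) simp
          show "{x\<in>?S. ?f x < 1 / t * l0} \<in> sets lebesgue" by (rule level_set_meas) simp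
        qed
        also have "\<dots> \<le> C * h * (1 / t) powr q"
          by (rule decay) (use h l0 t in \<open>auto simp: l0_def\<close>)
        also have "\<dots> \<le> max C 1 * h * (1 / t) powr q" using h by (intro mult_right_mono) auto
        also have "(1 / t) powr q = t powr (- q)" using t by (simp add: powr_divide powr_minus_divide)
        finally show "measure lebesgue {x\<in>?S. t < g x} \<le> max C 1 * h * t powr (- q)" .
      qed (use q in auto)
      also have "\<dots> = ennreal (B * h)" by (simp add: B_def mult_ac)
      finally have G: "(\<integral>\<^sup>+x\<in>?S. ennreal (g x powr (q / 2)) \<partial>lebesgue) \<le> ennreal (B * h)" .
      have "(\<integral>\<^sup>+x\<in>?S. ennpowr (?w x) (- (q / 2)) \<partial>lebesgue)
        = (\<integral>\<^sup>+x. ennreal (l0 powr (- (q / 2))) * (ennreal (g x powr (q / 2)) * indicator ?S x) \<partial>lebesgue)"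
      proof (rule nn_integral_cong_AE)
        show "AE x in lebesgue. ennpowr (?w x) (- (q / 2)) * indicator ?S x =
          ennreal (l0 powr (- (q / 2))) * (ennreal (g x powr (q / 2)) * indicator ?S x)"
          using AE_notin_closure[OF null]
        proof eventually_elim
          case (elim x)
          have f: "?f x > 0" by (rule real_dist_weight_pos[OF E elim])
          have "?f x powr (- (q / 2)) = l0 powr (- (q / 2)) * g x powr (q / 2)"
            using f l0 unfolding g_def by (simp add: powr_minus powr_divide field_simps)
          then show ?case
            by (simp add: dist_weight_eq_real[OF E elim] ennpowr_ennreal[OF f] ennreal_mult mult.assoc)
        qed
      qed
      also have "\<dots> = ennreal (l0 powr (- (q / 2))) * (\<integral>\<^sup>+x\<in>?S. ennreal (g x powr (q / 2)) \<partial>lebesgue)"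
        by (rule nn_integral_cmult) (auto simp: g_def intro!: measurable_completion)
      also have "\<dots> \<le> ennreal (l0 powr (- (q / 2))) * ennreal (B * h)" by (intro mult_left_mono G) simp
      also have "\<dots> = ennreal (l0 powr (- (q / 2)) * B * h)" using B h by (simp add: ennreal_mult[symmetric] mult.assoc)
      finally have "(\<integral>\<^sup>+x\<in>?S. ennpowr (?w x) (- (q / 2)) \<partial>lebesgue) / ennreal h \<le>
        ennreal (l0 powr (- (q / 2)) * B * h) / ennreal h" by (rule divide_right_mono_ennreal)
      then have "(\<integral>\<^sup>+x\<in>?S. ennpowr (?w x) (- (q / 2)) \<partial>lebesgue) / emeasure lebesgue ?S \<le>
        ennreal (l0 powr (- (q / 2)) * B)" using h B by (simp add: divide_ennreal)
      then have "ennpowr ((\<integral>\<^sup>+x\<in>?S. ennpowr (?w x) (- (q / 2)) \<partial>lebesgue) / emeasure lebesgue ?S) (2 / q)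
        \<le> ennpowr (ennreal (l0 powr (- (q / 2)) * B)) (2 / q)" using q by (intro ennpowr_mono) auto
      also have "\<dots> = ennreal (B powr (2 / q) / l0)"
      proof -
        have e: "- (q / 2) * (2 / q) = - 1" using q by simp
        have "(l0 powr (- (q / 2)) * B) powr (2 / q) = l0 powr (- (q / 2) * (2 / q)) * B powr (2 / q)"
          using l0 B by (simp only: powr_mult powr_powr)
        also have "\<dots> = B powr (2 / q) / l0" unfolding e using l0 by (simp add: powr_minus_divide)
        finally show ?thesis using l0 B by (subst ennpowr_ennreal) auto
      qed
      finally have "ennreal l0 * ennpowr ((\<integral>\<^sup>+x\<in>?S. ennpowr (?w x) (- (q / 2)) \<partial>lebesgue) / emeasure lebesgue ?S) (2 / q)
        \<le> ennreal l0 * ennreal (B powr (2 / q) / l0)" by (intro mult_left_mono) auto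
      also have "\<dots> = ennreal (B powr (2 / q))" using l0 by (simp add: ennreal_mult[symmetric])
      finally show ?thesis unfolding X .
    qed
  qed
  define p where "p = 1 + 2 / q"
  have p: "p > 1" "p - 1 = 2 / q" "- 1 / (p - 1) = - (q / 2)" using q by (auto simp: p_def)
  have "(SUP (a, b) \<in> {(a, b). a < b}.
        ((\<integral>\<^sup>+x\<in>{a<..<(a+b)/2}. ?w x \<partial>lebesgue) / emeasure lebesgue {a<..<(a+b)/2}) *
        ennpowr ((\<integral>\<^sup>+x\<in>{(a+b)/2<..<b}. ennpowr (?w x) (- 1 / (p - 1)) \<partial>lebesgue)
             / emeasure lebesgue {(a+b)/2<..<b}) (p - 1)) \<le> ennreal (B powr (2 / q))"
    unfolding p(2) p(3)[unfolded p(2)]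
  proof (rule SUP_least, clarify)
    fix a b :: real assume "a < b"
    then have "0 < (b - a) / 2" "a + (b - a) / 2 = (a + b) / 2" "a + 2 * ((b - a) / 2) = b"
      by (auto simp: field_simps)
    from bound[OF this(1), of a, unfolded this(2,3)]
    show "((\<integral>\<^sup>+x\<in>{a<..<(a+b)/2}. ?w x \<partial>lebesgue) / emeasure lebesgue {a<..<(a+b)/2}) *
        ennpowr ((\<integral>\<^sup>+x\<in>{(a+b)/2<..<b}. ennpowr (?w x) (- (q / 2)) \<partial>lebesgue)
             / emeasure lebesgue {(a+b)/2<..<b}) (2 / q) \<le> ennreal (B powr (2 / q))" .
  qed
  then have "?w \<in> Ap_plus p"
    unfolding Ap_plus_def using \<open>weight ?w\<close> by (auto intro: le_less_trans)
  then show ?thesis using p(1) by blast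
qed

section \<open>From the Muckenhoupt condition to the exponent\<close>

text \<open>
  The points at distance more than \<open>\<rho>\<close> from \<open>E\<close> exhaust the interval up to a null set as \<open>\<rho>\<close> tends
  to 0.
\<close>

lemma L_s_pos_of_closure_null:
  fixes E :: "real set"
  assumes E: "E \<noteq> {}" "closure E \<in> null_sets lebesgue" and s: "0 < s" "s < 1" and ab: "a < b"
  shows "0 < L_s s E a b"
proof -
  define \<rho> where "\<rho> n = 1 / real (Suc n)" for n
  define S where "S n = {x\<in>{a+\<rho> n<..<b}. \<rho> n < infdist x E}" for n
  have \<rho>: "0 < \<rho> n" "m \<le> n \<Longrightarrow> \<rho> n \<le> \<rho> m" for n m unfolding \<rho>_def by (auto simp: field_simps)
  have meas: "S n \<in> sets lebesgue" for n unfolding S_def by (rule infdist_level_set_meas) simp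
  have UN: "(\<Union>n. S n) = {a<..<b} - closure E"
  proof (intro set_eqI iffI)
    fix x assume "x \<in> (\<Union>n. S n)"
    then obtain n where "x \<in> S n" by blast
    then have "a + \<rho> n < x" "x < b" "0 < infdist x E" using \<rho>(1)[of n] unfolding S_def by auto
    then show "x \<in> {a<..<b} - closure E"
      using infdist_pos_iff_closure[OF E(1)] \<rho>(1)[of n] by auto
  next
    fix x assume x: "x \<in> {a<..<b} - closure E"
    then have "0 < min (infdist x E) (x - a)" using infdist_pos_iff_closure[OF E(1)] by auto
    then obtain n where "\<rho> n < min (infdist x E) (x - a)"
      unfolding \<rho>_def using nat_approx_posE by blast
    then have "x \<in> S n" using x unfolding S_def by auto
    then show "x \<in> (\<Union>n. S n)" by blast
  qed
  have lim: "(\<lambda>n. measure lebesgue (S n)) \<longlonglongrightarrow> measure lebesgue (\<Union>n. S n)"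
  proof (rule Lim_measure_incseq)
    show "incseq S"
    proof (rule incseq_SucI)
      fix n show "S n \<subseteq> S (Suc n)" using \<rho>(2)[of n "Suc n"] unfolding S_def by auto
    qed
    show "emeasure lebesgue (\<Union>n. S n) \<noteq> \<infinity>"
      unfolding UN using bounded_set_imp_lmeasurable[of "{a<..<b} - closure E"]
      by (auto simp: fmeasurable_def bounded_restrict)
  qed (use meas in auto)
  have "measure lebesgue ({a<..<b} - closure E) = measure lebesgue {a<..<b}"
    by (rule measure_Diff_null_set) (use E in auto)
  then have "measure lebesgue (\<Union>n. S n) = b - a" unfolding UN using ab by simp
  moreover have "(1 - s) * (b - a) < 1 * (b - a)" using s ab by (intro mult_strict_right_mono) auto
  ultimately have "\<forall>\<^sub>F n in sequentially. (1 - s) * (b - a) < measure lebesgue (S n)"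
    using lim by (intro order_tendstoD) auto
  then obtain n where "(1 - s) * (b - a) < measure lebesgue (S n)"
    using eventually_happens by fastforce
  then have "admissible_length s E a b (\<rho> n)"
    using E s ab \<rho>(1) unfolding S_def by (intro admissible_length_of_far_set) auto
  from admissible_length_le_L_s[OF this \<rho>(1)] show ?thesis using \<rho>(1)[of n] by linarith
qed

lemma real_dist_weight_less:
  assumes "0 < \<alpha>" "0 < r" "r < infdist x E"
  shows "real_dist_weight E \<alpha> x < r powr (- \<alpha>)"
  unfolding real_dist_weight_def using assms by (intro powr_less_mono2_neg) auto

lemma real_dist_weight_greater:
  assumes "0 < \<alpha>" "0 < infdist x E" "infdist x E < r"
  shows "r powr (- \<alpha>) < real_dist_weight E \<alpha> x"
  unfolding real_dist_weight_def using assms by (intro powr_less_mono2_neg) auto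

text \<open>
  Let \<open>m\<close> be the centre and \<open>h\<close> the half-length of the interval, and let \<open>L\<close> be the gap length on the right
  half. At least \<open>3 / 8\<close> of \<open>(m, m+h)\<close> is at distance more than \<open>L / 8\<close> from \<open>E\<close>, so \<open>A\<^sub>p\<^sup>+\<close> bounds the average of
  \<open>w\<close> on \<open>(m-h, m+h/4)\<close> by a multiple of \<open>L powr (- \<alpha>)\<close>. Some point \<open>b'\<close>
  of \<open>(m, m+h/4]\<close> has all its left averages bounded in the same way, and the decay of the superlevel
  sets on \<open>(m-h, b')\<close> is the required estimate with exponent \<open>\<alpha> q\<close>, \<open>q > 1\<close>.
\<close>

theorem Ap_plus_imp_less_Mu:
  assumes E: "E \<noteq> {}" and \<alpha>: "0 < \<alpha>" and p: "1 < p" and Ap: "dist_weight E \<alpha> \<in> Ap_plus p"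
  shows "ereal \<alpha> < Mu_inf_plus E"
proof -
  let ?f = "real_dist_weight E \<alpha>"
  note reg = Ap_plus_level_bound(1)[OF E p Ap]
  interpret regular_weight ?f "closure E" by (rule reg)
  obtain A where A: "A \<ge> 1" and bound: "\<And>m h l \<eta> \<kappa>. 0 < h \<Longrightarrow> 0 < l \<Longrightarrow> 0 < \<eta> \<Longrightarrow> 0 < \<kappa> \<Longrightarrow>
      l * h \<le> mass (m - h) m \<Longrightarrow> \<eta> * h \<le> measure lebesgue {x\<in>{m<..<m+h}. ?f x < \<kappa>} \<Longrightarrow>
      l * \<eta> powr (p - 1) \<le> A * \<kappa>"
    using Ap_plus_level_bound(2)[OF E p Ap] by blast
  define \<beta> where "\<beta> = (1 / 2) powr (p - 1) / (2 * A)"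
  have \<beta>: "0 < \<beta>" "\<beta> \<le> 1"
  proof -
    have "(1 / 2) powr (p - 1) \<le> (1 / 2 :: real) powr 0" using p by (intro powr_mono') auto
    then show "\<beta> \<le> 1" using A by (simp add: \<beta>_def field_simps)
  qed (use A in \<open>simp add: \<beta>_def\<close>)
  have A_inf: "A_inf \<beta> (1 / 2)"
    unfolding A_inf_def
  proof (intro allI impI)
    fix m h l :: real assume h: "0 < h" and l: "0 < l" and avg: "l * h \<le> mass (m - h) m"
    show "1 / 2 * h \<le> measure lebesgue {x\<in>{m<..<m+h}. \<beta> * l \<le> ?f x}"
    proof (rule ccontr)
      assume "\<not> ?thesis"
      moreover have "measure lebesgue {m<..<m+h} = h" using h by simp
      ultimately have "1 / 2 * h \<le> measure lebesgue {x\<in>{m<..<m+h}. ?f x < \<beta> * l}"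
        using measure_level_split[of "{m<..<m+h}" "\<beta> * l"] by simp
      from bound[OF h l _ _ avg this] have "l * (1 / 2) powr (p - 1) \<le> A * (\<beta> * l)" using \<beta> l by simp
      also have "\<dots> = l * (1 / 2) powr (p - 1) / 2" using A by (simp add: \<beta>_def)
      finally show False using l by (simp add: mult_le_0_iff)
    qed
  qed
  have half: "0 < (1 / 2 :: real)" "(1 / 2 :: real) < 1" by simp_all
  obtain C q where C: "C > 0" and q: "q > 1" and decay:
    "\<And>a b l0 t. a < b \<Longrightarrow> 0 < l0 \<Longrightarrow> \<forall>c\<in>{a..b}. mass c b \<le> l0 * (b - c) \<Longrightarrow> 0 < t \<Longrightarrow>
      measure lebesgue {x\<in>{a<..<b}. t * l0 < ?f x} \<le> C * (b - a) * (1 / t) powr q"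
    by (rule upper_level_decay[OF A_inf half \<beta>]) (rule that)
  define D where "D = A * 10 powr (p - 1)"
  have D: "D > 0" using A by (simp add: D_def)
  define C' where "C' = C * (5 / 4) * (12 * D * 8 powr \<alpha>) powr q"
  have C': "C' > 0" using C D by (simp add: C'_def)
  have main: "measure lebesgue ({a<..<(a+b)/2} \<inter> nbhd E r) / measure lebesgue {a<..<(a+b)/2}
               \<le> C' * (r / L_s (1/4) E ((a+b)/2) b) powr (\<alpha> * q)"
    if ab: "a < b" and r: "0 < r" for a b r
  proof -
    define m h where "m = (a + b) / 2" and "h = (b - a) / 2"
    have mh: "a = m - h" "b = m + h" "(a + b) / 2 = m" "h > 0" using ab by (auto simp: m_def h_def field_simps)
    define L where "L = L_s (1/4) E m b"
    have L: "L > 0" unfolding L_def using mh by (intro L_s_pos_of_closure_null E null) auto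
    obtain l' where l': "L / 2 < l'" "0 < l'" "admissible_length (1/4) E m b l'"
      using admissible_length_above[of "1/4" E m b "L / 2"] L unfolding L_def by auto
    define \<kappa> where "\<kappa> = (L / 8) powr (- \<alpha>)"
    have \<kappa>: "\<kappa> > 0" using L by (simp add: \<kappa>_def)
    let ?T = "{x\<in>{(m + h/4)<..<(m + h/4) + 5*h/4}. ?f x < \<kappa>}"
    have "3 / 8 * h \<le> measure lebesgue {x\<in>{m<..<b}. l' / 4 \<le> infdist x E}"
      using admissible_length_far(1)[OF E l'(3,2)] mh by (simp add: field_simps)
    also have "\<dots> \<le> measure lebesgue ({m<..m+h/4} \<union> ?T)"
    proof (rule measure_mono_bounded)
      show "{x\<in>{m<..<b}. l' / 4 \<le> infdist x E} \<subseteq> {m<..m+h/4} \<union> ?T"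
      proof
        fix x assume x: "x \<in> {x\<in>{m<..<b}. l' / 4 \<le> infdist x E}"
        then have "L / 8 < infdist x E" using l' by auto
        then have "?f x < \<kappa>" unfolding \<kappa>_def using L by (intro real_dist_weight_less \<alpha>) auto
        then show "x \<in> {m<..m+h/4} \<union> ?T" using x mh by auto
      qed
      show "bounded ({m<..m+h/4} \<union> ?T)" by (intro bounded_Un[THEN iffD2] conjI bounded_restrict) auto
      show "{m<..m+h/4} \<union> ?T \<in> sets lebesgue" by (intro sets.Un level_set_meas) auto
      show "{x\<in>{m<..<b}. l' / 4 \<le> infdist x E} \<in> sets lebesgue" by (rule infdist_level_set_meas) simp
    qed
    also have "\<dots> \<le> measure lebesgue {m<..m+h/4} + measure lebesgue ?T"
      by (intro measure_Un_le level_set_meas) auto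
    also have "measure lebesgue {m<..m+h/4} = h / 4" using mh by simp
    finally have T: "1 / 10 * (5*h/4) \<le> measure lebesgue ?T" by simp
    have W: "mass a (m + h/4) \<le> D * \<kappa> * (5*h/4)"
    proof (cases "mass a (m + h/4) > 0")
      case True
      define l where "l = mass a (m + h/4) / (5*h/4)"
      have l: "l > 0" "l * (5*h/4) = mass a (m + h/4)" using True mh by (auto simp: l_def)
      have "l * (1 / 10) powr (p - 1) \<le> A * \<kappa>"
        by (rule bound[of "5*h/4" l "1/10" \<kappa> "m + h/4"]) (use l mh \<kappa> T in auto)
      then have "l \<le> D * \<kappa>" by (simp add: D_def powr_divide field_simps)
      then have "l * (5*h/4) \<le> D * \<kappa> * (5*h/4)" using mh by (intro mult_right_mono) auto
      then show ?thesis unfolding l(2) .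
    next
      case False
      have "0 \<le> D * \<kappa> * (5*h/4)" using D \<kappa> mh by simp
      then show ?thesis using False by linarith
    qed
    \<comment> \<open>Large enough that \<open>l0\<close> times \<open>h / 4\<close> exceeds the mass of the whole interval, which keeps
    the minimum point \<open>b'\<close> to the right of \<open>m\<close>.\<close>
    define l0 where "l0 = 12 * D * \<kappa>"
    have l0: "l0 > 0" using D \<kappa> by (simp add: l0_def)
    let ?G = "\<lambda>x. mass a x - l0 * x"
    have "continuous_on {a..m+h/4} ?G" by (intro continuous_intros mass_cont)
    then obtain b' where b': "b' \<in> {a..m+h/4}" "\<And>y. y \<in> {a..m+h/4} \<Longrightarrow> ?G b' \<le> ?G y"
      using continuous_attains_inf[of "{a..m+h/4}" ?G] mh by auto
    have "m < b'"
    proof (rule ccontr)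
      assume "\<not> m < b'"
      then have "l0 * b' \<le> l0 * m" using l0 by simp
      moreover have "?G b' \<le> ?G (m + h/4)" using b'(2) mh by auto
      moreover have "l0 * (m + h/4) = l0 * m + 3 * (D * \<kappa> * h)" by (simp add: l0_def field_simps)
      moreover have "0 < D * \<kappa> * h" using D \<kappa> mh by simp
      moreover have "D * \<kappa> * (5*h/4) = 5/4 * (D * \<kappa> * h)" by simp
      ultimately show False using W mass_nonneg[of a b'] by linarith
    qed
    have stop: "mass c b' \<le> l0 * (b' - c)" if "a \<le> c" "c \<le> b'" for c
      using b'(2)[of c] b'(1) mass_split[of a c b'] that by (auto simp: algebra_simps)
    define t where "t = r powr (- \<alpha>) / l0"
    have t: "t > 0" "t * l0 = r powr (- \<alpha>)" using r l0 by (auto simp: t_def)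
    have "measure lebesgue ({a<..<m} \<inter> nbhd E r) \<le> measure lebesgue ({x\<in>{a<..<b'}. t * l0 < ?f x} \<union> closure E)"
    proof (rule measure_mono_fmeasurable)
      show "{a<..<m} \<inter> nbhd E r \<subseteq> {x\<in>{a<..<b'}. t * l0 < ?f x} \<union> closure E"
      proof
        fix x assume x: "x \<in> {a<..<m} \<inter> nbhd E r"
        show "x \<in> {x\<in>{a<..<b'}. t * l0 < ?f x} \<union> closure E"
        proof (cases "x \<in> closure E")
          case False
          then have "t * l0 < ?f x" unfolding t(2)
            using x infdist_pos_iff_closure[OF E] by (intro real_dist_weight_greater \<alpha>) (auto simp: nbhd_def)
          then show ?thesis using x \<open>m < b'\<close> by auto
        qed auto
      qed
      have "{a<..<m} \<inter> nbhd E r = {x\<in>{a<..<m}. infdist x E < r}" unfolding nbhd_def by auto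
      then show "{a<..<m} \<inter> nbhd E r \<in> sets lebesgue" using infdist_level_set_meas(4)[of "{a<..<m}" E r] by simp
      have "{x\<in>{a<..<b'}. t * l0 < ?f x} \<in> lmeasurable"
        by (intro bounded_set_imp_lmeasurable level_set_meas bounded_restrict) auto
      then show "{x\<in>{a<..<b'}. t * l0 < ?f x} \<union> closure E \<in> lmeasurable"
        using fmeasurableI_null_sets[OF null] by (rule fmeasurable.Un)
    qed
    also have "\<dots> = measure lebesgue {x\<in>{a<..<b'}. t * l0 < ?f x}"
      using null by (intro measure_Un_null_set level_set_meas) auto
    also have "\<dots> \<le> C * (b' - a) * (1 / t) powr q"
      by (rule decay) (use l0 t stop \<open>m < b'\<close> mh in auto)
    also have "\<dots> \<le> C * (5 / 4 * h) * (1 / t) powr q"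
      using C b'(1) mh by (intro mult_right_mono mult_left_mono) auto
    also have "1 / t = 12 * D * 8 powr \<alpha> * (r / L) powr \<alpha>"
      using r L l0 D by (simp add: t_def l0_def \<kappa>_def powr_minus powr_divide field_simps)
    also have "(12 * D * 8 powr \<alpha> * (r / L) powr \<alpha>) powr q = (12 * D * 8 powr \<alpha>) powr q * (r / L) powr (\<alpha> * q)"
      using D r L by (simp add: powr_mult powr_powr)
    finally have "measure lebesgue ({a<..<m} \<inter> nbhd E r) / h \<le> C' * (r / L) powr (\<alpha> * q)"
      using mh(4) by (simp add: C'_def field_simps)
    moreover have "measure lebesgue {a<..<m} = h" using mh by simp
    ultimately show ?thesis unfolding mh(3) L_def by simp
  qed
  \<comment> \<open>The exponent is therefore given by the supremum and not by the default value 0.\<close>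
  have no_zero: "\<not> (\<exists>s a b. 0 < s \<and> s < 1 \<and> a < b \<and> L_s s E a b = 0)"
    using L_s_pos_of_closure_null[OF E null] by (metis less_irrefl)
  have "ereal (\<alpha> * q) \<le> Mu_inf_plus E"
    unfolding Mu_inf_plus_def if_not_P[OF no_zero]
  proof (rule Sup_upper, intro CollectI exI conjI)
    show "0 \<le> \<alpha> * q" using \<alpha> q by simp
    show "\<forall>a b r. a < b \<and> (a + b) / 2 \<in> E \<and> 0 < r \<and> r \<le> L_s (1/4) E ((a+b)/2) b \<longrightarrow>
             measure lebesgue ({a<..<(a+b)/2} \<inter> nbhd E r) / measure lebesgue {a<..<(a+b)/2}
               \<le> C' * (r / L_s (1/4) E ((a+b)/2) b) powr (\<alpha> * q)"
      using main by blast
  qed (use C' in auto)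
  moreover have "\<alpha> < \<alpha> * q" using \<alpha> q by simp
  ultimately show ?thesis by (meson ereal_less_eq(3) less_le_trans ereal_less(2) less_ereal.simps(1))
qed

section \<open>The decay condition at points of the closure\<close>

text \<open>
  A positive gap length with parameter \<open>s\<close> leaves at most the proportion \<open>s\<close> of the interval to the
  closure of \<open>E\<close>, and \<open>s\<close> is arbitrarily small.
\<close>

lemma closure_null_of_L_s_pos:
  fixes E :: "real set"
  assumes E: "E \<noteq> {}" and L: "\<And>s a b. 0 < s \<Longrightarrow> s < 1 \<Longrightarrow> a < b \<Longrightarrow> L_s s E a b \<noteq> 0"
  shows "closure E \<in> null_sets lebesgue"
proof -
  have *: "closure E \<inter> {- real (Suc n)<..<real (Suc n)} \<in> null_sets lebesgue" for n
  proof -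
    define a b where "a = - real (Suc n)" and "b = real (Suc n)"
    have ab: "a < b" by (simp add: a_def b_def)
    let ?K = "closure E \<inter> {a<..<b}"
    have mK: "?K \<in> lmeasurable" by (intro bounded_set_imp_lmeasurable) (auto intro: bounded_subset)
    have "measure lebesgue ({a<..<b} - ?K) = measure lebesgue {a<..<b} - measure lebesgue ?K"
      using mK by (intro measurable_measure_Diff) auto
    moreover have "{a<..<b} - ?K = {a<..<b} - closure E" by auto
    ultimately have K: "measure lebesgue ({a<..<b} - closure E) = (b - a) - measure lebesgue ?K" using ab by simp
    have le: "measure lebesgue ?K \<le> s * (b - a)" if s: "0 < s" "s < 1" for s
    proof -
      have "0 < L_s s E a b" using L[OF s ab] L_s_nonneg[of s E a b] by simp
      then obtain l where "0 < l" "admissible_length s E a b l"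
        using admissible_length_above[of s E a b 0] by blast
      from admissible_length_far(2)[OF E this(2,1)] K show ?thesis by (simp add: algebra_simps)
    qed
    have "measure lebesgue ?K \<le> 0"
    proof (rule ccontr)
      assume "\<not> ?thesis"
      then have pos: "0 < measure lebesgue ?K" by simp
      define s where "s = min (1/2) (measure lebesgue ?K / (2 * (b - a)))"
      have "0 < s" "s < 1" using pos ab by (auto simp: s_def)
      from le[OF this] have "measure lebesgue ?K \<le> s * (b - a)" .
      also have "\<dots> \<le> measure lebesgue ?K / (2 * (b - a)) * (b - a)"
        using ab by (intro mult_right_mono) (auto simp: s_def)
      also have "\<dots> = measure lebesgue ?K / 2"
      proof -
        have half: "k / (2 * d) * d = k / 2" if "d > 0" for k d :: real using that by simp
        show ?thesis by (rule half) (use ab in simp)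
      qed
      finally show False using pos by simp
    qed
    then have "measure lebesgue ?K = 0" using measure_nonneg[of lebesgue ?K] by linarith
    then have "emeasure lebesgue ?K = 0" using emeasure_eq_measure2[OF mK] by simp
    then show ?thesis using mK unfolding a_def b_def by (intro null_setsI) auto
  qed
  then have "(\<Union>n. closure E \<inter> {- real (Suc n)<..<real (Suc n)}) \<in> null_sets lebesgue"
    by (intro null_sets_UN) auto
  moreover have "(\<Union>n. closure E \<inter> {- real (Suc n)<..<real (Suc n)}) = closure E"
  proof -
    have "\<exists>n. x \<in> {- real (Suc n)<..<real (Suc n)}" for x :: real
    proof -
      obtain n where "\<bar>x\<bar> \<le> real n" using real_arch_simple by blast
      then have "x \<in> {- real (Suc n)<..<real (Suc n)}" by auto
      then show ?thesis by blast
    qed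
    then show ?thesis by blast
  qed
  ultimately show ?thesis by simp
qed

text \<open>
  The condition from the definition of the exponent with the gap length eliminated: a scale \<open>\<rho>\<close>
  such that less than the proportion \<open>s\<close> of the right half is within \<open>\<rho>\<close> of \<open>E\<close> is a lower bound for
  the gap length. This form is stable under perturbation of the centre, and so it extends from \<open>E\<close> to its
  closure, where extremal points of gaps are found.
\<close>

definition one_sided_decay :: "real set \<Rightarrow> real \<Rightarrow> real \<Rightarrow> real \<Rightarrow> bool" where
  "one_sided_decay E s C q \<longleftrightarrow> (\<forall>x\<in>closure E. \<forall>H \<rho> r. 0 < H \<longrightarrow> 0 < r \<longrightarrow> r \<le> \<rho> \<longrightarrow>
     measure lebesgue {y\<in>{x<..<x+H}. infdist y E \<le> \<rho>} < s * H \<longrightarrow>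
     measure lebesgue {y\<in>{x-H<..<x}. infdist y E < r} \<le> C * H * (r / \<rho>) powr q)"

lemma measure_shift_le:
  fixes A :: "real set"
  assumes "A \<in> sets lebesgue"
  shows "measure lebesgue (A \<inter> {u<..<u+H}) \<le> measure lebesgue (A \<inter> {v<..<v+H}) + \<bar>u - v\<bar>"
proof -
  let ?J = "if u \<le> v then {u..v} else {v+H..u+H}"
  have "measure lebesgue (A \<inter> {u<..<u+H}) \<le> measure lebesgue (A \<inter> {v<..<v+H} \<union> ?J)"
  proof (rule measure_mono_bounded)
    show "A \<inter> {v<..<v+H} \<union> ?J \<in> sets lebesgue" by (intro sets.Un sets.Int assms) auto
  qed (use assms in \<open>auto simp: bounded_Int\<close>)
  also have "\<dots> \<le> measure lebesgue (A \<inter> {v<..<v+H}) + measure lebesgue ?J"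
    by (rule measure_Un_le) (use assms in auto)
  also have "measure lebesgue ?J = \<bar>u - v\<bar>" by auto
  finally show ?thesis .
qed

lemma near_set_eq_Int:
  "{y\<in>U. infdist y E \<le> \<rho>} = {y. infdist y E \<le> \<rho>} \<inter> U" "{y\<in>U. infdist y E < \<rho>} = {y. infdist y E < \<rho>} \<inter> U"
  by auto

lemma one_sided_decay_of_Mu:
  fixes E :: "real set"
  assumes E: "E \<noteq> {}" and s: "0 < s" "s < 1" and C: "0 < C" and q: "0 \<le> q"
    and Mu: "\<And>a b r. a < b \<Longrightarrow> (a + b) / 2 \<in> E \<Longrightarrow> 0 < r \<Longrightarrow> r \<le> L_s s E ((a+b)/2) b \<Longrightarrow>
             measure lebesgue ({a<..<(a+b)/2} \<inter> nbhd E r) / measure lebesgue {a<..<(a+b)/2}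
               \<le> C * (r / L_s s E ((a+b)/2) b) powr q"
  shows "one_sided_decay E s C q"
  unfolding one_sided_decay_def
proof (intro ballI allI impI)
  fix x0 H \<rho> r :: real
  assume x0: "x0 \<in> closure E" and H: "0 < H" and r: "0 < r" "r \<le> \<rho>"
    and near: "measure lebesgue {y\<in>{x0<..<x0+H}. infdist y E \<le> \<rho>} < s * H"
  define N where "N = {y. infdist y E \<le> \<rho>}"
  define R where "R = {y. infdist y E < r}"
  have meas: "N \<in> sets lebesgue" "R \<in> sets lebesgue"
    using infdist_level_set_meas(3,4)[of UNIV] unfolding N_def R_def by auto
  have at_E: "measure lebesgue (R \<inter> {x-H<..<x}) \<le> C * H * (r / \<rho>) powr q"
    if x: "x \<in> E" and nx: "measure lebesgue (N \<inter> {x<..<x+H}) < s * H" for x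
  proof -
    let ?T = "{y\<in>{x+\<rho><..<x+H}. \<rho> < infdist y E}"
    have mT: "?T \<in> sets lebesgue" by (rule infdist_level_set_meas) simp
    have "H = measure lebesgue {x<..<x+H}" using H by simp
    also have "\<dots> \<le> measure lebesgue (N \<inter> {x<..<x+H} \<union> ?T)"
    proof (rule measure_mono_bounded)
      show "{x<..<x+H} \<subseteq> N \<inter> {x<..<x+H} \<union> ?T"
      proof
        fix y assume y: "y \<in> {x<..<x+H}"
        then have "infdist y E \<le> y - x" using infdist_le[OF x, of y] by (simp add: dist_real_def)
        then show "y \<in> N \<inter> {x<..<x+H} \<union> ?T" using y by (auto simp: N_def)
      qed
      show "N \<inter> {x<..<x+H} \<union> ?T \<in> sets lebesgue" using meas mT by (intro sets.Un sets.Int) auto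
      show "bounded (N \<inter> {x<..<x+H} \<union> ?T)"
        by (intro bounded_Un[THEN iffD2] conjI bounded_Int disjI2 bounded_restrict) auto
    qed auto
    also have "\<dots> \<le> measure lebesgue (N \<inter> {x<..<x+H}) + measure lebesgue ?T"
      by (rule measure_Un_le) (use meas mT in auto)
    finally have "(1 - s) * (x + H - x) \<le> measure lebesgue ?T" using nx by (simp add: algebra_simps)
    then have adm: "admissible_length s E x (x + H) \<rho>"
      using r H s by (intro admissible_length_of_far_set E) auto
    have L: "\<rho> \<le> L_s s E x (x + H)" by (rule admissible_length_le_L_s[OF adm]) (use r in simp)
    have mid: "(x - H + (x + H)) / 2 = x" by simp
    have "measure lebesgue ({x-H<..<x} \<inter> nbhd E r) / measure lebesgue {x-H<..<x} \<le> C * (r / L_s s E x (x + H)) powr q"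
      using Mu[of "x - H" "x + H" r, unfolded mid] H x r L by simp
    also have "\<dots> \<le> C * (r / \<rho>) powr q"
      using C r L q by (intro mult_left_mono powr_mono2 divide_left_mono mult_pos_pos) auto
    finally have "measure lebesgue ({x-H<..<x} \<inter> nbhd E r) \<le> C * (r / \<rho>) powr q * H"
      using H by (simp add: field_simps)
    moreover have "{x-H<..<x} \<inter> nbhd E r = R \<inter> {x-H<..<x}" by (auto simp: nbhd_def R_def)
    ultimately show ?thesis by (simp add: mult_ac)
  qed
  \<comment> \<open>The hypothesis is a strict inequality, so it persists for centres in \<open>E\<close> close to \<open>x0\<close>.\<close>
  have "measure lebesgue (R \<inter> {x0-H<..<x0}) \<le> C * H * (r / \<rho>) powr q"
  proof (rule field_le_epsilon)
    fix \<epsilon> :: real assume \<epsilon>: "0 < \<epsilon>"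
    define \<delta> where "\<delta> = min \<epsilon> (s * H - measure lebesgue (N \<inter> {x0<..<x0+H}))"
    have "\<delta> > 0" using \<epsilon> near unfolding \<delta>_def near_set_eq_Int N_def by simp
    then obtain x where x: "x \<in> E" "dist x x0 < \<delta>"
      using x0 unfolding closure_approachable by blast
    have "measure lebesgue (N \<inter> {x<..<x+H}) \<le> measure lebesgue (N \<inter> {x0<..<x0+H}) + \<bar>x - x0\<bar>"
      by (rule measure_shift_le[OF meas(1)])
    also have "\<dots> < s * H" using x unfolding \<delta>_def dist_real_def by auto
    finally have *: "measure lebesgue (R \<inter> {x-H<..<x}) \<le> C * H * (r / \<rho>) powr q" using at_E x(1) by blast
    have "measure lebesgue (R \<inter> {x0-H<..<(x0-H)+H}) \<le> measure lebesgue (R \<inter> {x-H<..<(x-H)+H}) + \<bar>(x0-H) - (x-H)\<bar>"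
      by (rule measure_shift_le[OF meas(2)])
    also have "\<bar>(x0-H) - (x-H)\<bar> \<le> \<epsilon>" using x unfolding \<delta>_def dist_real_def by auto
    finally show "measure lebesgue (R \<inter> {x0-H<..<x0}) \<le> C * H * (r / \<rho>) powr q + \<epsilon>" using * by simp
  qed
  then show "measure lebesgue {y\<in>{x0-H<..<x0}. infdist y E < r} \<le> C * H * (r / \<rho>) powr q"
    unfolding near_set_eq_Int R_def .
qed

lemma small_neighbourhood_measure:
  fixes U :: "real set"
  assumes E: "E \<noteq> {}" "closure E \<in> null_sets lebesgue" and U: "U \<in> sets lebesgue" "bounded U" and \<epsilon>: "0 < \<epsilon>"
  obtains \<rho> where "0 < \<rho>" "measure lebesgue {y\<in>U. infdist y E \<le> \<rho>} < \<epsilon>"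
proof -
  define \<rho> where "\<rho> n = 1 / real (Suc n)" for n
  define S where "S n = {y\<in>U. infdist y E \<le> \<rho> n}" for n
  have meas: "S n \<in> lmeasurable" for n
    unfolding S_def by (intro bounded_set_imp_lmeasurable bounded_restrict infdist_level_set_meas U)
  have lim: "(\<lambda>n. measure lebesgue (S n)) \<longlonglongrightarrow> measure lebesgue (\<Inter>n. S n)"
  proof (rule Lim_measure_decseq)
    show "decseq S"
    proof (rule decseq_SucI)
      fix n
      have "\<rho> (Suc n) \<le> \<rho> n" unfolding \<rho>_def by (simp add: field_simps)
      then show "S (Suc n) \<subseteq> S n" unfolding S_def by auto
    qed
  qed (use fmeasurableD[OF meas] fmeasurableD2[OF meas] in auto)
  have "(\<Inter>n. S n) \<subseteq> closure E"
  proof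
    fix x assume x: "x \<in> (\<Inter>n. S n)"
    show "x \<in> closure E"
    proof (rule ccontr)
      assume "x \<notin> closure E"
      then have "0 < infdist x E" using infdist_pos_iff_closure[OF E(1)] by blast
      then obtain n where "\<rho> n < infdist x E" unfolding \<rho>_def using nat_approx_posE by blast
      moreover have "x \<in> S n" using x by blast
      ultimately show False unfolding S_def by auto
    qed
  qed
  moreover have "(\<Inter>n. S n) \<in> sets lebesgue" using meas by (intro sets.countable_INT) auto
  ultimately have "(\<Inter>n. S n) \<in> null_sets lebesgue" using E(2) null_sets_subset by blast
  then have "measure lebesgue (\<Inter>n. S n) = 0" by (auto simp: null_sets_def measure_def)
  then have "\<forall>\<^sub>F n in sequentially. measure lebesgue (S n) < \<epsilon>" using lim \<epsilon> by (intro order_tendstoD) auto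
  then obtain n where "measure lebesgue (S n) < \<epsilon>" using eventually_happens by fastforce
  then show ?thesis using that[of "\<rho> n"] unfolding S_def \<rho>_def by simp
qed

text \<open>
  The set \<open>{d < r}\<close> contains \<open>(x - r, x)\<close>, so its measure cannot decay faster than linearly.
\<close>

lemma one_sided_decay_exponent_le_1:
  fixes E :: "real set"
  assumes E: "E \<noteq> {}" "closure E \<in> null_sets lebesgue" and s: "0 < s" and C: "0 < C"
    and decay: "one_sided_decay E s C q"
  shows "q \<le> 1"
proof (rule ccontr)
  assume "\<not> q \<le> 1" then have q: "q > 1" by simp
  obtain x where x: "x \<in> closure E" using E(1) closure_subset by blast
  obtain \<rho> where \<rho>: "0 < \<rho>" "measure lebesgue {y\<in>{x<..<x+1}. infdist y E \<le> \<rho>} < s"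
    using small_neighbourhood_measure[OF E, of "{x<..<x+1}" s] s by auto
  define K where "K = C * \<rho> powr (- q)"
  have K: "K > 0" using C \<rho> by (simp add: K_def)
  have bound: "1 \<le> K * r powr (q - 1)" if r: "0 < r" "r \<le> \<rho>" "r \<le> 1" for r
  proof -
    have "r = measure lebesgue {x-r<..<x}" using r by simp
    also have "\<dots> \<le> measure lebesgue {y\<in>{x-1<..<x}. infdist y E < r}"
    proof (rule measure_mono_bounded)
      show "{x-r<..<x} \<subseteq> {y\<in>{x-1<..<x}. infdist y E < r}"
      proof
        fix y assume y: "y \<in> {x-r<..<x}"
        have "infdist y E \<le> infdist x E + dist y x" by (rule infdist_triangle)
        also have "infdist x E = 0" using infdist_eq_0_iff_closure[OF E(1)] x by blast
        finally show "y \<in> {y\<in>{x-1<..<x}. infdist y E < r}" using y r by (auto simp: dist_real_def)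
      qed
      show "bounded {y\<in>{x-1<..<x}. infdist y E < r}" by (rule bounded_restrict) simp
      show "{y\<in>{x-1<..<x}. infdist y E < r} \<in> sets lebesgue" by (rule infdist_level_set_meas) simp
    qed auto
    also have "\<dots> \<le> C * 1 * (r / \<rho>) powr q"
      using decay[unfolded one_sided_decay_def, rule_format, of x 1 r \<rho>] x r \<rho> by simp
    also have "\<dots> = K * r powr (q - 1) * r"
      using r \<rho> by (simp add: K_def powr_divide powr_minus powr_diff field_simps)
    finally show ?thesis using r by simp
  qed
  define r where "r = min (min \<rho> 1) ((1 / (2 * K)) powr (1 / (q - 1)))"
  have r: "0 < r" "r \<le> \<rho>" "r \<le> 1" "r \<le> (1 / (2 * K)) powr (1 / (q - 1))" using \<rho> K by (auto simp: r_def)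
  have "r powr (q - 1) \<le> ((1 / (2 * K)) powr (1 / (q - 1))) powr (q - 1)"
    using r q by (intro powr_mono2) auto
  also have "\<dots> = 1 / (2 * K)" using q K by (simp add: powr_powr)
  finally have "K * r powr (q - 1) \<le> K * (1 / (2 * K))" using K by (intro mult_left_mono) auto
  also have "\<dots> < 1" using K by simp
  finally show False using bound[OF r(1-3)] by simp
qed

text \<open>
  The weak type bound for \<open>\<rho> / d\<close>, of which \<open>w\<close> is a power up to the factor \<open>\<rho> powr (- \<alpha>)\<close>.
\<close>

lemma near_decay_imp_integral_bound:
  fixes S :: "real set"
  assumes S: "S \<in> sets lebesgue" "bounded S" and pq: "0 < \<alpha>" "\<alpha> < q" and \<rho>: "0 < \<rho>"
    and K: "measure lebesgue S \<le> K"
    and near: "\<And>r. 0 < r \<Longrightarrow> r \<le> \<rho> \<Longrightarrow> measure lebesgue {x\<in>S. infdist x E < r} \<le> K * (r / \<rho>) powr q"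
  shows "(\<integral>\<^sup>+x\<in>S. ennreal (real_dist_weight E \<alpha> x) \<partial>lebesgue)
    \<le> ennreal (K * weak_const \<alpha> q * \<rho> powr (- \<alpha>))"
proof -
  define g where "g x = \<rho> / infdist x E" for x
  define B where "B = K * weak_const \<alpha> q"
  have gm: "g \<in> borel_measurable lebesgue" unfolding g_def by (intro measurable_completion) auto
  have "0 \<le> K" using K measure_nonneg[of lebesgue S] by linarith
  then have B0: "0 \<le> B" unfolding B_def using weak_const_pos[OF pq] by simp
  have G: "(\<integral>\<^sup>+x\<in>S. ennreal (g x powr \<alpha>) \<partial>lebesgue) \<le> ennreal B"
    unfolding B_def
  proof (rule weak_type_nn_integral_le[OF S gm _ pq K])
    show "0 \<le> g x" for x unfolding g_def using \<rho> by (intro divide_nonneg_nonneg infdist_nonneg) simp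
    fix t :: real assume t: "1 \<le> t"
    have "measure lebesgue {x\<in>S. t < g x} \<le> measure lebesgue {x\<in>S. infdist x E < \<rho> / t}"
    proof (rule measure_mono_bounded)
      show "{x\<in>S. t < g x} \<subseteq> {x\<in>S. infdist x E < \<rho> / t}"
      proof
        fix x assume x: "x \<in> {x\<in>S. t < g x}"
        then have "infdist x E \<noteq> 0" using t unfolding g_def by auto
        then have "0 < infdist x E" using infdist_nonneg[of x E] by linarith
        then show "x \<in> {x\<in>S. infdist x E < \<rho> / t}" using x t unfolding g_def by (auto simp: field_simps)
      qed
      have "{x\<in>S. t < g x} = S \<inter> {x\<in>space lebesgue. t < g x}" by auto
      also have "\<dots> \<in> sets lebesgue" using S gm by measurable
      finally show "{x\<in>S. t < g x} \<in> sets lebesgue" .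
    qed (intro infdist_level_set_meas bounded_restrict S)+
    also have "\<dots> \<le> K * ((\<rho> / t) / \<rho>) powr q" using t \<rho> by (intro near) (auto simp: field_simps)
    also have "((\<rho> / t) / \<rho>) powr q = t powr (- q)" using t \<rho> by (simp add: powr_divide powr_minus_divide)
    finally show "measure lebesgue {x\<in>S. t < g x} \<le> K * t powr (- q)" .
  qed
  have eq: "real_dist_weight E \<alpha> x = \<rho> powr (- \<alpha>) * g x powr \<alpha>" for x
  proof (cases "infdist x E = 0")
    case False
    then have "0 < infdist x E" using infdist_nonneg[of x E] by linarith
    then show ?thesis using \<rho> unfolding real_dist_weight_def g_def
      by (simp add: powr_divide powr_minus field_simps)
  qed (simp add: real_dist_weight_def g_def)
  have "(\<integral>\<^sup>+x\<in>S. ennreal (real_dist_weight E \<alpha> x) \<partial>lebesgue)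
    = (\<integral>\<^sup>+x. ennreal (\<rho> powr (- \<alpha>)) * (ennreal (g x powr \<alpha>) * indicator S x) \<partial>lebesgue)"
    by (intro nn_integral_cong) (simp add: eq ennreal_mult mult.assoc)
  also have "\<dots> = ennreal (\<rho> powr (- \<alpha>)) * (\<integral>\<^sup>+x\<in>S. ennreal (g x powr \<alpha>) \<partial>lebesgue)"
    by (rule nn_integral_cmult) (use gm S in auto)
  also have "\<dots> \<le> ennreal (\<rho> powr (- \<alpha>)) * ennreal B" by (intro mult_left_mono G) simp
  also have "\<dots> = ennreal (B * \<rho> powr (- \<alpha>))" using B0 by (simp add: ennreal_mult[symmetric] mult.commute)
  finally show ?thesis unfolding B_def .
qed

section \<open>From the exponent to the Muckenhoupt condition\<close>

lemma set_nn_integral_le_of_cover: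
  fixes F :: "real \<Rightarrow> ennreal"
  assumes F: "F \<in> borel_measurable lebesgue" and S: "S \<subseteq> insert x (A \<union> B)"
    and AB: "A \<in> sets lebesgue" "B \<in> sets lebesgue"
  shows "(\<integral>\<^sup>+y\<in>S. F y \<partial>lebesgue) \<le> (\<integral>\<^sup>+y\<in>A. F y \<partial>lebesgue) + (\<integral>\<^sup>+y\<in>B. F y \<partial>lebesgue)"
proof -
  have "AE y in lebesgue. y \<notin> {x}" by (intro AE_not_in) simp
  then have "AE y in lebesgue. F y * indicator S y \<le> F y * indicator A y + F y * indicator B y"
  proof eventually_elim
    case (elim y)
    then show ?case using S by (auto simp: indicator_def)
  qed
  then have "(\<integral>\<^sup>+y\<in>S. F y \<partial>lebesgue) \<le> (\<integral>\<^sup>+y. F y * indicator A y + F y * indicator B y \<partial>lebesgue)"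
    by (rule nn_integral_mono_AE)
  also have "\<dots> = (\<integral>\<^sup>+y\<in>A. F y \<partial>lebesgue) + (\<integral>\<^sup>+y\<in>B. F y \<partial>lebesgue)"
    by (rule nn_integral_add) (use F AB in auto)
  finally show ?thesis .
qed

lemma real_dist_weight_measurable_ennreal:
  "(\<lambda>x. ennreal (real_dist_weight E \<alpha> x)) \<in> borel_measurable lebesgue"
  by (intro measurable_completion) auto

text \<open>
  The situation when \<open>\<alpha>\<close> is smaller than the exponent: decay holds with some \<open>q > \<alpha>\<close>.
\<close>

locale decay_set =
  fixes E :: "real set" and s C q \<alpha> :: real
  assumes E: "E \<noteq> {}" and null: "closure E \<in> null_sets lebesgue"
    and s: "0 < s" "s < 1" and C: "0 < C"
    and decay: "one_sided_decay E s C q"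
    and \<alpha>: "0 < \<alpha>" "\<alpha> < q"
begin

abbreviation "w \<equiv> real_dist_weight E \<alpha>"

lemma \<alpha>_less_1: "\<alpha> < 1"
  using one_sided_decay_exponent_le_1[OF E null s(1) C decay] \<alpha> by simp

lemma infdist_closure_eq_0: "e \<in> closure E \<Longrightarrow> infdist e E = 0"
  using infdist_eq_0_iff_closure[OF E] by blast

lemma infdist_le_closure: "e \<in> closure E \<Longrightarrow> infdist x E \<le> \<bar>x - e\<bar>"
  using infdist_triangle[of x E e] infdist_closure_eq_0 by (simp add: dist_real_def)

definition C1 :: real where "C1 = max C 1 * weak_const \<alpha> q"

lemma C1_pos: "0 < C1"
  unfolding C1_def using weak_const_pos[OF \<alpha>] by simp

lemma integral_left_of_point:
  assumes e: "e \<in> closure E" and H: "0 < H" and \<rho>: "0 < \<rho>"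
    and near: "measure lebesgue {y\<in>{e<..<e+H}. infdist y E \<le> \<rho>} < s * H"
  shows "(\<integral>\<^sup>+x\<in>{e-H<..<e}. ennreal (w x) \<partial>lebesgue) \<le> ennreal (C1 * H * \<rho> powr (- \<alpha>))"
proof -
  have "(\<integral>\<^sup>+x\<in>{e-H<..<e}. ennreal (w x) \<partial>lebesgue) \<le> ennreal (max C 1 * H * weak_const \<alpha> q * \<rho> powr (- \<alpha>))"
  proof (rule near_decay_imp_integral_bound[OF _ _ \<alpha> \<rho>])
    show "measure lebesgue {e-H<..<e} \<le> max C 1 * H" using H by (simp add: mult_le_cancel_right1)
    fix r assume r: "0 < r" "r \<le> \<rho>"
    have "measure lebesgue {x\<in>{e-H<..<e}. infdist x E < r} \<le> C * H * (r / \<rho>) powr q"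
      using decay[unfolded one_sided_decay_def, rule_format, OF e H r near] .
    also have "\<dots> \<le> max C 1 * H * (r / \<rho>) powr q" using H by (intro mult_right_mono) auto
    finally show "measure lebesgue {x\<in>{e-H<..<e}. infdist x E < r} \<le> max C 1 * H * (r / \<rho>) powr q" .
  qed auto
  then show ?thesis unfolding C1_def by (simp add: mult_ac)
qed

text \<open>
  In a gap the distance to \<open>E\<close> is at least the distance to the endpoint \<open>e\<close> up to the scale \<open>\<rho>\<close>, so
  the linear decay of \<open>{d < r}\<close> suffices, as \<open>\<alpha> < 1\<close>.
\<close>

lemma integral_right_of_point_in_gap:
  assumes "e < m" "0 < \<rho>" "m - e \<le> K" "\<rho> \<le> K"
    and gap: "\<And>y. e < y \<Longrightarrow> y < m \<Longrightarrow> min (y - e) \<rho> \<le> infdist y E"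
  shows "(\<integral>\<^sup>+x\<in>{e<..<m}. ennreal (w x) \<partial>lebesgue) \<le> ennreal (K * weak_const \<alpha> 1 * \<rho> powr (- \<alpha>))"
proof (rule near_decay_imp_integral_bound[OF _ _ \<alpha>(1) \<alpha>_less_1 assms(2)])
  show "measure lebesgue {e<..<m} \<le> K" using assms by simp
  fix r assume r: "0 < r" "r \<le> \<rho>"
  have "measure lebesgue {x\<in>{e<..<m}. infdist x E < r} \<le> measure lebesgue {e<..<e+r}"
  proof (rule measure_mono_bounded)
    show "{x\<in>{e<..<m}. infdist x E < r} \<subseteq> {e<..<e+r}" using gap r by force
    show "{x\<in>{e<..<m}. infdist x E < r} \<in> sets lebesgue" by (rule infdist_level_set_meas) simp
  qed auto
  also have "\<dots> = \<rho> * (r / \<rho>)" using r by simp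
  also have "\<dots> \<le> K * (r / \<rho>)" using r assms by (intro mult_right_mono) auto
  finally show "measure lebesgue {x\<in>{e<..<m}. infdist x E < r} \<le> K * (r / \<rho>) powr 1" using r by simp
qed auto

lemma integral_left_finite:
  assumes e: "e \<in> closure E" and H: "0 < H"
  shows "(\<integral>\<^sup>+x\<in>{e-H<..<e}. ennreal (w x) \<partial>lebesgue) < \<infinity>"
proof -
  obtain \<rho> where "0 < \<rho>" "measure lebesgue {y\<in>{e<..<e+H}. infdist y E \<le> \<rho>} < s * H"
    using small_neighbourhood_measure[OF E null, of "{e<..<e+H}" "s * H"] s H by auto
  from integral_left_of_point[OF e H this] show ?thesis by (rule le_less_trans) simp
qed

text \<open>
  Points of the closure control the integral on their left. On the right of all points of \<open>E\<close>, the
  weight is a power of the distance to the last point of the closure, and \<open>\<alpha> < 1\<close>.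
\<close>

lemma integral_finite: "(\<integral>\<^sup>+x\<in>{a..b}. dist_weight E \<alpha> x \<partial>lebesgue) < \<infinity>"
proof -
  note split = set_nn_integral_le_of_cover[OF real_dist_weight_measurable_ennreal]
  have "(\<integral>\<^sup>+x\<in>{a..b}. ennreal (w x) \<partial>lebesgue) < \<infinity>"
  proof (cases "\<exists>e\<in>closure E. b \<le> e")
    case True
    then obtain e where e: "e \<in> closure E" "b \<le> e" by blast
    define H where "H = max 1 (e - a + 1)"
    have "(\<integral>\<^sup>+x\<in>{a..b}. ennreal (w x) \<partial>lebesgue) \<le> (\<integral>\<^sup>+x\<in>{e-H<..<e}. ennreal (w x) \<partial>lebesgue) + (\<integral>\<^sup>+x\<in>{}. ennreal (w x) \<partial>lebesgue)"
      by (rule split[where x = e]) (use e in \<open>auto simp: H_def\<close>)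
    also have "\<dots> < \<infinity>" using integral_left_finite[OF e(1), of H] by (simp add: H_def)
    finally show ?thesis .
  next
    case False
    then have lt: "y < b" if "y \<in> closure E" for y using that by force
    define e where "e = Sup (closure E)"
    have bdd: "bdd_above (closure E)" using lt by (auto intro!: bdd_aboveI less_imp_le)
    have ne: "closure E \<noteq> {}" using E by simp
    have e: "e \<in> closure E" unfolding e_def by (rule closed_contains_Sup[OF ne bdd]) simp
    have le_e: "y \<le> e" if "y \<in> closure E" for y unfolding e_def using that bdd by (rule cSup_upper)
    define H where "H = max 1 (e - a + 1)"
    have fin2: "(\<integral>\<^sup>+x\<in>{e<..<b+1}. ennreal (w x) \<partial>lebesgue) < \<infinity>"
    proof -
      have "(\<integral>\<^sup>+x\<in>{e<..<b+1}. ennreal (w x) \<partial>lebesgue) \<le> ennreal (max 1 (b + 1 - e) * weak_const \<alpha> 1 * 1 powr (- \<alpha>))"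
      proof (rule integral_right_of_point_in_gap)
        fix y assume "e < y"
        then have "y - e \<le> infdist y E"
          using le_e closure_subset[of E] by (intro le_infdistI[OF E]) (force simp: dist_real_def)
        then show "min (y - e) 1 \<le> infdist y E" by simp
      qed (use lt[OF e] in auto)
      then show ?thesis by (rule le_less_trans) simp
    qed
    have "(\<integral>\<^sup>+x\<in>{a..b}. ennreal (w x) \<partial>lebesgue) \<le> (\<integral>\<^sup>+x\<in>{e-H<..<e}. ennreal (w x) \<partial>lebesgue) + (\<integral>\<^sup>+x\<in>{e<..<b+1}. ennreal (w x) \<partial>lebesgue)"
      by (rule split[where x = e]) (auto simp: H_def)
    also have "\<dots> < \<infinity>" using integral_left_finite[OF e(1), of H] fin2 by (simp add: H_def)
    finally show ?thesis .
  qed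
  then show ?thesis using set_nn_integral_dist_weight[OF E null] by simp
qed

text \<open>
  The tolerance for moving centres: a proportion \<open>\<epsilon>\<close> of near points, enlarged by two displacements
  of an endpoint by \<open>\<epsilon>\<close> times the length, stays below the proportion \<open>s\<close>.
\<close>
definition \<epsilon> :: real where "\<epsilon> = s / 4"

lemma \<epsilon>_bounds: "0 < \<epsilon>" "\<epsilon> < 1 / 4" "s = 4 * \<epsilon>"
  using s by (auto simp: \<epsilon>_def)

text \<open>
  One summand for each of the cases of a point of the closure just on the right of the centre, no
  point of the closure nearby, and a gap around the centre (two summands).
\<close>
definition C2 :: real where
  "C2 = 2 * C1 + (\<epsilon> / (2 + \<epsilon>)) powr (- \<alpha>) + 3 * C1 * (\<epsilon> / 6) powr (- \<alpha>) + 2 * weak_const \<alpha> 1 * (\<epsilon> / 3) powr (- \<alpha>)"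

lemma C2_bounds:
  "0 < C2" "2 * C1 \<le> C2" "(\<epsilon> / (2 + \<epsilon>)) powr (- \<alpha>) \<le> C2"
  "3 * C1 * (\<epsilon> / 6) powr (- \<alpha>) + 2 * weak_const \<alpha> 1 * (\<epsilon> / 3) powr (- \<alpha>) \<le> C2"
proof -
  have "0 < C1" "0 \<le> 3 * C1 * (\<epsilon> / 6) powr (- \<alpha>)" "0 \<le> 2 * weak_const \<alpha> 1 * (\<epsilon> / 3) powr (- \<alpha>)"
    "0 \<le> (\<epsilon> / (2 + \<epsilon>)) powr (- \<alpha>)"
    using C1_pos weak_const_pos[OF \<alpha>(1) \<alpha>_less_1] by auto
  then show "0 < C2" "2 * C1 \<le> C2" "(\<epsilon> / (2 + \<epsilon>)) powr (- \<alpha>) \<le> C2"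
    "3 * C1 * (\<epsilon> / 6) powr (- \<alpha>) + 2 * weak_const \<alpha> 1 * (\<epsilon> / 3) powr (- \<alpha>) \<le> C2"
    unfolding C2_def by linarith+
qed

lemma integral_left_bound_point_on_right:
  assumes h: "0 < h" and \<rho>: "0 < \<rho>"
    and near: "measure lebesgue {y\<in>{m<..<m+h}. infdist y E \<le> \<rho>} < \<epsilon> * h"
    and e: "e \<in> closure E" "m \<le> e" "e < m + \<epsilon> * h"
  shows "(\<integral>\<^sup>+x\<in>{m-h<..<m}. ennreal (w x) \<partial>lebesgue) \<le> ennreal (C2 * h * \<rho> powr (- \<alpha>))"
proof -
  define H where "H = h + (e - m)"
  have "\<epsilon> * h < 1 * h" using \<epsilon>_bounds h by (intro mult_strict_right_mono) auto
  then have H: "h \<le> H" "H \<le> 2 * h" "e - H = m - h" using e by (auto simp: H_def)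
  let ?N = "\<lambda>u H. {y\<in>{u<..<u+H}. infdist y E \<le> \<rho>}"
  have "measure lebesgue (?N e H) \<le> measure lebesgue (?N m h \<union> {m+h..e+H})"
  proof (rule measure_mono_bounded)
    show "?N e H \<subseteq> ?N m h \<union> {m+h..e+H}" using e by auto
    show "bounded (?N m h \<union> {m+h..e+H})" by (intro bounded_Un[THEN iffD2] conjI bounded_restrict) auto
    show "?N m h \<union> {m+h..e+H} \<in> sets lebesgue" by (intro sets.Un infdist_level_set_meas) auto
  qed (rule infdist_level_set_meas, simp)
  also have "\<dots> \<le> measure lebesgue (?N m h) + measure lebesgue {m+h..e+H}"
    by (intro measure_Un_le infdist_level_set_meas) auto
  also have "measure lebesgue {m+h..e+H} = 2 * (e - m)" using e by (simp add: H_def)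
  also have "measure lebesgue (?N m h) + 2 * (e - m) < \<epsilon> * h + 2 * (\<epsilon> * h)"
    using near e by (intro add_strict_mono) auto
  also have "\<dots> \<le> s * h" using \<epsilon>_bounds h by simp
  also have "\<dots> \<le> s * H" using s H by (intro mult_left_mono) auto
  finally have "(\<integral>\<^sup>+x\<in>{e-H<..<e}. ennreal (w x) \<partial>lebesgue) \<le> ennreal (C1 * H * \<rho> powr (- \<alpha>))"
    using H h by (intro integral_left_of_point e \<rho>) auto
  moreover have "(\<integral>\<^sup>+x\<in>{m-h<..<m}. ennreal (w x) \<partial>lebesgue) \<le> (\<integral>\<^sup>+x\<in>{e-H<..<e}. ennreal (w x) \<partial>lebesgue)"
    using H e by (intro nn_integral_mono) (auto simp: indicator_def)
  moreover have "C1 * H * \<rho> powr (- \<alpha>) \<le> C2 * h * \<rho> powr (- \<alpha>)"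
  proof -
    have "C1 * H \<le> C1 * (2 * h)" using C1_pos H by (intro mult_left_mono) auto
    also have "\<dots> \<le> C2 * h" using mult_right_mono[OF C2_bounds(2), of h] h by (simp add: mult_ac)
    finally show ?thesis by (rule mult_right_mono) simp
  qed
  ultimately show ?thesis by (meson ennreal_leI order_trans)
qed

text \<open>
  On \<open>(m-h, m)\<close> the distance to \<open>E\<close> is at least \<open>\<epsilon> h\<close>, and it differs from the value at \<open>x1\<close>,
  which exceeds \<open>\<rho>\<close>, by at most \<open>2 h\<close>. So it is at least a fixed multiple of \<open>\<rho>\<close>.
\<close>

lemma integral_left_bound_far:
  assumes h: "0 < h" and \<rho>: "0 < \<rho>"
    and x1: "m < x1" "x1 < m + h" "\<rho> < infdist x1 E"
    and free: "closure E \<inter> {m-2*h<..<m+\<epsilon>*h} = {}"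
  shows "(\<integral>\<^sup>+x\<in>{m-h<..<m}. ennreal (w x) \<partial>lebesgue) \<le> ennreal (C2 * h * \<rho> powr (- \<alpha>))"
proof -
  define c where "c = \<epsilon> / (2 + \<epsilon>)"
  have c: "0 < c" using \<epsilon>_bounds by (simp add: c_def)
  have pw: "w y \<le> (c * \<rho>) powr (- \<alpha>)" if y: "m - h < y" "y < m" for y
  proof -
    have "\<epsilon> * h < 1 * h" using \<epsilon>_bounds h by (intro mult_strict_right_mono) auto
    have d1: "\<epsilon> * h \<le> infdist y E"
    proof (rule le_infdistI[OF E])
      fix z assume "z \<in> E"
      then have "z \<le> m - 2 * h \<or> m + \<epsilon> * h \<le> z" using free closure_subset[of E] by force
      then show "\<epsilon> * h \<le> dist y z" using y \<open>\<epsilon> * h < 1 * h\<close> unfolding dist_real_def by linarith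
    qed
    have "infdist x1 E \<le> infdist y E + dist x1 y" by (rule infdist_triangle)
    also have "dist x1 y \<le> 2 * h" using x1 y by (simp add: dist_real_def)
    finally have "\<rho> \<le> infdist y E + 2 * h" using x1 by linarith
    then have "\<epsilon> * \<rho> \<le> \<epsilon> * (infdist y E + 2 * h)" using \<epsilon>_bounds by (intro mult_left_mono) auto
    also have "\<dots> \<le> \<epsilon> * infdist y E + 2 * infdist y E" using d1 by (simp add: algebra_simps)
    finally have "c * \<rho> \<le> infdist y E" using \<epsilon>_bounds unfolding c_def by (simp add: field_simps)
    then show ?thesis unfolding real_dist_weight_def using c \<rho> \<alpha> by (intro powr_mono2') auto
  qed
  have "(\<integral>\<^sup>+x\<in>{m-h<..<m}. ennreal (w x) \<partial>lebesgue) \<le> (\<integral>\<^sup>+x. ennreal ((c * \<rho>) powr (- \<alpha>)) * indicator {m-h<..<m} x \<partial>lebesgue)"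
    using pw by (intro nn_integral_mono) (auto simp: indicator_def intro!: ennreal_leI)
  also have "\<dots> = ennreal ((c * \<rho>) powr (- \<alpha>)) * emeasure lebesgue {m-h<..<m}"
    by (rule nn_integral_cmult_indicator) auto
  also have "\<dots> = ennreal ((c * \<rho>) powr (- \<alpha>) * h)" using h by (simp add: ennreal_mult[symmetric])
  also have "\<dots> \<le> ennreal (C2 * h * \<rho> powr (- \<alpha>))"
  proof (rule ennreal_leI)
    have "(c * \<rho>) powr (- \<alpha>) * h = c powr (- \<alpha>) * (h * \<rho> powr (- \<alpha>))" using c \<rho> by (simp add: powr_mult)
    also have "\<dots> \<le> C2 * (h * \<rho> powr (- \<alpha>))"
      using C2_bounds(3) h unfolding c_def[symmetric] by (intro mult_right_mono) auto
    finally show "(c * \<rho>) powr (- \<alpha>) * h \<le> C2 * h * \<rho> powr (- \<alpha>)" by simp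
  qed
  finally show ?thesis .
qed

text \<open>
  The last point \<open>e\<close> of the closure before \<open>m\<close> serves as centre, with right half \<open>(e, m+h)\<close>. In the gap only
  points within \<open>\<rho>'\<close> of \<open>e\<close> are within \<open>\<rho>'\<close> of \<open>E\<close> when \<open>\<rho>' < \<epsilon> h\<close>, so the hypothesis survives the
  move of the centre. Nothing is lost by the smaller scale \<open>\<rho>'\<close>, since \<open>\<rho> < d x1 \<le> 3 h\<close>. The
  remaining integral over \<open>(e, m)\<close> is the explicit one over the gap.
\<close>

lemma integral_left_bound_gap:
  assumes h: "0 < h" and \<rho>: "0 < \<rho>"
    and near: "measure lebesgue {y\<in>{m<..<m+h}. infdist y E \<le> \<rho>} < \<epsilon> * h"
    and x1: "m < x1" "x1 < m + h" "\<rho> < infdist x1 E"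
    and e: "e \<in> closure E" "m - 2 * h \<le> e" "e < m"
    and free: "closure E \<inter> {e<..<m+\<epsilon>*h} = {}"
  shows "(\<integral>\<^sup>+x\<in>{m-h<..<m}. ennreal (w x) \<partial>lebesgue) \<le> ennreal (C2 * h * \<rho> powr (- \<alpha>))"
proof -
  define H where "H = m + h - e"
  define \<rho>' where "\<rho>' = min \<rho> (\<epsilon> * h / 2)"
  have H: "h < H" "H \<le> 3 * h" "e + H = m + h" using e by (auto simp: H_def)
  have eh: "0 < \<epsilon> * h" "\<epsilon> * h \<le> 2 * h" using \<epsilon>_bounds h by (auto intro: mult_right_mono)
  have \<rho>': "0 < \<rho>'" "\<rho>' \<le> \<rho>" "\<rho>' < \<epsilon> * h" "\<rho>' \<le> \<epsilon> * h / 2" using eh \<rho> by (auto simp: \<rho>'_def)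
  have gap: "min (y - e) (\<epsilon> * h) \<le> infdist y E" if y: "e < y" "y < m" for y
  proof (rule le_infdistI[OF E])
    fix z assume "z \<in> E"
    then have "z \<le> e \<or> m + \<epsilon> * h \<le> z" using free closure_subset[of E] by force
    then show "min (y - e) (\<epsilon> * h) \<le> dist y z" using y unfolding dist_real_def by linarith
  qed
  have \<rho>_le: "\<rho> \<le> 3 * h" using infdist_le_closure[OF e(1), of x1] x1 e by linarith
  have \<rho>'_ge: "\<epsilon> / 6 * \<rho> \<le> \<rho>'"
  proof -
    have "\<epsilon> / 6 * \<rho> \<le> 1 * \<rho>" using \<epsilon>_bounds \<rho> by (intro mult_right_mono) auto
    moreover have "\<epsilon> / 6 * \<rho> \<le> \<epsilon> / 6 * (3 * h)" using \<epsilon>_bounds \<rho>_le by (intro mult_left_mono) auto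
    moreover have "\<epsilon> / 6 * (3 * h) = \<epsilon> * h / 2" by simp
    ultimately show ?thesis unfolding \<rho>'_def by linarith
  qed
  let ?N = "{y\<in>{m<..<m+h}. infdist y E \<le> \<rho>}"
  have "measure lebesgue {y\<in>{e<..<e+H}. infdist y E \<le> \<rho>'} \<le> measure lebesgue (?N \<union> ({e..e+\<rho>'} \<union> {m}))"
  proof (rule measure_mono_bounded)
    show "{y\<in>{e<..<e+H}. infdist y E \<le> \<rho>'} \<subseteq> ?N \<union> ({e..e+\<rho>'} \<union> {m})"
    proof
      fix y assume y: "y \<in> {y\<in>{e<..<e+H}. infdist y E \<le> \<rho>'}"
      consider "y < m" | "y = m" | "m < y" by linarith
      then show "y \<in> ?N \<union> ({e..e+\<rho>'} \<union> {m})"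
      proof cases
        case 1
        then have "min (y - e) (\<epsilon> * h) \<le> \<rho>'" using gap[of y] y by auto
        then have "y \<le> e + \<rho>'" using \<rho>' by linarith
        then show ?thesis using y by auto
      next
        case 3 then show ?thesis using y H \<rho>' by auto
      qed simp
    qed
    show "bounded (?N \<union> ({e..e+\<rho>'} \<union> {m}))" by (intro bounded_Un[THEN iffD2] conjI bounded_restrict) auto
    show "?N \<union> ({e..e+\<rho>'} \<union> {m}) \<in> sets lebesgue" by (intro sets.Un infdist_level_set_meas) auto
  qed (rule infdist_level_set_meas, simp)
  also have "\<dots> \<le> measure lebesgue ?N + measure lebesgue ({e..e+\<rho>'} \<union> {m})"
    by (intro measure_Un_le infdist_level_set_meas sets.Un) auto
  also have "measure lebesgue ({e..e+\<rho>'} \<union> {m}) \<le> measure lebesgue {e..e+\<rho>'} + measure lebesgue {m}"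
    by (rule measure_Un_le) auto
  also have "\<dots> = \<rho>'" using \<rho>' by simp
  also have "measure lebesgue ?N + \<rho>' < \<epsilon> * h + \<epsilon> * h" using near \<rho>' by linarith
  also have "\<dots> \<le> s * h" using \<epsilon>_bounds h by simp
  also have "\<dots> \<le> s * H" using s H by (intro mult_left_mono) auto
  finally have I1: "(\<integral>\<^sup>+x\<in>{e-H<..<e}. ennreal (w x) \<partial>lebesgue) \<le> ennreal (C1 * H * \<rho>' powr (- \<alpha>))"
    using H h by (intro integral_left_of_point e \<rho>') auto
  have I2: "(\<integral>\<^sup>+x\<in>{e<..<m}. ennreal (w x) \<partial>lebesgue) \<le> ennreal (2 * h * weak_const \<alpha> 1 * (\<epsilon> * h) powr (- \<alpha>))"
    by (rule integral_right_of_point_in_gap) (use e eh gap in auto)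
  have "(\<integral>\<^sup>+x\<in>{m-h<..<m}. ennreal (w x) \<partial>lebesgue) \<le>
    (\<integral>\<^sup>+x\<in>{e-H<..<e}. ennreal (w x) \<partial>lebesgue) + (\<integral>\<^sup>+x\<in>{e<..<m}. ennreal (w x) \<partial>lebesgue)"
    by (rule set_nn_integral_le_of_cover[OF real_dist_weight_measurable_ennreal, where x = e])
       (use e h in \<open>auto simp: H_def\<close>)
  also have "\<dots> \<le> ennreal (C1 * H * \<rho>' powr (- \<alpha>)) + ennreal (2 * h * weak_const \<alpha> 1 * (\<epsilon> * h) powr (- \<alpha>))"
    by (intro add_mono I1 I2)
  also have "\<dots> = ennreal (C1 * H * \<rho>' powr (- \<alpha>) + 2 * h * weak_const \<alpha> 1 * (\<epsilon> * h) powr (- \<alpha>))"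
    using C1_pos H h weak_const_pos[OF \<alpha>(1) \<alpha>_less_1] by (intro ennreal_plus[symmetric]) auto
  also have "\<dots> \<le> ennreal (C2 * h * \<rho> powr (- \<alpha>))"
  proof (rule ennreal_leI)
    have "C1 * H * \<rho>' powr (- \<alpha>) \<le> C1 * (3 * h) * (\<epsilon> / 6 * \<rho>) powr (- \<alpha>)"
      using C1_pos H h \<rho>'_ge \<alpha> \<epsilon>_bounds \<rho> by (intro mult_mono powr_mono2') auto
    also have "(\<epsilon> / 6 * \<rho>) powr (- \<alpha>) = (\<epsilon> / 6) powr (- \<alpha>) * \<rho> powr (- \<alpha>)" by (rule powr_mult)
    finally have 1: "C1 * H * \<rho>' powr (- \<alpha>) \<le> 3 * C1 * (\<epsilon> / 6) powr (- \<alpha>) * (h * \<rho> powr (- \<alpha>))"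
      by (simp add: mult_ac)
    have "\<epsilon> / 3 * \<rho> \<le> \<epsilon> / 3 * (3 * h)" using \<epsilon>_bounds \<rho>_le by (intro mult_left_mono) auto
    then have "(\<epsilon> * h) powr (- \<alpha>) \<le> (\<epsilon> / 3 * \<rho>) powr (- \<alpha>)"
      using \<alpha> \<epsilon>_bounds \<rho> by (intro powr_mono2') auto
    also have "\<dots> = (\<epsilon> / 3) powr (- \<alpha>) * \<rho> powr (- \<alpha>)" by (rule powr_mult)
    finally have "2 * h * weak_const \<alpha> 1 * (\<epsilon> * h) powr (- \<alpha>) \<le> 2 * h * weak_const \<alpha> 1 * ((\<epsilon> / 3) powr (- \<alpha>) * \<rho> powr (- \<alpha>))"
      using h weak_const_pos[OF \<alpha>(1) \<alpha>_less_1] by (intro mult_left_mono) auto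
    then have 2: "2 * h * weak_const \<alpha> 1 * (\<epsilon> * h) powr (- \<alpha>) \<le> 2 * weak_const \<alpha> 1 * (\<epsilon> / 3) powr (- \<alpha>) * (h * \<rho> powr (- \<alpha>))"
      by (simp add: mult_ac)
    have "C1 * H * \<rho>' powr (- \<alpha>) + 2 * h * weak_const \<alpha> 1 * (\<epsilon> * h) powr (- \<alpha>)
      \<le> (3 * C1 * (\<epsilon> / 6) powr (- \<alpha>) + 2 * weak_const \<alpha> 1 * (\<epsilon> / 3) powr (- \<alpha>)) * (h * \<rho> powr (- \<alpha>))"
      using add_mono[OF 1 2] by (simp only: distrib_right)
    also have "\<dots> \<le> C2 * (h * \<rho> powr (- \<alpha>))" using h by (intro mult_right_mono C2_bounds) auto
    finally show "C1 * H * \<rho>' powr (- \<alpha>) + 2 * h * weak_const \<alpha> 1 * (\<epsilon> * h) powr (- \<alpha>) \<le> C2 * h * \<rho> powr (- \<alpha>)"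
      by simp
  qed
  finally show ?thesis .
qed

text \<open>
  The bound for intervals centred on the closure, transferred to an arbitrary centre \<open>m\<close>.
\<close>

lemma integral_left_bound:
  assumes h: "0 < h" and \<rho>: "0 < \<rho>"
    and near: "measure lebesgue {y\<in>{m<..<m+h}. infdist y E \<le> \<rho>} < \<epsilon> * h"
  shows "(\<integral>\<^sup>+x\<in>{m-h<..<m}. ennreal (w x) \<partial>lebesgue) \<le> ennreal (C2 * h * \<rho> powr (- \<alpha>))"
proof -
  have "\<exists>x1. m < x1 \<and> x1 < m + h \<and> \<rho> < infdist x1 E"
  proof (rule ccontr)
    assume "\<not> ?thesis"
    then have "{y\<in>{m<..<m+h}. infdist y E \<le> \<rho>} = {m<..<m+h}" by force
    then have "h < \<epsilon> * h" using near h by simp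
    moreover have "\<epsilon> * h \<le> 1 * h" using \<epsilon>_bounds h by (intro mult_right_mono) auto
    ultimately show False by simp
  qed
  then obtain x1 where x1: "m < x1" "x1 < m + h" "\<rho> < infdist x1 E" by blast
  consider (right) e where "e \<in> closure E" "m \<le> e" "e < m + \<epsilon> * h"
    | (gap) "closure E \<inter> {m..<m+\<epsilon>*h} = {}" "closure E \<inter> {m-2*h<..<m} \<noteq> {}"
    | (far) "closure E \<inter> {m..<m+\<epsilon>*h} = {}" "closure E \<inter> {m-2*h<..<m} = {}"
    by fastforce
  then show ?thesis
  proof cases
    case right
    then show ?thesis by (rule integral_left_bound_point_on_right[OF h \<rho> near])
  next
    case far
    have "closure E \<inter> {m-2*h<..<m+\<epsilon>*h} = {}"
    proof -
      have "{m-2*h<..<m+\<epsilon>*h} \<subseteq> {m..<m+\<epsilon>*h} \<union> {m-2*h<..<m}" by auto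
      then show ?thesis using far by blast
    qed
    then show ?thesis by (rule integral_left_bound_far[OF h \<rho> x1])
  next
    case gap
    let ?K = "closure E \<inter> {m-2*h..m}"
    define e where "e = Sup ?K"
    have bdd: "bdd_above ?K" by (auto intro: bdd_aboveI)
    have "?K \<noteq> {}" using gap(2) by fastforce
    then have eK: "e \<in> ?K" unfolding e_def by (intro closed_contains_Sup bdd) auto
    have le_e: "y \<le> e" if "y \<in> ?K" for y unfolding e_def using that bdd by (rule cSup_upper)
    have "e \<noteq> m"
    proof
      assume "e = m"
      then have "m \<in> closure E \<inter> {m..<m+\<epsilon>*h}" using eK \<epsilon>_bounds h by simp
      then show False using gap by blast
    qed
    then have e: "e \<in> closure E" "m - 2 * h \<le> e" "e < m" using eK by auto
    have "closure E \<inter> {e<..<m+\<epsilon>*h} = {}"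
    proof (rule ccontr)
      assume "\<not> ?thesis"
      then obtain y where y: "y \<in> closure E" "e < y" "y < m + \<epsilon> * h" by auto
      show False
      proof (cases "y < m")
        case True
        then show False using le_e[of y] y e by auto
      next
        case False
        then have "y \<in> closure E \<inter> {m..<m+\<epsilon>*h}" using y by auto
        then show False using gap by blast
      qed
    qed
    then show ?thesis by (rule integral_left_bound_gap[OF h \<rho> near x1 e])
  qed
qed

text \<open>
  The contrapositive of the \<open>A\<^sub>\<infinity>\<close> condition: if \<open>w \<ge> \<beta> l\<close> on too small a part of \<open>(m, m+h)\<close>, the
  previous bound with \<open>\<rho> powr (- \<alpha>) = \<beta> l\<close> makes the average on the left smaller than \<open>l\<close>.
\<close>

theorem exists_Ap_plus: "\<exists>p>1. dist_weight E \<alpha> \<in> Ap_plus p"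
proof -
  interpret regular_weight w "closure E"
    by (rule regular_real_dist_weight[OF E null integral_finite])
  define \<beta> where "\<beta> = min 1 (1 / (2 * C2))"
  have \<beta>: "0 < \<beta>" "\<beta> \<le> 1" "C2 * \<beta> < 1" using C2_bounds(1) by (auto simp: \<beta>_def min_def field_simps)
  have "A_inf \<beta> \<epsilon>"
    unfolding A_inf_def
  proof (intro allI impI)
    fix m h l :: real
    assume h: "0 < h" and l: "0 < l" and avg: "l * h \<le> mass (m - h) m"
    show "\<epsilon> * h \<le> measure lebesgue {x\<in>{m<..<m+h}. \<beta> * l \<le> w x}"
    proof (rule ccontr)
      assume contr: "\<not> ?thesis"
      define \<rho> where "\<rho> = (\<beta> * l) powr (- (1 / \<alpha>))"
      have bl: "0 < \<beta> * l" using \<beta> l by simp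
      have \<rho>: "0 < \<rho>" unfolding \<rho>_def powr_gt_zero using bl by linarith
      have \<rho>\<alpha>: "\<rho> powr (- \<alpha>) = \<beta> * l" unfolding \<rho>_def powr_powr using \<alpha> bl by simp
      have "measure lebesgue {y\<in>{m<..<m+h}. infdist y E \<le> \<rho>} \<le> measure lebesgue ({x\<in>{m<..<m+h}. \<beta> * l \<le> w x} \<union> closure E)"
      proof (rule measure_mono_fmeasurable)
        show "{y\<in>{m<..<m+h}. infdist y E \<le> \<rho>} \<subseteq> {x\<in>{m<..<m+h}. \<beta> * l \<le> w x} \<union> closure E"
        proof
          fix y assume y: "y \<in> {y\<in>{m<..<m+h}. infdist y E \<le> \<rho>}"
          show "y \<in> {x\<in>{m<..<m+h}. \<beta> * l \<le> w x} \<union> closure E"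
          proof (cases "y \<in> closure E")
            case False
            then have "0 < infdist y E" using infdist_pos_iff_closure[OF E] by blast
            then have "\<rho> powr (- \<alpha>) \<le> w y" unfolding real_dist_weight_def using y \<alpha> by (intro powr_mono2') auto
            then show ?thesis using y \<rho>\<alpha> by simp
          qed simp
        qed
        show "{y\<in>{m<..<m+h}. infdist y E \<le> \<rho>} \<in> sets lebesgue" by (rule infdist_level_set_meas) simp
        have "{x\<in>{m<..<m+h}. \<beta> * l \<le> w x} \<in> lmeasurable"
          by (intro bounded_set_imp_lmeasurable level_set_meas bounded_restrict) auto
        then show "{x\<in>{m<..<m+h}. \<beta> * l \<le> w x} \<union> closure E \<in> lmeasurable"
          using fmeasurableI_null_sets[OF null] by (rule fmeasurable.Un)
      qed
      also have "\<dots> = measure lebesgue {x\<in>{m<..<m+h}. \<beta> * l \<le> w x}"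
        using null by (intro measure_Un_null_set level_set_meas) auto
      also have "\<dots> < \<epsilon> * h" using contr by simp
      finally have "measure lebesgue {y\<in>{m<..<m+h}. infdist y E \<le> \<rho>} < \<epsilon> * h" .
      from integral_left_bound[OF h \<rho> this]
      have "ennreal (mass (m - h) m) \<le> ennreal (C2 * h * \<rho> powr (- \<alpha>))"
        unfolding set_nn_integral_eq_mass .
      then have "mass (m - h) m \<le> C2 * h * \<rho> powr (- \<alpha>)"
        using C2_bounds(1) h by (subst (asm) ennreal_le_iff) auto
      then have "l * h \<le> C2 * \<beta> * (l * h)" using avg by (simp add: \<rho>\<alpha> mult_ac)
      moreover have "C2 * \<beta> * (l * h) < 1 * (l * h)" using \<beta>(3) l h by (intro mult_strict_right_mono) auto
      ultimately show False by simp
    qed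
  qed
  then show ?thesis
    by (rule A_inf_imp_Ap_plus[OF E null integral_finite]) (use \<epsilon>_bounds \<beta> in auto)
qed

end

theorem less_Mu_imp_Ap_plus:
  assumes E: "E \<noteq> {}" and \<alpha>: "0 < \<alpha>" and Mu: "ereal \<alpha> < Mu_inf_plus E"
  shows "\<exists>p>1. dist_weight E \<alpha> \<in> Ap_plus p"
proof -
  let ?P = "\<exists>s a b. 0 < s \<and> s < 1 \<and> a < b \<and> L_s s E a b = 0"
  have nP: "\<not> ?P"
  proof
    assume ?P
    then have "Mu_inf_plus E = 0" unfolding Mu_inf_plus_def by (rule if_P)
    then show False using Mu \<alpha> by simp
  qed
  from Mu obtain q s C where q: "\<alpha> < q" and s: "0 < s" "s < 1" and C: "0 < C"
    and decay: "\<forall>a b r. a < b \<and> (a + b) / 2 \<in> E \<and> 0 < r \<and> r \<le> L_s s E ((a+b)/2) b \<longrightarrow>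
             measure lebesgue ({a<..<(a+b)/2} \<inter> nbhd E r) / measure lebesgue {a<..<(a+b)/2}
               \<le> C * (r / L_s s E ((a+b)/2) b) powr q"
    unfolding Mu_inf_plus_def if_not_P[OF nP] less_Sup_iff by auto
  have "one_sided_decay E s C q"
    using decay \<alpha> q by (intro one_sided_decay_of_Mu[OF E s C]) auto
  moreover have "closure E \<in> null_sets lebesgue"
    using nP by (intro closure_null_of_L_s_pos[OF E]) blast
  ultimately interpret decay_set E s C q \<alpha>
    using E s C \<alpha> q by unfold_locales auto
  show ?thesis by (rule exists_Ap_plus)
qed

theorem theorem1p10:
  fixes E :: "real set" and \<alpha> :: real
  assumes "E \<noteq> {}" and "\<alpha> > 0"
  shows "(\<exists>p>1. dist_weight E \<alpha> \<in> Ap_plus p) \<longleftrightarrow> ereal \<alpha> < Mu_inf_plus E"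
  using Ap_plus_imp_less_Mu less_Mu_imp_Ap_plus assms by blast

end
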